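(* Let $Q$ be a finite quiver and let $Z$ be a set of paths in $Q$, each of length at least $2$, such that the pair $(Q,Z)$ is special. Let $V=V[1]\sqcup\dots\sqcup V[n]$ be the primitive-nerve partition of $(Q,Z)$, let $(R,\mathfrak{m},k)$ be a regular local ring of Krull dimension $n$ (the number of parts of the partition), and let $(s_1,\dots,s_n)$ be a regular sequence generating $\mathfrak{m}$. For $v\in V$ let $\sigma_v\in RQ$ be the sum of the $Z$-primitive cycles at $v$. Let $I$ be the two-sided ideal of the path algebra $RQ$ given by $$I=\langle Z\rangle+\sum_{i=1}^{n}\Big(\langle s_ie_v-\sigma_v \mid v\in V[i]\rangle+\langle s_ie_v\mid v\in Q_0\setminus V[i]\rangle\Big).$$ Then every $Z$-admissible path lies outside $I$, and if $Q$ is biserial then $RQ/I$ is a string algebra over $R$.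
   Context: Quivers and paths. $Q=(Q_0,Q_1,h,t)$ has finite sets $Q_0$ of vertices and $Q_1$ of arrows; an arrow $a$ has head $h(a)$ and tail $t(a)$. Each vertex $v$ has a trivial path $e_v$ of length $0$ with head and tail $v$. A non-trivial path of length $n\ge1$ is $a_n\dots a_1$ with arrows satisfying $t(a_{i+1})=h(a_i)$; its head is $h(a_n)$ and its tail is $t(a_1)$. The product $pq$ in the path algebra $RQ$ (free $R$-module on the paths) is the composite path if $t(p)=h(q)$ and $0$ otherwise. A cycle is a non-trivial path whose head and tail coincide; it is "at $v$" if this common vertex is $v$. $\langle\,\cdot\,\rangle$ denotes the two-sided ideal generated. Special pairs. $(Q,Z)$ is special if for every arrow $b$ there is at most one arrow $a$ with $t(a)=h(b)$ and $ab\notin Z$, and at most one arrow $c$ with $h(c)=t(b)$ and $bc\notin Z$. Admissible paths and primitive cycles. A path is $Z$-inadmissible if it has the form $pzq$ with $p,q$ paths and $z\in Z$; otherwise it is $Z$-admissible. A cycle $c$ is $Z$-primitive if every power $c^m$ ($m\ge1$) is $Z$-admissible and $c$ is not of the form $d^m$ with $m>1$ for a ($Z$-admissible) cycle $d$ of shorter length. Primitive-nerve partition. For a non-trivial path $p=a_n\dots a_1$ let $V(p)=\{h(a_n),t(a_1)\}\cup\{h(a_i)\mid 1\le i<n\}$, the set of vertices traversed by $p$. Let $V=\bigcup_cV(c)$ with $c$ running over the $Z$-primitive cycles. The primitive-nerve partition $V=V[1]\sqcup\dots\sqcup V[n]$ is the partition into equivalence classes of the transitive closure of the reflexive symmetric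 relation $\bigcup_cV(c)\times V(c)$ on $V$. String algebras over $R$. $Q$ is biserial if each vertex is the head of at most two arrows and the tail of at most two arrows. Let $\mathfrak{m}Q$ be the kernel of the canonical map $RQ\to kQ$ (the $R$-linear combinations of paths with coefficients in $\mathfrak{m}$), $A_\ell\subseteq RQ$ the $R$-span of the paths of length $\ell$, and $A=\bigoplus_{\ell\ge1}A_\ell$. An ideal $I$ of $RQ$ is: - admissible if there are integers $m,n'>0$ with $I\subseteq A+\mathfrak{m}Q$, $I\cap A\subseteq A^2+(\mathfrak{m}Q\cap A)$, $A^m\subseteq I+\mathfrak{m}Q$, and $\mathfrak{m}Q\subseteq I+\sum_{\ell=1}^{n'}A_\ell$; - special if for any arrow $b$ there is at most one arrow $a$ with $t(a)=h(b)$ and $ab\notin I$, and at most one arrow $c$ with $h(c)=t(b)$ and $bc\notin I$; - arrow-direct if for any arrow $a$ we have $RQa\cap\sum_xRQx\subseteq I$ and $aRQ\cap\sum_yyRQ\subseteq I$, where $x$ runs over the arrows $x\ne a$ with $t(x)=t(a)$ and $y$ over the arrows $y\neq a$ with $h(y)=h(a)$. A string algebra over a local ring $R$ is an $R$-algebra of the form $RQ/I$ with $Q$ a biserial quiver and $I$ an ideal of $RQ$ that is admissible, special and arrow-direct. *)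

theory Defs
  imports
    "Graph_Theory.Arc_Walk"
    "HOL-Algebra.Ideal_Product"
    "HOL-Algebra.QuotRing"
    "HOL-Algebra.Ring_Divisibility"
    "HOL-Algebra.Module"
    "HOL-Library.Extended_Nat"
begin

section \<open>Quivers and paths\<close>

text \<open>
  A finite quiver is a \<^locale>\<open>fin_digraph\<close> (finitely many vertices and arrows; loops and multiple
  arrows allowed). A path is a pair of its tail and the list of its arrows in the order of
  traversal: \<open>a\<^sub>n \<dots> a\<^sub>1\<close> is \<open>(t(a\<^sub>1), [a\<^sub>1, \<dots>, a\<^sub>n])\<close> and \<open>e\<^sub>v\<close> is \<open>(v, [])\<close>.
\<close>

type_synonym ('v, 'e) qpath = "'v \<times> 'e list"

definition path_tail :: "('v, 'e) qpath \<Rightarrow> 'v" where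
  "path_tail p = fst p"

definition path_head :: "('v, 'e) pre_digraph \<Rightarrow> ('v, 'e) qpath \<Rightarrow> 'v" where
  "path_head Q p = last (pre_digraph.awalk_verts Q (fst p) (snd p))"

definition path_length :: "('v, 'e) qpath \<Rightarrow> nat" where
  "path_length p = length (snd p)"

definition paths :: "('v, 'e) pre_digraph \<Rightarrow> ('v, 'e) qpath set" where
  "paths Q = {p. pre_digraph.awalk Q (path_tail p) (snd p) (path_head Q p)}"

definition trivial_path :: "'v \<Rightarrow> ('v, 'e) qpath" where
  "trivial_path v = (v, [])"

definition arrow_path :: "('v, 'e) pre_digraph \<Rightarrow> 'e \<Rightarrow> ('v, 'e) qpath" where
  "arrow_path Q a = (tail Q a, [a])"

text \<open>The composite \<open>pq\<close> (first \<open>q\<close>, then \<open>p\<close>); meaningful if \<open>path_tail p = path_head Q q\<close>.\<close>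

definition path_comp :: "('v, 'e) qpath \<Rightarrow> ('v, 'e) qpath \<Rightarrow> ('v, 'e) qpath" where
  "path_comp p q = (fst q, snd q @ snd p)"

definition path_power :: "('v, 'e) qpath \<Rightarrow> nat \<Rightarrow> ('v, 'e) qpath" where
  "path_power p m = (fst p, concat (replicate m (snd p)))"

definition cycle :: "('v, 'e) pre_digraph \<Rightarrow> ('v, 'e) qpath \<Rightarrow> bool" where
  "cycle Q c \<longleftrightarrow> c \<in> paths Q \<and> path_length c \<ge> 1 \<and> path_head Q c = path_tail c"

definition biserial :: "('v, 'e) pre_digraph \<Rightarrow> bool" where
  "biserial Q \<longleftrightarrow> (\<forall>v \<in> verts Q. in_degree Q v \<le> 2 \<and> out_degree Q v \<le> 2)"


section \<open>Special pairs, primitive cycles and the primitive-nerve partition\<close>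

definition special_pair :: "('v, 'e) pre_digraph \<Rightarrow> ('v, 'e) qpath set \<Rightarrow> bool" where
  "special_pair Q Z \<longleftrightarrow> (\<forall>b \<in> arcs Q.
     (\<exists>\<^sub>\<le>\<^sub>1 a. a \<in> arcs Q \<and> tail Q a = head Q b \<and>
        path_comp (arrow_path Q a) (arrow_path Q b) \<notin> Z) \<and>
     (\<exists>\<^sub>\<le>\<^sub>1 c. c \<in> arcs Q \<and> head Q c = tail Q b \<and>
        path_comp (arrow_path Q b) (arrow_path Q c) \<notin> Z))"

definition inadmissible_path ::
    "('v, 'e) pre_digraph \<Rightarrow> ('v, 'e) qpath set \<Rightarrow> ('v, 'e) qpath \<Rightarrow> bool" where
  "inadmissible_path Q Z x \<longleftrightarrow> (\<exists>p \<in> paths Q. \<exists>z \<in> Z. \<exists>q \<in> paths Q.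
     path_tail p = path_head Q z \<and> path_tail z = path_head Q q \<and>
     x = path_comp p (path_comp z q))"

definition admissible_path ::
    "('v, 'e) pre_digraph \<Rightarrow> ('v, 'e) qpath set \<Rightarrow> ('v, 'e) qpath \<Rightarrow> bool" where
  "admissible_path Q Z x \<longleftrightarrow> x \<in> paths Q \<and> \<not> inadmissible_path Q Z x"

definition primitive_cycle ::
    "('v, 'e) pre_digraph \<Rightarrow> ('v, 'e) qpath set \<Rightarrow> ('v, 'e) qpath \<Rightarrow> bool" where
  "primitive_cycle Q Z c \<longleftrightarrow> cycle Q c \<and>
     (\<forall>m \<ge> 1. admissible_path Q Z (path_power c m)) \<and>
     \<not> (\<exists>d m. m > 1 \<and> cycle Q d \<and> admissible_path Q Z d \<and>
          path_length d < path_length c \<and> c = path_power d m)"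

definition traversed_vertices :: "('v, 'e) pre_digraph \<Rightarrow> ('v, 'e) qpath \<Rightarrow> 'v set" where
  "traversed_vertices Q p = set (pre_digraph.awalk_verts Q (fst p) (snd p))"

definition primitive_vertices :: "('v, 'e) pre_digraph \<Rightarrow> ('v, 'e) qpath set \<Rightarrow> 'v set" where
  "primitive_vertices Q Z = (\<Union>c \<in> {c. primitive_cycle Q Z c}. traversed_vertices Q c)"

definition primitive_nerve_partition ::
    "('v, 'e) pre_digraph \<Rightarrow> ('v, 'e) qpath set \<Rightarrow> 'v set set" where
  "primitive_nerve_partition Q Z = primitive_vertices Q Z //
     (\<Union>c \<in> {c. primitive_cycle Q Z c}. traversed_vertices Q c \<times> traversed_vertices Q c)\<^sup>+"


section \<open>The path algebra\<close>

definition path_factorizations ::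
    "('v, 'e) pre_digraph \<Rightarrow> ('v, 'e) qpath \<Rightarrow> (('v, 'e) qpath \<times> ('v, 'e) qpath) set" where
  "path_factorizations Q x = {(p, q). p \<in> paths Q \<and> q \<in> paths Q \<and>
     path_tail p = path_head Q q \<and> path_comp p q = x}"

text \<open>
  An element of \<open>RQ\<close> is its coefficient function, which is finitely supported and vanishes off the
  paths. The multiplication is the bilinear extension of the product of paths; the unit is
  \<open>\<Sum>\<^sub>v e\<^sub>v\<close>.
\<close>

definition path_algebra ::
    "('r, 'm) ring_scheme \<Rightarrow> ('v, 'e) pre_digraph \<Rightarrow> ('r, ('v, 'e) qpath \<Rightarrow> 'r) module" where
  "path_algebra R Q =
    \<lparr> carrier = {f. (\<forall>x. f x \<in> carrier R) \<and> (\<forall>x. x \<notin> paths Q \<longrightarrow> f x = \<zero>\<^bsub>R\<^esub>) \<and>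
                    finite {x. f x \<noteq> \<zero>\<^bsub>R\<^esub>}},
      monoid.mult = (\<lambda>f g x. \<Oplus>\<^bsub>R\<^esub> pq \<in> path_factorizations Q x. f (fst pq) \<otimes>\<^bsub>R\<^esub> g (snd pq)),
      one = (\<lambda>x. if x \<in> trivial_path ` verts Q then \<one>\<^bsub>R\<^esub> else \<zero>\<^bsub>R\<^esub>),
      zero = (\<lambda>x. \<zero>\<^bsub>R\<^esub>),
      add = (\<lambda>f g x. f x \<oplus>\<^bsub>R\<^esub> g x),
      module.smult = (\<lambda>r f x. r \<otimes>\<^bsub>R\<^esub> f x) \<rparr>"

text \<open>The path \<open>p\<close> as an element of \<open>RQ\<close>.\<close>

definition path_elem :: "('r, 'm) ring_scheme \<Rightarrow> ('v, 'e) qpath \<Rightarrow> ('v, 'e) qpath \<Rightarrow> 'r" where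
  "path_elem R p = (\<lambda>x. if x = p then \<one>\<^bsub>R\<^esub> else \<zero>\<^bsub>R\<^esub>)"

definition arrow_elem ::
    "('r, 'm) ring_scheme \<Rightarrow> ('v, 'e) pre_digraph \<Rightarrow> 'e \<Rightarrow> ('v, 'e) qpath \<Rightarrow> 'r" where
  "arrow_elem R Q a = path_elem R (arrow_path Q a)"

text \<open>
  The \<open>R\<close>-span of the paths in \<open>P\<close>. So \<open>A\<^sub>\<ell>\<close> is the span of the paths of length \<open>\<ell>\<close>, and \<open>A\<close> and
  \<open>A\<^sub>1 + \<dots> + A\<^sub>n\<close> are the spans of the paths of length at least \<open>1\<close> and between \<open>1\<close> and \<open>n\<close>.
\<close>

definition path_span ::
    "('r, 'm) ring_scheme \<Rightarrow> ('v, 'e) pre_digraph \<Rightarrow> ('v, 'e) qpath set \<Rightarrow>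
      (('v, 'e) qpath \<Rightarrow> 'r) set" where
  "path_span R Q P = {f \<in> carrier (path_algebra R Q). \<forall>x. f x \<noteq> \<zero>\<^bsub>R\<^esub> \<longrightarrow> x \<in> P}"

definition arrow_ideal ::
    "('r, 'm) ring_scheme \<Rightarrow> ('v, 'e) pre_digraph \<Rightarrow> (('v, 'e) qpath \<Rightarrow> 'r) set" where
  "arrow_ideal R Q = path_span R Q {p. path_length p \<ge> 1}"

text \<open>\<open>\<mm>Q\<close>, the elements of \<open>RQ\<close> with all coefficients in \<open>\<mm>\<close>.\<close>

definition coeff_ideal ::
    "('r, 'm) ring_scheme \<Rightarrow> 'r set \<Rightarrow> ('v, 'e) pre_digraph \<Rightarrow> (('v, 'e) qpath \<Rightarrow> 'r) set" where
  "coeff_ideal R \<mm> Q = {f \<in> carrier (path_algebra R Q). \<forall>x. f x \<in> \<mm>}"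

lemma path_comp_simps [simp]:
  "fst (path_comp p q) = fst q" "snd (path_comp p q) = snd q @ snd p"
  by (simp_all add: path_comp_def)

lemma path_comp_assoc: "path_comp (path_comp p q) r = path_comp p (path_comp q r)"
  by (simp add: path_comp_def)

lemma (in fin_digraph) path_head_comp:
  assumes "p \<in> paths G" "q \<in> paths G" "path_tail p = path_head G q"
  shows "path_head G (path_comp p q) = path_head G p" "path_comp p q \<in> paths G"
proof -
  have "awalk (fst q) (snd q @ snd p) (path_head G p)"
    using assms by (auto simp: paths_def path_tail_def intro: awalk_appendI)
  then show "path_head G (path_comp p q) = path_head G p" "path_comp p q \<in> paths G"
    by (auto simp: paths_def path_head_def path_tail_def)
qed

lemma (in fin_digraph) finite_path_factorizations: "finite (path_factorizations G x)"
proof (rule finite_subset)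
  let ?f = "\<lambda>i. ((path_head G (fst x, take i (snd x)), drop i (snd x)), (fst x, take i (snd x)))"
  show "path_factorizations G x \<subseteq> ?f ` {..length (snd x)}"
  proof
    fix z assume "z \<in> path_factorizations G x"
    then obtain p q where z: "z = (p, q)" "path_tail p = path_head G q" "path_comp p q = x"
      by (auto simp: path_factorizations_def)
    have "z = ?f (length (snd q))"
      using z by (cases p; cases q) (auto simp: path_tail_def path_comp_def)
    then show "z \<in> ?f ` {..length (snd x)}"
      using z(3) by (intro image_eqI[of _ _ "length (snd q)"]) (auto simp: path_comp_def)
  qed
qed simp

lemma ring_path_algebra:
  fixes Q :: "('v, 'e) pre_digraph"
  assumes "cring R" "fin_digraph Q"
  shows "ring (path_algebra R Q)"
proof -
  interpret R: cring R by fact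
  interpret Q: fin_digraph Q by fact
  let ?A = "path_algebra R Q" and ?F = "path_factorizations Q"
  note finF = Q.finite_path_factorizations
  have car: "f \<in> carrier ?A \<longleftrightarrow> (\<forall>x. f x \<in> carrier R) \<and> (\<forall>x. x \<notin> paths Q \<longrightarrow> f x = \<zero>\<^bsub>R\<^esub>) \<and>
     finite {x. f x \<noteq> \<zero>\<^bsub>R\<^esub>}" for f by (simp add: path_algebra_def)
  have carD: "f x \<in> carrier R" if "f \<in> carrier ?A" for f x
    using that by (simp only: car)
  have mul: "f \<otimes>\<^bsub>?A\<^esub> g = (\<lambda>x. \<Oplus>\<^bsub>R\<^esub> pq \<in> ?F x. f (fst pq) \<otimes>\<^bsub>R\<^esub> g (snd pq))" for f g
    by (simp add: path_algebra_def)
  have pl: "f \<oplus>\<^bsub>?A\<^esub> g = (\<lambda>x. f x \<oplus>\<^bsub>R\<^esub> g x)" for f g by (simp add: path_algebra_def)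
  have ze: "\<zero>\<^bsub>?A\<^esub> = (\<lambda>x. \<zero>\<^bsub>R\<^esub>)" by (simp add: path_algebra_def)
  have on: "\<one>\<^bsub>?A\<^esub> = (\<lambda>x. if x \<in> trivial_path ` verts Q then \<one>\<^bsub>R\<^esub> else \<zero>\<^bsub>R\<^esub>)"
    by (simp add: path_algebra_def)
  have ab: "abelian_group ?A"
  proof (rule abelian_groupI)
    fix f g assume f: "f \<in> carrier ?A" and g: "g \<in> carrier ?A"
    have "{x. f x \<oplus>\<^bsub>R\<^esub> g x \<noteq> \<zero>\<^bsub>R\<^esub>} \<subseteq> {x. f x \<noteq> \<zero>\<^bsub>R\<^esub>} \<union> {x. g x \<noteq> \<zero>\<^bsub>R\<^esub>}"
      by auto
    then show "f \<oplus>\<^bsub>?A\<^esub> g \<in> carrier ?A"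
      using f g by (auto simp: car pl intro: finite_subset)
  next
    fix f assume f: "f \<in> carrier ?A"
    have "{x. \<ominus>\<^bsub>R\<^esub> f x \<noteq> \<zero>\<^bsub>R\<^esub>} \<subseteq> {x. f x \<noteq> \<zero>\<^bsub>R\<^esub>}"
      by auto
    then have "(\<lambda>x. \<ominus>\<^bsub>R\<^esub> f x) \<in> carrier ?A"
      using f by (auto simp: car intro: finite_subset)
    then show "\<exists>g\<in>carrier ?A. g \<oplus>\<^bsub>?A\<^esub> f = \<zero>\<^bsub>?A\<^esub>"
      using f by (auto simp: pl ze car R.l_neg intro!: bexI[of _ "\<lambda>x. \<ominus>\<^bsub>R\<^esub> f x"])
  qed (auto simp: car pl ze R.a_ac fun_eq_iff)
  have triv: "trivial_path ` verts Q \<subseteq> paths Q" and finv: "finite (trivial_path ` verts Q :: ('v,'e) qpath set)"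
    by (auto simp: trivial_path_def paths_def path_tail_def path_head_def Q.awalk_Nil_iff)
  have one: "\<one>\<^bsub>?A\<^esub> \<in> carrier ?A"
    using triv finv by (auto simp: car on)
  have mc: "f \<otimes>\<^bsub>?A\<^esub> g \<in> carrier ?A" if f: "f \<in> carrier ?A" and g: "g \<in> carrier ?A" for f g
  proof -
    have c: "(f \<otimes>\<^bsub>?A\<^esub> g) x \<in> carrier R" for x
      using f g unfolding mul car by (intro R.finsum_closed) auto
    have z: "\<exists>p q. x = path_comp p q \<and> f p \<noteq> \<zero>\<^bsub>R\<^esub> \<and> g q \<noteq> \<zero>\<^bsub>R\<^esub> \<and> x \<in> paths Q"
      if nz: "(f \<otimes>\<^bsub>?A\<^esub> g) x \<noteq> \<zero>\<^bsub>R\<^esub>" for x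
    proof (rule ccontr)
      assume n: "\<not> ?thesis"
      have "f (fst pq) \<otimes>\<^bsub>R\<^esub> g (snd pq) = \<zero>\<^bsub>R\<^esub>" if "pq \<in> ?F x" for pq
      proof -
        have x: "x = path_comp (fst pq) (snd pq)" "x \<in> paths Q"
          using that by (auto simp: path_factorizations_def Q.path_head_comp)
        then have "f (fst pq) = \<zero>\<^bsub>R\<^esub> \<or> g (snd pq) = \<zero>\<^bsub>R\<^esub>"
          using n by blast
        then show ?thesis by (metis carD f g R.l_null R.r_null)
      qed
      then have "(f \<otimes>\<^bsub>?A\<^esub> g) x = \<zero>\<^bsub>R\<^esub>"
        unfolding mul by (rule R.add.finprod_one_eqI[simplified])
      with nz show False by blast
    qed
    have fin: "finite ((\<lambda>(p, q). path_comp p q) ` ({x. f x \<noteq> \<zero>\<^bsub>R\<^esub>} \<times> {x. g x \<noteq> \<zero>\<^bsub>R\<^esub>}))"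
      using f g by (simp only: car finite_imageI finite_cartesian_product)
    have "finite {x. (f \<otimes>\<^bsub>?A\<^esub> g) x \<noteq> \<zero>\<^bsub>R\<^esub>}"
    proof (rule finite_subset[OF _ fin], rule subsetI)
      fix x assume "x \<in> {x. (f \<otimes>\<^bsub>?A\<^esub> g) x \<noteq> \<zero>\<^bsub>R\<^esub>}"
      then obtain p q where pq: "x = path_comp p q" "f p \<noteq> \<zero>\<^bsub>R\<^esub>" "g q \<noteq> \<zero>\<^bsub>R\<^esub>"
        using z[of x] by blast
      show "x \<in> (\<lambda>(p, q). path_comp p q) ` ({x. f x \<noteq> \<zero>\<^bsub>R\<^esub>} \<times> {x. g x \<noteq> \<zero>\<^bsub>R\<^esub>})"
        by (rule image_eqI[of _ _ "(p, q)"]) (simp_all only: pq prod.case mem_Sigma_iff mem_Collect_eq simp_thms)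
    qed
    moreover have "\<forall>x. x \<notin> paths Q \<longrightarrow> (f \<otimes>\<^bsub>?A\<^esub> g) x = \<zero>\<^bsub>R\<^esub>"
      using z by metis
    ultimately show ?thesis using c unfolding car by blast
  qed
  have "monoid ?A"
  proof (rule monoidI)
    fix f g h assume f: "f \<in> carrier ?A" and g: "g \<in> carrier ?A" and h: "h \<in> carrier ?A"
    show "(f \<otimes>\<^bsub>?A\<^esub> g) \<otimes>\<^bsub>?A\<^esub> h = f \<otimes>\<^bsub>?A\<^esub> (g \<otimes>\<^bsub>?A\<^esub> h)"
    proof
      fix x
      let ?t = "\<lambda>(p, q, r). f p \<otimes>\<^bsub>R\<^esub> (g q \<otimes>\<^bsub>R\<^esub> h r)"
      let ?B = "\<lambda>ur. (\<lambda>pq. (fst pq, snd pq, snd ur)) ` ?F (fst ur)"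
      let ?C = "\<lambda>pu. (\<lambda>qr. (fst pu, qr)) ` ?F (snd pu)"
      have fc: "f y \<in> carrier R" and gc: "g y \<in> carrier R" and hc: "h y \<in> carrier R" for y
        using f g h by (simp_all only: carD)
      have Fm: "pq \<in> ?F y \<longleftrightarrow> fst pq \<in> paths Q \<and> snd pq \<in> paths Q \<and>
          path_tail (fst pq) = path_head Q (snd pq) \<and> path_comp (fst pq) (snd pq) = y" for pq y
        by (simp add: path_factorizations_def case_prod_beta)
      have pt: "path_tail (path_comp p q) = path_tail q" for p q :: "('v, 'e) qpath"
        by (simp add: path_tail_def)
      have UN: "(\<Union>ur \<in> ?F x. ?B ur) = (\<Union>pu \<in> ?F x. ?C pu)"
      proof (intro equalityI subsetI)
        fix z assume "z \<in> (\<Union>ur \<in> ?F x. ?B ur)"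
        then obtain ur where ur: "ur \<in> ?F x" "z \<in> ?B ur" by blast
        then obtain pq where pq: "pq \<in> ?F (fst ur)" "z = (fst pq, snd pq, snd ur)" by blast
        have "path_tail (snd pq) = path_head Q (snd ur)"
          using ur(1) pq(1) pt unfolding Fm by metis
        then have "(fst pq, path_comp (snd pq) (snd ur)) \<in> ?F x"
          "(snd pq, snd ur) \<in> ?F (path_comp (snd pq) (snd ur))"
          using ur(1) pq(1) Q.path_head_comp[of "snd pq" "snd ur"] path_comp_assoc
          unfolding Fm fst_conv snd_conv by metis+
        then show "z \<in> (\<Union>pu \<in> ?F x. ?C pu)"
          unfolding pq(2) by (intro UN_I image_eqI) (assumption | simp)+
      next
        fix z assume "z \<in> (\<Union>pu \<in> ?F x. ?C pu)"
        then obtain pu where pu: "pu \<in> ?F x" "z \<in> ?C pu" by blast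
        then obtain qr where qr: "qr \<in> ?F (snd pu)" "z = (fst pu, qr)" by blast
        have "path_tail (fst pu) = path_head Q (fst qr)"
          using pu(1) qr(1) Q.path_head_comp[of "fst qr" "snd qr"] unfolding Fm by metis
        then have "(path_comp (fst pu) (fst qr), snd qr) \<in> ?F x"
          "(fst pu, fst qr) \<in> ?F (path_comp (fst pu) (fst qr))"
          using pu(1) qr(1) Q.path_head_comp[of "fst pu" "fst qr"] path_comp_assoc pt
          unfolding Fm fst_conv snd_conv by metis+
        then show "z \<in> (\<Union>ur \<in> ?F x. ?B ur)"
          unfolding qr(2)
          by (intro UN_I[of "(path_comp (fst pu) (fst qr), snd qr)"] image_eqI[of _ _ "(fst pu, fst qr)"])
             simp_all
      qed
      have B_disj: "pairwise (\<lambda>i j. disjnt (?B i) (?B j)) (?F x)"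
        unfolding pairwise_def disjnt_iff
      proof (intro ballI impI allI notI, elim conjE)
        fix i j z assume ij: "i \<noteq> j" "z \<in> ?B i" "z \<in> ?B j"
        from ij(2) obtain a where a: "a \<in> ?F (fst i)" "z = (fst a, snd a, snd i)" by blast
        from ij(3) obtain b where b: "b \<in> ?F (fst j)" "z = (fst b, snd b, snd j)" by blast
        have "fst i = fst j" using a b unfolding Fm by (metis Pair_inject)
        then show False using ij(1) a b by (simp add: prod_eq_iff)
      qed
      have C_disj: "pairwise (\<lambda>i j. disjnt (?C i) (?C j)) (?F x)"
        unfolding pairwise_def disjnt_iff
      proof (intro ballI impI allI notI, elim conjE)
        fix i j z assume ij: "i \<noteq> j" "z \<in> ?C i" "z \<in> ?C j"
        from ij(2) obtain a where a: "a \<in> ?F (snd i)" "z = (fst i, a)" by blast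
        from ij(3) obtain b where b: "b \<in> ?F (snd j)" "z = (fst j, b)" by blast
        have "snd i = snd j" using a b unfolding Fm by (metis Pair_inject)
        then show False using ij(1) a b by (simp add: prod_eq_iff)
      qed
      have "((f \<otimes>\<^bsub>?A\<^esub> g) \<otimes>\<^bsub>?A\<^esub> h) x
          = (\<Oplus>\<^bsub>R\<^esub> ur \<in> ?F x. (\<Oplus>\<^bsub>R\<^esub> pq \<in> ?F (fst ur). f (fst pq) \<otimes>\<^bsub>R\<^esub> g (snd pq)) \<otimes>\<^bsub>R\<^esub> h (snd ur))"
        by (simp add: mul)
      also have "\<dots> = (\<Oplus>\<^bsub>R\<^esub> ur \<in> ?F x. \<Oplus>\<^bsub>R\<^esub> z \<in> ?B ur. ?t z)"
      proof (rule R.finsum_cong')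
        fix ur
        have "(\<Oplus>\<^bsub>R\<^esub> z \<in> ?B ur. ?t z) =
            (\<Oplus>\<^bsub>R\<^esub> pq \<in> ?F (fst ur). ?t (fst pq, snd pq, snd ur))"
          by (rule R.finsum_reindex) (auto simp: inj_on_def fc gc hc)
        also have "\<dots> = (\<Oplus>\<^bsub>R\<^esub> pq \<in> ?F (fst ur). f (fst pq) \<otimes>\<^bsub>R\<^esub> g (snd pq)) \<otimes>\<^bsub>R\<^esub> h (snd ur)"
          by (subst R.finsum_ldistr) (auto simp: finF fc gc hc R.m_assoc)
        finally show "(\<Oplus>\<^bsub>R\<^esub> pq \<in> ?F (fst ur). f (fst pq) \<otimes>\<^bsub>R\<^esub> g (snd pq)) \<otimes>\<^bsub>R\<^esub> h (snd ur) =
          (\<Oplus>\<^bsub>R\<^esub> z \<in> ?B ur. ?t z)" ..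
      qed (auto intro!: R.finsum_closed simp: fc gc hc)
      also have "\<dots> = (\<Oplus>\<^bsub>R\<^esub> z \<in> (\<Union>ur \<in> ?F x. ?B ur). ?t z)"
        by (rule R.add.finprod_UN_disjoint[symmetric])
           (use B_disj in \<open>auto simp: finF fc gc hc simp del: split_paired_All split_paired_Ex\<close>)
      also have "\<dots> = (\<Oplus>\<^bsub>R\<^esub> z \<in> (\<Union>pu \<in> ?F x. ?C pu). ?t z)"
        by (simp only: UN)
      also have "\<dots> = (\<Oplus>\<^bsub>R\<^esub> pu \<in> ?F x. \<Oplus>\<^bsub>R\<^esub> z \<in> ?C pu. ?t z)"
        by (rule R.add.finprod_UN_disjoint)
           (use C_disj in \<open>auto simp: finF fc gc hc simp del: split_paired_All split_paired_Ex\<close>)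
      also have "\<dots> = (\<Oplus>\<^bsub>R\<^esub> pu \<in> ?F x. f (fst pu) \<otimes>\<^bsub>R\<^esub> (\<Oplus>\<^bsub>R\<^esub> qr \<in> ?F (snd pu). g (fst qr) \<otimes>\<^bsub>R\<^esub> h (snd qr)))"
      proof (rule R.finsum_cong')
        fix pu
        have "(\<Oplus>\<^bsub>R\<^esub> z \<in> ?C pu. ?t z) = (\<Oplus>\<^bsub>R\<^esub> qr \<in> ?F (snd pu). ?t (fst pu, qr))"
          by (rule R.finsum_reindex) (auto simp: inj_on_def fc gc hc)
        also have "\<dots> = f (fst pu) \<otimes>\<^bsub>R\<^esub> (\<Oplus>\<^bsub>R\<^esub> qr \<in> ?F (snd pu). g (fst qr) \<otimes>\<^bsub>R\<^esub> h (snd qr))"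
          by (subst R.finsum_rdistr) (auto simp: finF fc gc hc case_prod_beta)
        finally show "(\<Oplus>\<^bsub>R\<^esub> z \<in> ?C pu. ?t z) =
          f (fst pu) \<otimes>\<^bsub>R\<^esub> (\<Oplus>\<^bsub>R\<^esub> qr \<in> ?F (snd pu). g (fst qr) \<otimes>\<^bsub>R\<^esub> h (snd qr))" .
      qed (auto intro!: R.finsum_closed simp: fc gc hc)
      also have "\<dots> = (f \<otimes>\<^bsub>?A\<^esub> (g \<otimes>\<^bsub>?A\<^esub> h)) x"
        by (simp add: mul)
      finally show "((f \<otimes>\<^bsub>?A\<^esub> g) \<otimes>\<^bsub>?A\<^esub> h) x = (f \<otimes>\<^bsub>?A\<^esub> (g \<otimes>\<^bsub>?A\<^esub> h)) x" .
    qed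
  next
    fix f assume f: "f \<in> carrier ?A"
    have fc: "f y \<in> carrier R" for y
      using f by (simp only: carD)
    show "\<one>\<^bsub>?A\<^esub> \<otimes>\<^bsub>?A\<^esub> f = f"
    proof
      fix x
      show "(\<one>\<^bsub>?A\<^esub> \<otimes>\<^bsub>?A\<^esub> f) x = f x"
      proof (cases "x \<in> paths Q")
        case True
        let ?u = "(trivial_path (path_head Q x), x)"
        have hv: "path_head Q x \<in> verts Q"
          using True by (auto simp: paths_def dest: Q.awalk_last_in_verts)
        then have uF: "?u \<in> ?F x"
          using True triv by (auto simp: path_factorizations_def trivial_path_def path_tail_def path_comp_def)
        have sub: "pq = ?u" if "pq \<in> ?F x" "fst pq \<in> trivial_path ` verts Q" for pq
          using that by (cases pq) (auto simp: path_factorizations_def trivial_path_def path_tail_def path_comp_def)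
        have "(\<one>\<^bsub>?A\<^esub> \<otimes>\<^bsub>?A\<^esub> f) x = (\<Oplus>\<^bsub>R\<^esub> pq \<in> ?F x. if ?u = pq then f x else \<zero>\<^bsub>R\<^esub>)"
          unfolding mul on
        proof (rule R.finsum_cong'[OF refl])
          fix pq assume pq: "pq \<in> ?F x"
          show "(if fst pq \<in> trivial_path ` verts Q then \<one>\<^bsub>R\<^esub> else \<zero>\<^bsub>R\<^esub>) \<otimes>\<^bsub>R\<^esub> f (snd pq) =
            (if ?u = pq then f x else \<zero>\<^bsub>R\<^esub>)"
          proof (cases "fst pq \<in> trivial_path ` verts Q")
            case True
            show ?thesis unfolding sub[OF pq True] using hv fc by simp
          next
            case False
            then have "?u \<noteq> pq" using hv by fastforce
            then show ?thesis using False fc by simp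
          qed
        qed (simp add: fc)
        also have "\<dots> = f x"
          using R.add.finprod_singleton[OF uF finF, of "\<lambda>_. f x"] fc by (auto)
        finally show ?thesis .
      next
        case False
        then have "?F x = {}" by (auto simp: path_factorizations_def Q.path_head_comp)
        moreover have "f x = \<zero>\<^bsub>R\<^esub>" using False f unfolding car by blast
        ultimately show ?thesis by (simp add: mul)
      qed
    qed
    show "f \<otimes>\<^bsub>?A\<^esub> \<one>\<^bsub>?A\<^esub> = f"
    proof
      fix x
      show "(f \<otimes>\<^bsub>?A\<^esub> \<one>\<^bsub>?A\<^esub>) x = f x"
      proof (cases "x \<in> paths Q")
        case True
        let ?u = "(x, trivial_path (path_tail x))"
        have hv: "path_tail x \<in> verts Q"
          using True by (auto simp: paths_def dest: Q.awalk_hd_in_verts)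
        then have "trivial_path (path_tail x) \<in> paths Q"
          using triv by blast
        then have uF: "?u \<in> ?F x"
          using True by (auto simp: path_factorizations_def trivial_path_def path_tail_def path_comp_def path_head_def)
        have sub: "pq = ?u" if "pq \<in> ?F x" "snd pq \<in> trivial_path ` verts Q" for pq
          using that by (cases pq) (auto simp: path_factorizations_def trivial_path_def path_tail_def path_comp_def path_head_def prod_eq_iff)
        have "(f \<otimes>\<^bsub>?A\<^esub> \<one>\<^bsub>?A\<^esub>) x = (\<Oplus>\<^bsub>R\<^esub> pq \<in> ?F x. if ?u = pq then f x else \<zero>\<^bsub>R\<^esub>)"
          unfolding mul on
        proof (rule R.finsum_cong'[OF refl])
          fix pq assume pq: "pq \<in> ?F x"
          show "f (fst pq) \<otimes>\<^bsub>R\<^esub> (if snd pq \<in> trivial_path ` verts Q then \<one>\<^bsub>R\<^esub> else \<zero>\<^bsub>R\<^esub>) =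
            (if ?u = pq then f x else \<zero>\<^bsub>R\<^esub>)"
          proof (cases "snd pq \<in> trivial_path ` verts Q")
            case True
            show ?thesis unfolding sub[OF pq True] using hv fc by simp
          next
            case False
            then have "?u \<noteq> pq" using hv by fastforce
            then show ?thesis using False fc by simp
          qed
        qed (simp add: fc)
        also have "\<dots> = f x"
          using R.add.finprod_singleton[OF uF finF, of "\<lambda>_. f x"] fc by (auto)
        finally show ?thesis .
      next
        case False
        then have "?F x = {}" by (auto simp: path_factorizations_def Q.path_head_comp)
        moreover have "f x = \<zero>\<^bsub>R\<^esub>" using False f unfolding car by blast
        ultimately show ?thesis by (simp add: mul)
      qed
    qed
  qed (auto simp: one mc)
  then show ?thesis
  proof (rule ringI[OF ab])
    fix f g h assume f: "f \<in> carrier ?A" and g: "g \<in> carrier ?A" and h: "h \<in> carrier ?A"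
    show "(f \<oplus>\<^bsub>?A\<^esub> g) \<otimes>\<^bsub>?A\<^esub> h = f \<otimes>\<^bsub>?A\<^esub> h \<oplus>\<^bsub>?A\<^esub> g \<otimes>\<^bsub>?A\<^esub> h"
      unfolding mul pl
      by (rule ext) (simp add: carD f g h R.l_distr Pi_def)
    show "h \<otimes>\<^bsub>?A\<^esub> (f \<oplus>\<^bsub>?A\<^esub> g) = h \<otimes>\<^bsub>?A\<^esub> f \<oplus>\<^bsub>?A\<^esub> h \<otimes>\<^bsub>?A\<^esub> g"
      unfolding mul pl
      by (rule ext) (simp add: carD f g h R.r_distr Pi_def)
  qed
qed


section \<open>Ideals of the path algebra and string algebras\<close>

text \<open>\<open>\<Sum>\<^sub>x Ax\<close> and \<open>\<Sum>\<^sub>x xA\<close>, where \<open>x\<close> runs over the finite set \<open>S\<close>.\<close>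

definition left_ideal_gen :: "('a, 'm) ring_scheme \<Rightarrow> 'a set \<Rightarrow> 'a set" where
  "left_ideal_gen A S = {(\<Oplus>\<^bsub>A\<^esub> x \<in> S. f x \<otimes>\<^bsub>A\<^esub> x) | f. \<forall>x \<in> S. f x \<in> carrier A}"

definition right_ideal_gen :: "('a, 'm) ring_scheme \<Rightarrow> 'a set \<Rightarrow> 'a set" where
  "right_ideal_gen A S = {(\<Oplus>\<^bsub>A\<^esub> x \<in> S. x \<otimes>\<^bsub>A\<^esub> f x) | f. \<forall>x \<in> S. f x \<in> carrier A}"

definition admissible_ideal ::
    "('r, 'm) ring_scheme \<Rightarrow> 'r set \<Rightarrow> ('v, 'e) pre_digraph \<Rightarrow>
      (('v, 'e) qpath \<Rightarrow> 'r) set \<Rightarrow> bool" where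
  "admissible_ideal R \<mm> Q I \<longleftrightarrow>
     (let RQ = path_algebra R Q; A = arrow_ideal R Q; \<mm>Q = coeff_ideal R \<mm> Q in
      \<exists>(m::nat) > 0. \<exists>(n::nat) > 0.
        I \<subseteq> A <+>\<^bsub>RQ\<^esub> \<mm>Q \<and>
        I \<inter> A \<subseteq> (A [^]\<^bsub>ideals_set RQ\<^esub> (2::nat)) <+>\<^bsub>RQ\<^esub> (\<mm>Q \<inter> A) \<and>
        A [^]\<^bsub>ideals_set RQ\<^esub> m \<subseteq> I <+>\<^bsub>RQ\<^esub> \<mm>Q \<and>
        \<mm>Q \<subseteq> I <+>\<^bsub>RQ\<^esub> path_span R Q {p. 1 \<le> path_length p \<and> path_length p \<le> n})"

definition special_ideal ::
    "('r, 'm) ring_scheme \<Rightarrow> ('v, 'e) pre_digraph \<Rightarrow> (('v, 'e) qpath \<Rightarrow> 'r) set \<Rightarrow> bool" where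
  "special_ideal R Q I \<longleftrightarrow> (\<forall>b \<in> arcs Q.
     (\<exists>\<^sub>\<le>\<^sub>1 a. a \<in> arcs Q \<and> tail Q a = head Q b \<and>
        arrow_elem R Q a \<otimes>\<^bsub>path_algebra R Q\<^esub> arrow_elem R Q b \<notin> I) \<and>
     (\<exists>\<^sub>\<le>\<^sub>1 c. c \<in> arcs Q \<and> head Q c = tail Q b \<and>
        arrow_elem R Q b \<otimes>\<^bsub>path_algebra R Q\<^esub> arrow_elem R Q c \<notin> I))"

definition arrow_direct_ideal ::
    "('r, 'm) ring_scheme \<Rightarrow> ('v, 'e) pre_digraph \<Rightarrow> (('v, 'e) qpath \<Rightarrow> 'r) set \<Rightarrow> bool" where
  "arrow_direct_ideal R Q I \<longleftrightarrow> (\<forall>a \<in> arcs Q.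
     left_ideal_gen (path_algebra R Q) {arrow_elem R Q a} \<inter>
       left_ideal_gen (path_algebra R Q)
         (arrow_elem R Q ` {x \<in> arcs Q. x \<noteq> a \<and> tail Q x = tail Q a}) \<subseteq> I \<and>
     right_ideal_gen (path_algebra R Q) {arrow_elem R Q a} \<inter>
       right_ideal_gen (path_algebra R Q)
         (arrow_elem R Q ` {y \<in> arcs Q. y \<noteq> a \<and> head Q y = head Q a}) \<subseteq> I)"

text \<open>The quotient ring \<open>A/I\<close> with the induced action of \<open>R\<close>.\<close>

definition quotient_algebra :: "('r, 'a) module \<Rightarrow> 'a set \<Rightarrow> ('r, 'a set) module" where
  "quotient_algebra A I = ring.extend (A Quot I)
     (module.fields (\<lambda>r X. \<Union>x \<in> X. I +>\<^bsub>A\<^esub> (r \<odot>\<^bsub>A\<^esub> x)))"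

locale local_ring = cring R + maximalideal \<mm> R for \<mm> and R (structure) +
  assumes maximal_unique: "maximalideal \<nn> R \<Longrightarrow> \<nn> = \<mm>"

definition string_algebra ::
    "('r, 'm) ring_scheme \<Rightarrow> 'r set \<Rightarrow> ('r, (('v, 'e) qpath \<Rightarrow> 'r) set) module \<Rightarrow> bool" where
  "string_algebra R \<mm> \<Lambda> \<longleftrightarrow> local_ring \<mm> R \<and>
     (\<exists>(Q :: ('v, 'e) pre_digraph) I. fin_digraph Q \<and> biserial Q \<and>
        ideal I (path_algebra R Q) \<and> admissible_ideal R \<mm> Q I \<and> special_ideal R Q I \<and>
        arrow_direct_ideal R Q I \<and> \<Lambda> = quotient_algebra (path_algebra R Q) I)"


section \<open>Regular local rings and regular sequences\<close>

definition krull_dim :: "('r, 'm) ring_scheme \<Rightarrow> enat" where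
  "krull_dim R = (SUP l \<in> {l. \<exists>P. (\<forall>i \<le> l. primeideal (P i) R) \<and> (\<forall>i < l. P i \<subset> P (Suc i))}. enat l)"

text \<open>Noetherian local with \<open>\<mm>\<close> minimally generated by as many elements as the Krull dimension.\<close>

locale regular_local_ring = local_ring \<mm> R + noetherian_ring R for \<mm> and R (structure) +
  assumes regular: "enat (LEAST k. \<exists>S \<subseteq> carrier R. finite S \<and> card S = k \<and> \<mm> = Idl S) = krull_dim R"

text \<open>The sequence is \<open>s 1, \<dots>, s n\<close>.\<close>

definition regular_sequence :: "('r, 'm) ring_scheme \<Rightarrow> nat \<Rightarrow> (nat \<Rightarrow> 'r) \<Rightarrow> bool" where
  "regular_sequence R n s \<longleftrightarrow>
     (\<forall>i \<in> {1..n}. s i \<in> carrier R) \<and>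
     (\<forall>i \<in> {1..n}. \<forall>x \<in> carrier R.
        s i \<otimes>\<^bsub>R\<^esub> x \<in> genideal R (s ` {1..<i}) \<longrightarrow> x \<in> genideal R (s ` {1..<i})) \<and>
     genideal R (s ` {1..n}) \<noteq> carrier R"


section \<open>The ideal attached to a special pair\<close>

definition vertex_elem :: "('r, 'm) ring_scheme \<Rightarrow> 'v \<Rightarrow> ('v, 'e) qpath \<Rightarrow> 'r" where
  "vertex_elem R v = path_elem R (trivial_path v)"

text \<open>
  \<open>\<sigma>\<^sub>v\<close>. A special pair on a finite quiver has only finitely many primitive cycles at \<open>v\<close> (at most
  one for each arrow with tail \<open>v\<close>), so this is a genuine finite sum.
\<close>

definition primitive_cycle_sum ::
    "('r, 'm) ring_scheme \<Rightarrow> ('v, 'e) pre_digraph \<Rightarrow> ('v, 'e) qpath set \<Rightarrow> 'v \<Rightarrow>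
      ('v, 'e) qpath \<Rightarrow> 'r" where
  "primitive_cycle_sum R Q Z v =
     (\<Oplus>\<^bsub>path_algebra R Q\<^esub> c \<in> {c. primitive_cycle Q Z c \<and> path_tail c = v}. path_elem R c)"

text \<open>
  Sums of ideals are taken in the additive monoid of \<^const>\<open>ideals_set\<close>. The parts
  \<open>V[1], \<dots>, V[n]\<close> are \<open>W 1, \<dots>, W n\<close>.
\<close>

definition nerve_ideal ::
    "('r, 'm) ring_scheme \<Rightarrow> ('v, 'e) pre_digraph \<Rightarrow> ('v, 'e) qpath set \<Rightarrow> nat \<Rightarrow>
      (nat \<Rightarrow> 'v set) \<Rightarrow> (nat \<Rightarrow> 'r) \<Rightarrow> (('v, 'e) qpath \<Rightarrow> 'r) set" where
  "nerve_ideal R Q Z n W s =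
     (let RQ = path_algebra R Q in
      genideal RQ (path_elem R ` Z) <+>\<^bsub>RQ\<^esub>
      (\<Oplus>\<^bsub>ideals_set RQ\<^esub> i \<in> {1..n}.
         genideal RQ {(s i \<odot>\<^bsub>RQ\<^esub> vertex_elem R v) \<ominus>\<^bsub>RQ\<^esub> primitive_cycle_sum R Q Z v | v. v \<in> W i}
         <+>\<^bsub>RQ\<^esub>
         genideal RQ {s i \<odot>\<^bsub>RQ\<^esub> vertex_elem R v | v. v \<in> verts Q - W i}))"

end

theory Submission
  imports Defs "HOL-Library.Sublist"
begin

text \<open>
  In an admissible path each arrow determines the next one, and also the one before it. So an
  admissible path is determined by its first arrow and its length, and an infinite admissible path,
  called an admissible stream below, is purely periodic: it winds around a primitive cycle. There is
  at most one stream for each first arrow, and the primitive cycles are exactly the periods of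
  streams (\<open>window_period_primitive\<close>, \<open>primitive_cycle_window\<close>). Every path on a stream can be
  lengthened at each of its vertices by exactly one primitive cycle so that it stays on the stream
  (\<open>insert_primitive_cycle\<close>).

  That a path does not lie in \<open>I\<close> is detected by an \<open>R\<close>-linear functional on \<open>RQ\<close> which maps all
  two-sided multiples of the generators of \<open>I\<close> into an ideal \<open>J\<close> of \<open>R\<close>
  (\<open>nerve_ideal_functional\<close>). Two kinds of functionals suffice. If an admissible path \<open>p\<close> contains no
  primitive cycle, then one takes the coefficient at \<open>p\<close> and \<open>J = \<mm>\<close>
  (\<open>nerve_ideal_coefficient\<close>). Otherwise \<open>p\<close> lies on a stream of some period \<open>l\<close> whose vertices
  belong to one part \<open>V[i]\<close>. Now \<open>J\<close> is generated by the \<open>s\<^sub>j\<close> with \<open>j \<noteq> i\<close>, and for a fixed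
  residue \<open>r\<close> the functional maps the path of length \<open>kl + r\<close> on the stream to \<open>s\<^sub>i\<^sup>k\<close> and all other
  paths to \<open>0\<close> (\<open>nerve_ideal_stream_weight\<close>). Lengthening the path by one turn multiplies the value
  by \<open>s\<^sub>i\<close>, and this is what the relation \<open>s\<^sub>i e\<^sub>v = \<sigma>\<^sub>v\<close> asks for. A regular sequence that generates a
  proper ideal satisfies \<open>s\<^sub>i\<^sup>k \<notin> J\<close>, because \<open>s\<^sub>i\<close> stays regular when it is moved to the end of the
  sequence. Hence \<open>p \<notin> I\<close>.

  For the second claim, \<open>I\<close> is special because it contains \<open>Z\<close>, and arrow-direct because paths that
  begin or end with different arrows are linearly independent in \<open>RQ\<close>. The first two
  conditions of admissibility say that certain coefficients of the elements of \<open>I\<close> at trivial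
  paths and at arrows lie in \<open>\<mm>\<close>, which the same functionals show. The last two rest on a reduction
  of long paths (\<open>long_path_reduction\<close>): a long admissible path is \<open>x = uc\<close> for a
  primitive cycle \<open>c\<close>, and \<open>uc'\<close> is inadmissible for every other primitive cycle \<open>c'\<close> at the same
  vertex, so \<open>x\<close> is congruent to \<open>u\<sigma>\<^sub>v\<close> and hence to \<open>s\<^sub>i u\<close> modulo \<open>I\<close>.
\<close>

section \<open>Admissible paths and admissible streams\<close>

locale special_quiver = fin_digraph Q for Q :: "('v, 'e) pre_digraph" (structure) +
  fixes Z :: "('v, 'e) qpath set"
  assumes Z_paths: "Z \<subseteq> paths Q"
    and Z_length: "z \<in> Z \<Longrightarrow> path_length z \<ge> 2"
    and special: "special_pair Q Z"
begin

lemma cas_iff: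
  "cas u as w \<longleftrightarrow> (as \<noteq> [] \<longrightarrow> tail Q (hd as) = u) \<and> (\<forall>i. Suc i < length as \<longrightarrow> head Q (as ! i) = tail Q (as ! Suc i))
     \<and> w = (if as = [] then u else head Q (last as))"
proof (induction as arbitrary: u)
  case (Cons a as)
  show ?case
  proof (cases as)
    case (Cons b bs)
    have "(\<forall>i. Suc i < length (a # as) \<longrightarrow> head Q ((a # as) ! i) = tail Q ((a # as) ! Suc i)) \<longleftrightarrow>
      head Q a = tail Q b \<and> (\<forall>i. Suc i < length as \<longrightarrow> head Q (as ! i) = tail Q (as ! Suc i))"
      using Cons by (auto simp: All_less_Suc2 nth_Cons split: nat.splits)
    then show ?thesis using Cons.IH[of "head Q a"] Cons by auto
  qed auto
qed auto

lemma path_head_eq: "path_head Q (v, as) = (if as = [] then v else head Q (last as))"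
  by (simp add: path_head_def awalk_verts_conv)

lemma mem_paths_iff:
  "(v, as) \<in> paths Q \<longleftrightarrow> v \<in> verts Q \<and> set as \<subseteq> arcs Q \<and> (as \<noteq> [] \<longrightarrow> tail Q (hd as) = v) \<and>
     (\<forall>i. Suc i < length as \<longrightarrow> head Q (as ! i) = tail Q (as ! Suc i))"
  by (auto simp: paths_def path_tail_def awalk_def path_head_eq cas_iff)

lemma subpath:
  assumes "x \<in> paths Q" "sublist ys (snd x)" "ys \<noteq> []"
  shows "(tail Q (hd ys), ys) \<in> paths Q"
proof -
  obtain v ps qs where x: "x = (v, ps @ ys @ qs)" using assms(2) by (cases x) (auto simp: sublist_def)
  have "head Q (ys ! i) = tail Q (ys ! Suc i)" if "Suc i < length ys" for i
  proof -
    have "Suc (length ps + i) < length (ps @ ys @ qs)" using that by simp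
    then have "head Q ((ps @ ys @ qs) ! (length ps + i)) = tail Q ((ps @ ys @ qs) ! Suc (length ps + i))"
      using assms(1) unfolding x mem_paths_iff by blast
    then show ?thesis using that by (simp add: nth_append)
  qed
  moreover have "set ys \<subseteq> arcs Q" using assms(1) unfolding x mem_paths_iff by auto
  moreover have "hd ys \<in> set ys" using assms(3) by simp
  ultimately show ?thesis unfolding mem_paths_iff by auto
qed

lemma prefix_subpath:
  assumes "(v, ps @ qs) \<in> paths Q"
  shows "(v, ps) \<in> paths Q" "(path_head Q (v, ps), qs) \<in> paths Q"
proof -
  have "awalk v (ps @ qs) (path_head Q (v, ps @ qs))"
    using assms by (simp add: paths_def path_tail_def)
  then have *: "awalk v ps (awlast v ps)" "awalk (awlast v ps) qs (path_head Q (v, ps @ qs))"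
    by auto
  then show "(v, ps) \<in> paths Q" by (simp add: paths_def path_tail_def path_head_def)
  have "path_head Q (v, ps @ qs) = path_head Q (path_head Q (v, ps), qs)"
    by (simp add: path_head_eq)
  moreover have "awlast v ps = path_head Q (v, ps)" by (simp add: path_head_def)
  ultimately have "awalk (path_head Q (v, ps)) qs (path_head Q (path_head Q (v, ps), qs))"
    using *(2) by (simp only:)
  then show "(path_head Q (v, ps), qs) \<in> paths Q"
    unfolding paths_def path_tail_def by (simp only: mem_Collect_eq fst_conv snd_conv)
qed

lemma inadmissible_iff:
  assumes "x \<in> paths Q"
  shows "inadmissible_path Q Z x \<longleftrightarrow> (\<exists>z\<in>Z. sublist (snd z) (snd x))"
proof
  assume "inadmissible_path Q Z x"
  then obtain p z q where "z \<in> Z" "x = path_comp p (path_comp z q)"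
    unfolding inadmissible_path_def by blast
  then have "z \<in> Z" "snd x = snd q @ snd z @ snd p" by simp_all
  then show "\<exists>z\<in>Z. sublist (snd z) (snd x)" unfolding sublist_def by blast
next
  assume "\<exists>z\<in>Z. sublist (snd z) (snd x)"
  then obtain z ps qs where z: "z \<in> Z" "snd x = ps @ snd z @ qs" by (auto simp: sublist_def)
  define v where "v = fst x"
  have x: "x = (v, ps @ snd z @ qs)" using z v_def by (cases x) auto
  have ne: "snd z \<noteq> []" using Z_length[OF z(1)] by (auto simp: path_length_def)
  have zp: "z \<in> paths Q" using z Z_paths by auto
  have fz: "fst z = tail Q (hd (snd z))" using zp ne mem_paths_iff[of "fst z" "snd z"] by auto
  have 1: "(v, ps) \<in> paths Q" "(path_head Q (v, ps), snd z @ qs) \<in> paths Q"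
    using prefix_subpath[of v ps "snd z @ qs"] assms x by auto
  have 2: "path_head Q (v, ps) = fst z"
    using 1(2) ne fz unfolding mem_paths_iff by auto
  have "(path_head Q z, qs) \<in> paths Q"
    using prefix_subpath(2)[OF 1(2)] unfolding 2 by simp
  then show "inadmissible_path Q Z x"
    unfolding inadmissible_path_def using z(1) 1(1) 2 x
    by (intro bexI[of _ "(path_head Q z, qs)"] bexI[of _ z] bexI[of _ "(v, ps)"])
       (auto simp: path_tail_def path_comp_def)
qed

lemma admissible_iff:
  "admissible_path Q Z x \<longleftrightarrow> x \<in> paths Q \<and> (\<forall>z\<in>Z. \<not> sublist (snd z) (snd x))"
  using inadmissible_iff unfolding admissible_path_def by blast

lemma trivial_admissible: "v \<in> verts Q \<Longrightarrow> admissible_path Q Z (v, [])"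
  using Z_length unfolding admissible_iff by (fastforce simp: mem_paths_iff path_length_def)

lemma admissible_subpath:
  assumes "admissible_path Q Z x" "sublist ys (snd x)" "ys \<noteq> []"
  shows "admissible_path Q Z (tail Q (hd ys), ys)"
  using assms subpath[of x ys] sublist_order.order.trans[OF _ assms(2)] unfolding admissible_iff by auto

text \<open>
  The paths of length two that do not lie in \<open>Z\<close>. That the pair is special means that this relation
  is a partial injection; the longer paths in \<open>Z\<close> only decide where an admissible path has to stop.
\<close>

definition follows :: "'e \<Rightarrow> 'e \<Rightarrow> bool" where
  "follows b a \<longleftrightarrow> b \<in> arcs Q \<and> a \<in> arcs Q \<and> tail Q a = head Q b \<and>
     path_comp (arrow_path Q a) (arrow_path Q b) \<notin> Z"

lemma follows_unique:
  assumes "follows b a" "follows b a'"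
  shows "a = a'"
proof -
  have "\<exists>\<^sub>\<le>\<^sub>1 a. a \<in> arcs Q \<and> tail Q a = head Q b \<and> path_comp (arrow_path Q a) (arrow_path Q b) \<notin> Z"
    using special assms(1) unfolding special_pair_def follows_def by meson
  then show ?thesis by (rule Uniq_D) (use assms follows_def in auto)
qed

lemma follows_unique_back:
  assumes "follows c b" "follows c' b"
  shows "c = c'"
proof -
  have "\<exists>\<^sub>\<le>\<^sub>1 c. c \<in> arcs Q \<and> head Q c = tail Q b \<and> path_comp (arrow_path Q b) (arrow_path Q c) \<notin> Z"
    using special assms(1) unfolding special_pair_def follows_def by meson
  then show ?thesis by (rule Uniq_D) (use assms follows_def in auto)
qed

lemma admissible_follows:
  assumes "admissible_path Q Z x" "snd x = ps @ b # a # qs"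
  shows "follows b a"
proof -
  have "sublist [b, a] (snd x)" using assms(2) by (auto simp: sublist_def)
  then have "admissible_path Q Z (tail Q b, [b, a])" using admissible_subpath[OF assms(1), of "[b,a]"] by simp
  then show ?thesis unfolding admissible_iff follows_def mem_paths_iff
    by (auto simp: path_comp_def arrow_path_def)
qed

lemma admissible_follows_nth:
  assumes "admissible_path Q Z x" "Suc i < length (snd x)"
  shows "follows (snd x ! i) (snd x ! Suc i)"
  using assms admissible_follows[OF assms(1), of "take i (snd x)" _ _ "drop (Suc (Suc i)) (snd x)"]
  by (metis Suc_lessD id_take_nth_drop Cons_nth_drop_Suc)

text \<open>
  A stretch of an infinite sequence of arrows. The tail is read off from the sequence, so a stretch
  of length \<open>0\<close> is a trivial path at a definite vertex and stretches can always be composed.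
\<close>

definition window :: "(nat \<Rightarrow> 'e) \<Rightarrow> nat \<Rightarrow> nat \<Rightarrow> ('v, 'e) qpath" where
  "window f i N = (tail Q (f i), map f [i..<i + N])"

definition admissible_stream :: "(nat \<Rightarrow> 'e) \<Rightarrow> bool" where
  "admissible_stream f \<longleftrightarrow> (\<forall>N. admissible_path Q Z (window f 0 N))"

lemma length_window [simp]: "path_length (window f i N) = N" "length (snd (window f i N)) = N"
  by (simp_all add: window_def path_length_def)

lemma tail_window [simp]: "path_tail (window f i N) = tail Q (f i)" "fst (window f i N) = tail Q (f i)"
  by (simp_all add: window_def path_tail_def)

lemma window_shift: "window (\<lambda>j. f (k + j)) i N = window f (k + i) N"
  by (simp add: window_def list_eq_iff_nth_eq ac_simps)

lemma map_upt_add: "map f [i..<i + (M + N)] = map f [i..<i + M] @ map f [i + M..<i + M + N]"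
  by (metis map_append add.assoc le_add1 upt_add_eq_append)

lemma window_comp: "path_comp (window f (i + M) N) (window f i M) = window f i (M + N)"
  by (simp add: window_def path_comp_def map_upt_add)

lemma sublist_window: 
  assumes "i \<le> j" "j + M \<le> i + N"
  shows "sublist (snd (window f j M)) (snd (window f i N))"
proof -
  have "[i..<i+N] = [i..<j] @ [j..<j+M] @ [j+M..<i+N]"
    using assms by (metis le_add1 le_add_diff_inverse order_trans upt_add_eq_append)
  then show ?thesis unfolding window_def sublist_def by (metis map_append snd_conv)
qed

lemma stream_window:
  assumes "admissible_stream f"
  shows "admissible_path Q Z (window f i N)"
proof (cases N)
  case 0
  have "admissible_path Q Z (window f 0 (Suc i))" using assms admissible_stream_def by blast
  then have "f i \<in> arcs Q" unfolding admissible_iff by (auto simp: window_def mem_paths_iff)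
  then show ?thesis using 0 trivial_admissible by (simp add: window_def)
next
  case (Suc N')
  have "admissible_path Q Z (window f 0 (i + N))" using assms admissible_stream_def by blast
  from admissible_subpath[OF this sublist_window[of 0 i N "i + N" f]] Suc
  show ?thesis by (simp add: window_def upt_rec)
qed

lemma stream_follows: 
  assumes "admissible_stream f" shows "follows (f i) (f (Suc i))"
  using admissible_follows_nth[OF stream_window[OF assms, of i 2], of 0] by (simp add: window_def)

lemma stream_arcs: "admissible_stream f \<Longrightarrow> f i \<in> arcs Q"
  using stream_follows follows_def by blast

lemma stream_head: "admissible_stream f \<Longrightarrow> head Q (f i) = tail Q (f (Suc i))"
  using stream_follows follows_def by metis

lemma head_window: "admissible_stream f \<Longrightarrow> path_head Q (window f i N) = tail Q (f (i + N))"
  using stream_head[of f "i + N - 1"] by (cases N) (auto simp: window_def path_head_eq last_map)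

lemma stream_shift: "admissible_stream f \<Longrightarrow> admissible_stream (\<lambda>j. f (k + j))"
  using stream_window unfolding admissible_stream_def window_shift by blast

text \<open>
  Successors in admissible paths are unique, so the path cannot leave the stream once it shares an
  arrow with it.
\<close>

lemma stream_agree:
  assumes "admissible_stream f" "admissible_path Q Z x" "snd x \<noteq> []" "hd (snd x) = f i"
  shows "x = window f i (path_length x)"
proof -
  have "snd x ! j = f (i + j)" if "j < length (snd x)" for j
    using that
  proof (induction j)
    case 0 then show ?case using assms by (simp add: hd_conv_nth)
  next
    case (Suc j)
    then show ?case 
      using admissible_follows_nth[OF assms(2) Suc.prems] stream_follows[OF assms(1), of "i + j"]
      by (auto dest: follows_unique)
  qed
  then have "snd x = map f [i..<i + length (snd x)]" by (intro nth_equalityI) auto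
  moreover have "fst x = tail Q (f i)" using assms mem_paths_iff[of "fst x" "snd x"] 
    unfolding admissible_iff by auto
  ultimately show ?thesis unfolding window_def path_length_def by (metis prod.collapse)
qed

lemma stream_eq:
  assumes "admissible_stream f" "admissible_stream g" "f i = g j"
  shows "f (i + k) = g (j + k)"
proof (induction k)
  case (Suc k)
  then show ?case
    using follows_unique stream_follows[OF assms(1), of "i + k"] stream_follows[OF assms(2), of "j + k"] by simp
qed (use assms in simp)

lemma stream_eq_back:
  assumes "admissible_stream f" "admissible_stream g" "f (i + k) = g (j + k)"
  shows "f i = g j"
  using assms(3)
proof (induction k)
  case (Suc k)
  have "f (i + k) = g (j + k)"
    using follows_unique_back Suc.prems stream_follows[OF assms(1), of "i + k"]
      stream_follows[OF assms(2), of "j + k"] by simp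
  then show ?case by (rule Suc.IH)
qed simp

text \<open>
  There are finitely many arrows, so some arrow is repeated, and by uniqueness of predecessors the
  repetition can be traced back to the first arrow.
\<close>

lemma stream_returns:
  assumes "admissible_stream f"
  shows "\<exists>t>0. f t = f 0"
proof -
  have "f ` {..card (arcs Q)} \<subseteq> arcs Q" using stream_arcs[OF assms] by auto
  then have "card (f ` {..card (arcs Q)}) \<le> card (arcs Q)" by (simp add: card_mono)
  then have "\<not> inj_on f {..card (arcs Q)}" using card_image by fastforce
  then obtain i j where "i < j" "f i = f j" unfolding inj_on_def by (metis linorder_neqE_nat)
  then have "f (0 + i) = f ((j - i) + i)" by simp
  from stream_eq_back[OF assms assms this] \<open>i < j\<close> show ?thesis by (intro exI[of _ "j - i"]) auto
qed

definition period :: "(nat \<Rightarrow> 'e) \<Rightarrow> nat" where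
  "period f = (LEAST t. t > 0 \<and> f t = f 0)"

lemma period:
  assumes "admissible_stream f"
  shows period_pos: "period f > 0" and period_return: "f (period f) = f 0"
  using LeastI_ex[OF stream_returns[OF assms]] unfolding period_def by auto

lemma period_add:
  assumes "admissible_stream f"
  shows "f (period f + j) = f j"
  using stream_eq[OF assms assms, of "period f" 0 j] period_return[OF assms] by simp

lemma period_mod:
  assumes "admissible_stream f"
  shows "f (j mod period f) = f j"
proof (induction j rule: less_induct)
  case (less j)
  show ?case
  proof (cases "j < period f")
    case False
    then have "f ((j - period f) mod period f) = f (j - period f)" 
      using less period_pos[OF assms] by auto
    then show ?thesis using period_add[OF assms, of "j - period f"] False by (simp add: le_mod_geq)
  qed auto
qed

lemma period_dvd:
  assumes "admissible_stream f" 
  shows "f i = f (i + t) \<longleftrightarrow> period f dvd t"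
proof
  assume "f i = f (i + t)"
  then have "f (0 + i) = f (t + i)" by (simp add: add.commute)
  from stream_eq_back[OF assms assms this] have "f (t mod period f) = f 0" 
    using period_mod[OF assms, of t] by simp
  moreover have "t mod period f < period f" using period_pos[OF assms] by simp
  ultimately have "t mod period f = 0"
    using not_less_Least[of "t mod period f" "\<lambda>t. t > 0 \<and> f t = f 0"] unfolding period_def by auto
  then show "period f dvd t" by auto
next
  assume "period f dvd t"
  then have "f t = f 0" using period_mod[OF assms, of t] by (auto simp: dvd_eq_mod_eq_0)
  then have "f (t + i) = f (0 + i)" using stream_eq[OF assms assms] by blast
  then show "f i = f (i + t)" by (simp add: add.commute)
qed

section \<open>Primitive cycles as periods of admissible streams\<close>

lemma concat_replicate_nth:
  assumes "length xs > 0" "j < m * length xs"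
  shows "concat (replicate m xs) ! j = xs ! (j mod length xs)"
  using assms
proof (induction m arbitrary: j)
  case (Suc m)
  show ?case
  proof (cases "j < length xs")
    case False
    then have "j - length xs < m * length xs" using Suc.prems by auto
    with Suc.IH[of "j - length xs"] False Suc.prems show ?thesis 
      by (simp add: nth_append le_mod_geq)
  qed (simp add: nth_append)
qed simp

lemma length_concat_replicate [simp]: "length (concat (replicate m xs)) = m * length xs"
  by (induction m) auto

lemma window_power: 
  assumes "admissible_stream f" "period f dvd N"
  shows "path_power (window f i N) m = window f i (m * N)"
proof (induction m)
  case (Suc m)
  have "map f [i + N..<i + N + m * N] = map f [i..<i + m * N]"
  proof (intro nth_equalityI)
    fix j assume "j < length (map f [i + N..<i + N + m * N])"
    moreover have "f (i + j) = f (i + j + N)" using assms(2) period_dvd[OF assms(1)] by blast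
    ultimately show "map f [i + N..<i + N + m * N] ! j = map f [i..<i + m * N] ! j" 
      by (simp add: ac_simps)
  qed simp
  then show ?case using Suc unfolding path_power_def window_def by (simp add: map_upt_add)
qed (simp add: path_power_def window_def)

text \<open>
  If one period were a proper power of a shorter cycle, then the stream would return earlier to the
  same arrow.
\<close>

lemma window_period_primitive:
  assumes "admissible_stream f"
  shows "primitive_cycle Q Z (window f i (period f))"
  unfolding primitive_cycle_def
proof (intro conjI allI impI notI)
  note per = period_pos[OF assms]
  show "Defs.cycle Q (window f i (period f))"
    using stream_window[OF assms] per period_dvd[OF assms, of i "period f"]
    unfolding Defs.cycle_def admissible_iff by (simp add: head_window[OF assms])
  show "admissible_path Q Z (path_power (window f i (period f)) m)" for m
    using stream_window[OF assms] by (simp add: window_power[OF assms])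
  assume "\<exists>d m. m > 1 \<and> Defs.cycle Q d \<and> admissible_path Q Z d \<and> path_length d < path_length (window f i (period f))
    \<and> window f i (period f) = path_power d m"
  then obtain d m where d: "m > 1" "Defs.cycle Q d" "path_length d < period f" "window f i (period f) = path_power d m"
    by auto
  let ?l = "length (snd d)"
  have l: "?l > 0" "?l < period f" "period f = m * ?l" 
    using d(2,3) arg_cong[OF d(4), of "\<lambda>x. length (snd x)"] 
    by (auto simp: Defs.cycle_def path_length_def path_power_def)
  have "f (i + j) = snd d ! (j mod ?l)" if "j < period f" for j
    using that arg_cong[OF d(4), of "\<lambda>x. snd x ! j"] concat_replicate_nth[of "snd d" j m] l
    by (simp add: path_power_def window_def)
  from this[of 0] this[of ?l] l have "f i = f (i + ?l)" by auto
  then have "period f dvd ?l" using period_dvd[OF assms] by blast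
  with l show False by (auto dest: dvd_imp_le)
qed

text \<open>
  The infinite power of \<open>c\<close> is a stream. Its period divides the length of \<open>c\<close>, and a proper divisor
  would exhibit \<open>c\<close> as a proper power of an admissible cycle.
\<close>

lemma primitive_cycle_window:
  assumes "primitive_cycle Q Z c"
  obtains f where "admissible_stream f" "c = window f 0 (period f)"
proof -
  define cs where "cs = snd c"
  define l where "l = length cs"
  define f where "f = (\<lambda>j. cs ! (j mod l))"
  have cyc: "Defs.cycle Q c" and adm: "\<And>m. m \<ge> 1 \<Longrightarrow> admissible_path Q Z (path_power c m)"
    using assms unfolding primitive_cycle_def by auto
  have l: "l > 0" "cs \<noteq> []" using cyc unfolding Defs.cycle_def path_length_def l_def cs_def by auto
  have tc: "fst c = tail Q (f 0)"
    using cyc l mem_paths_iff[of "fst c" "snd c"] unfolding Defs.cycle_def f_def cs_def by (simp add: hd_conv_nth)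
  have pow: "path_power c m = window f 0 (m * l)" for m
    using l tc concat_replicate_nth[of cs _ m]
    unfolding path_power_def window_def f_def cs_def l_def 
    by (auto intro!: nth_equalityI)
  have "admissible_path Q Z (window f 0 N)" for N
  proof (cases N)
    case 0
    have "fst c \<in> verts Q" using cyc mem_paths_iff[of "fst c" "snd c"] unfolding Defs.cycle_def by simp
    then show ?thesis using 0 trivial_admissible tc by (simp add: window_def)
  next
    case (Suc N')
    have "admissible_path Q Z (window f 0 (N * l))" using adm[of N] pow Suc by simp
    moreover have "sublist (snd (window f 0 N)) (snd (window f 0 (N * l)))" 
      using l by (intro sublist_window) auto
    ultimately have "admissible_path Q Z (tail Q (hd (snd (window f 0 N))), snd (window f 0 N))"
      using admissible_subpath Suc by (metis length_0_conv length_window(2) nat.distinct(1))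
    then show ?thesis using Suc by (simp add: window_def upt_rec)
  qed
  then have f: "admissible_stream f" unfolding admissible_stream_def by blast
  have "f 0 = f (0 + l)" by (simp add: f_def)
  then have "period f dvd l" using period_dvd[OF f] by blast
  then obtain k where k: "l = k * period f" by (metis dvdE mult.commute)
  have c: "c = window f 0 l" using pow[of 1] by (simp add: path_power_def)
  also have "\<dots> = path_power (window f 0 (period f)) k" using window_power[OF f] k by simp
  finally have pw: "c = path_power (window f 0 (period f)) k" .
  have "\<not> k > 1"
  proof
    assume k1: "k > 1"
    have "period f < l" using k k1 period_pos[OF f] by simp
    moreover have "path_length c = l" by (simp add: path_length_def l_def cs_def)
    ultimately show False
      using assms window_period_primitive[OF f, of 0] pw k1 stream_window[OF f, of 0 "period f"]
      unfolding primitive_cycle_def by (metis length_window(1))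
  qed
  then have "k = 1" using k l by (cases k) auto
  then show ?thesis using that f c k by simp
qed


lemma primitive_cycle_unique:
  assumes "primitive_cycle Q Z c" "primitive_cycle Q Z c'" "hd (snd c) = hd (snd c')"
  shows "c = c'"
proof -
  obtain f where f: "admissible_stream f" "c = window f 0 (period f)"
    using primitive_cycle_window[OF assms(1)] .
  obtain g where g: "admissible_stream g" "c' = window g 0 (period g)"
    using primitive_cycle_window[OF assms(2)] .
  have "f 0 = g 0"
    using assms(3) f g period_pos[OF f(1)] period_pos[OF g(1)] by (simp add: window_def hd_map)
  then have "f = g" using stream_eq[OF f(1) g(1), of 0 0] by auto
  then show ?thesis using f g by simp
qed

lemma primitive_cycle_nonempty: "primitive_cycle Q Z c \<Longrightarrow> snd c \<noteq> []"
  unfolding primitive_cycle_def Defs.cycle_def path_length_def by auto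

lemma primitive_cycle_admissible: "primitive_cycle Q Z c \<Longrightarrow> admissible_path Q Z c"
  using primitive_cycle_window stream_window by metis

lemma primitive_cycle_path: "primitive_cycle Q Z c \<Longrightarrow> c \<in> paths Q"
  and primitive_cycle_head: "primitive_cycle Q Z c \<Longrightarrow> path_head Q c = path_tail c"
  unfolding primitive_cycle_def Defs.cycle_def by auto

lemma finite_primitive_cycles: "finite {c. primitive_cycle Q Z c \<and> path_tail c = v}"
proof (rule finite_subset)
  show "finite {c. primitive_cycle Q Z c}"
  proof (rule inj_on_finite)
    show "inj_on (\<lambda>c. hd (snd c)) {c. primitive_cycle Q Z c}"
      using primitive_cycle_unique by (auto simp: inj_on_def simp del: split_paired_All)
    show "(\<lambda>c. hd (snd c)) ` {c. primitive_cycle Q Z c} \<subseteq> arcs Q"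
    proof safe
      fix v as assume "primitive_cycle Q Z (v, as)"
      then show "hd (snd (v, as)) \<in> arcs Q"
        using primitive_cycle_path[of "(v, as)"] primitive_cycle_nonempty[of "(v, as)"] 
        by (auto simp: mem_paths_iff)
    qed
  qed simp
qed auto

text \<open>
  Predecessors in admissible paths are unique, so the path agrees with the stream of the cycle also
  before it reaches the cycle.
\<close>

lemma primitive_subpath_stream:
  assumes "admissible_path Q Z p" "primitive_cycle Q Z c" "sublist (snd c) (snd p)"
  obtains f where "admissible_stream f" "p = window f 0 (path_length p)"
proof -
  obtain g where g: "admissible_stream g" "c = window g 0 (period g)"
    using primitive_cycle_window[OF assms(2)] .
  obtain ps qs where p: "snd p = ps @ snd c @ qs" using assms(3) by (auto simp: sublist_def)
  define k where "k = length ps"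
  \<comment> \<open>A multiple of the period that leaves room for the \<open>k\<close> steps back.\<close>
  define K where "K = k * period g"
  have K: "k \<le> K" using period_pos[OF g(1)] by (simp add: K_def)
  have l: "k < length (snd p)" using p primitive_cycle_nonempty[OF assms(2)] by (simp add: k_def)
  have "snd p ! k = g 0" using p g period_pos[OF g(1)] by (simp add: k_def nth_append window_def)
  also have "\<dots> = g K" using period_dvd[OF g(1), of 0 K] by (simp add: K_def)
  finally have gK: "snd p ! k = g K" .
  have "i \<le> k \<Longrightarrow> snd p ! (k - i) = g (K - i)" for i
  proof (induction i)
    case (Suc i)
    have "follows (snd p ! (k - Suc i)) (snd p ! Suc (k - Suc i))"
      using admissible_follows_nth[OF assms(1)] Suc.prems l by simp
    moreover have "follows (g (K - Suc i)) (g (Suc (K - Suc i)))" using stream_follows[OF g(1)] .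
    ultimately show ?case using Suc K by (simp add: Suc_diff_Suc follows_unique_back)
  qed (use gK in simp)
  from this[of k] have "snd p ! 0 = g (K - k + 0)" by simp
  moreover have ne: "snd p \<noteq> []" using l by auto
  ultimately have "hd (snd p) = g (K - k + 0)" by (simp add: hd_conv_nth)
  moreover note ne
  ultimately have "p = window g (K - k + 0) (path_length p)"
    using stream_agree[OF g(1) assms(1)] by simp
  then show ?thesis
    using that[OF stream_shift[OF g(1), of "K - k"]] by (simp add: window_shift)
qed

lemma window_decomp:
  assumes "admissible_stream f" "x \<in> paths Q" "y \<in> paths Q" "path_tail x = path_head Q y" 
    "path_comp x y = window f i N"
  shows "y = window f i (path_length y)" "x = window f (i + path_length y) (path_length x)"
    "N = path_length y + path_length x"
proof -
  have l: "N = path_length y + path_length x"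
    using arg_cong[OF assms(5), of path_length] by (simp add: path_length_def)
  have s: "snd y @ snd x = map f [i..<i + path_length y] @ map f [i + path_length y..<i + path_length y + path_length x]"
    using assms(5) l map_upt_add[of f i "path_length y" "path_length x"]
    by (simp add: path_comp_def window_def)
  then have s': "snd y = map f [i..<i + path_length y]" 
    "snd x = map f [i + path_length y..<i + path_length y + path_length x]"
    by (simp_all add: path_length_def)
  have "fst y = tail Q (f i)" using assms(5) by (simp add: path_comp_def window_def)
  with s' show y: "y = window f i (path_length y)" by (simp add: window_def prod_eq_iff)
  have "fst x = tail Q (f (i + path_length y))"
    using assms(4) head_window[OF assms(1), of i "path_length y"] y by (simp add: path_tail_def)
  with s' show "x = window f (i + path_length y) (path_length x)" by (simp add: window_def prod_eq_iff)
  show "N = path_length y + path_length x" by fact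
qed

lemma primitive_cycle_in_stream:
  assumes "admissible_stream f" "primitive_cycle Q Z c" "c = window f i N"
  shows "N = period f"
proof -
  have c: "c = window f i (period f)"
  proof (rule primitive_cycle_unique[OF assms(2) window_period_primitive[OF assms(1)]])
    have "N > 0" using primitive_cycle_nonempty[OF assms(2)] assms(3) by (cases N) (auto simp: window_def)
    then show "hd (snd c) = hd (snd (window f i (period f)))"
      using period_pos[OF assms(1)] by (simp add: assms(3) window_def hd_map)
  qed
  show ?thesis
    using arg_cong[OF c, of path_length] arg_cong[OF assms(3), of path_length] by simp
qed

lemma window_period_add:
  assumes "admissible_stream f"
  shows "window f (i + period f) N = window f i N"
proof -
  have "f (i + period f + j) = f (i + j)" for j
    using period_add[OF assms, of "i + j"] by (simp add: ac_simps)
  from this this[of 0] show ?thesis by (simp add: window_def list_eq_iff_nth_eq)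
qed

text \<open>
  A primitive cycle between two pieces of a path keeps the path on the stream precisely if it starts
  with the arrow that the stream takes at this place, because this makes it one full turn of the
  stream. Thus \<open>\<sigma>\<^sub>v\<close> acts on paths on the stream as one full turn: its other summands leave the stream.
\<close>

lemma insert_primitive_cycle:
  assumes "admissible_stream f" "u \<in> paths Q" "w \<in> paths Q" "path_tail u = path_head Q w"
    and "primitive_cycle Q Z c" "path_tail c = path_head Q w"
  shows "path_comp u (path_comp c w) = window f 0 N \<longleftrightarrow>
    N \<ge> period f \<and> c = window f (path_length w) (period f) \<and> path_comp u w = window f 0 (N - period f)"
proof
  assume eq: "path_comp u (path_comp c w) = window f 0 N"
  note hc = primitive_cycle_head[OF assms(5)] primitive_cycle_path[OF assms(5)]
  have cw: "path_comp c w \<in> paths Q" "path_head Q (path_comp c w) = path_head Q c"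
    using path_head_comp[OF hc(2) assms(3,6)] by auto
  have t: "path_tail u = path_head Q (path_comp c w)" using cw hc assms by simp
  note d1 = window_decomp[OF assms(1,2) cw(1) t eq]
  note d2 = window_decomp[OF assms(1) hc(2) assms(3,6) d1(1)]
  have c: "c = window f (path_length w) (path_length c)" using d2(2) by simp
  then have lc: "path_length c = period f" using primitive_cycle_in_stream[OF assms(1,5)] by simp
  have N: "N = path_length w + period f + path_length u" using d1(3) d2(3) lc by simp
  have "path_length (path_comp c w) = path_length w + period f" using d2(3) lc by simp
  then have u: "u = window f (path_length w + period f) (path_length u)" using d1(2) by simp
  have "u = window f (0 + path_length w) (path_length u)"
    using u window_period_add[OF assms(1)] by simp
  moreover have "w = window f 0 (path_length w)" by (rule d2(1))
  ultimately have "path_comp u w = window f 0 (path_length w + path_length u)"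
    using window_comp by metis
  then show "N \<ge> period f \<and> c = window f (path_length w) (period f) \<and> path_comp u w = window f 0 (N - period f)"
    using N c lc by simp
next
  assume r: "N \<ge> period f \<and> c = window f (path_length w) (period f) \<and> path_comp u w = window f 0 (N - period f)"
  note d = window_decomp[OF assms(1-4) conjunct2[OF conjunct2[OF r]]]
  have cw: "path_comp c w = window f 0 (path_length w + period f)"
    using d(1) r window_comp[of f 0 "path_length w" "period f"] by simp
  have u: "u = window f (0 + (path_length w + period f)) (path_length u)"
    using d(2) window_period_add[OF assms(1)] by simp
  have "path_comp u (path_comp c w) = window f 0 (path_length w + period f + path_length u)"
    using window_comp[of f 0 "path_length w + period f" "path_length u"] u cw by simp
  moreover have "N = path_length w + period f + path_length u" using d(3) conjunct1[OF r] by linarith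
  ultimately show "path_comp u (path_comp c w) = window f 0 N" by simp
qed

text \<open>
  Of two admissible paths with the same first arrow one is an initial piece of the other, so
  arbitrarily long ones fit together to a stream.
\<close>

lemma unbounded_stream:
  assumes "\<And>N. \<exists>x. admissible_path Q Z x \<and> snd x \<noteq> [] \<and> hd (snd x) = b \<and> N \<le> path_length x"
  obtains f where "admissible_stream f" "f 0 = b"
proof -
  obtain X where X: "\<And>N. admissible_path Q Z (X N)" "\<And>N. snd (X N) \<noteq> []" "\<And>N. hd (snd (X N)) = b"
    "\<And>N. N \<le> length (snd (X N))"
    using assms unfolding path_length_def by metis
  have agree: "snd (X M) ! j = snd (X N) ! j" if "j < length (snd (X M))" "j < length (snd (X N))" for M N j
    using that
  proof (induction j)
    case 0 then show ?case using X by (metis hd_conv_nth)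
  next
    case (Suc j)
    then show ?case
      using follows_unique admissible_follows_nth[OF X(1), of j M] admissible_follows_nth[OF X(1), of j N] by simp
  qed
  define f where "f = (\<lambda>j. snd (X (Suc j)) ! j)"
  have f0: "f 0 = b" using X(2,3)[of "Suc 0"] by (simp add: f_def hd_conv_nth)
  have "b \<in> arcs Q" using X(1-3)[of 0] mem_paths_iff[of "fst (X 0)" "snd (X 0)"] unfolding admissible_iff by auto
  have "admissible_path Q Z (window f 0 N)" for N
  proof (cases N)
    case 0
    then show ?thesis using trivial_admissible f0 \<open>b \<in> arcs Q\<close> by (simp add: window_def)
  next
    case (Suc N')
    have "f j = snd (X N) ! j" if "j < N" for j
      using agree[of j "Suc j" N] X(4)[of "Suc j"] X(4)[of N] that by (simp add: f_def)
    then have "snd (window f 0 N) = take N (snd (X N))"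
      using X(4)[of N] by (simp add: window_def list_eq_iff_nth_eq)
    then have "sublist (snd (window f 0 N)) (snd (X N))" by simp
    from admissible_subpath[OF X(1) this] show ?thesis
      using Suc by (simp add: window_def upt_rec)
  qed
  then show ?thesis using that f0 unfolding admissible_stream_def by blast
qed

text \<open>
  An arrow that starts no stream starts only admissible paths of bounded length, and every arrow
  starts at most one stream. As there are finitely many arrows, one number exceeds all these bounds
  and the periods of all streams.
\<close>

lemma long_paths:
  obtains m where "m > 0"
    and "\<And>c. primitive_cycle Q Z c \<Longrightarrow> path_length c \<le> m"
    and "\<And>x. admissible_path Q Z x \<Longrightarrow> m \<le> path_length x \<Longrightarrow>
      \<exists>f. admissible_stream f \<and> period f < path_length x \<and> x = window f 0 (path_length x)"
proof -
  have "\<exists>m. \<forall>x. admissible_path Q Z x \<and> snd x \<noteq> [] \<and> hd (snd x) = b \<and> m \<le> path_length x \<longrightarrow>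
    (\<exists>f. admissible_stream f \<and> f 0 = b \<and> period f < m)" for b
  proof (cases "\<exists>f. admissible_stream f \<and> f 0 = b")
    case True
    then obtain f where "admissible_stream f" "f 0 = b" by blast
    then show ?thesis by (intro exI[of _ "Suc (period f)"]) auto
  next
    case False
    then show ?thesis using unbounded_stream[of b] by metis
  qed
  then obtain M where M: "\<And>b x. admissible_path Q Z x \<Longrightarrow> snd x \<noteq> [] \<Longrightarrow> hd (snd x) = b \<Longrightarrow> 
    M b \<le> path_length x \<Longrightarrow> \<exists>f. admissible_stream f \<and> f 0 = b \<and> period f < M b"
    by metis
  define m where "m = Suc (\<Sum>b\<in>arcs Q. M b)"
  have Mm: "M b < m" if "b \<in> arcs Q" for b
    using that by (simp add: m_def less_Suc_eq_le member_le_sum)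
  show ?thesis
  proof (rule that[of m])
    show "m > 0" by (simp add: m_def)
    fix x assume x: "admissible_path Q Z x" "m \<le> path_length x"
    then have ne: "snd x \<noteq> []" by (auto simp: m_def path_length_def)
    define b where "b = hd (snd x)"
    have "b \<in> arcs Q" using x(1) ne mem_paths_iff[of "fst x" "snd x"] unfolding admissible_iff b_def by auto
    then obtain f where f: "admissible_stream f" "f 0 = b" "period f < M b"
      using M[OF x(1) ne b_def[symmetric]] Mm[of b] x(2) by auto
    have "x = window f 0 (path_length x)" using stream_agree[OF f(1) x(1) ne] f(2) b_def by simp
    moreover have "period f < path_length x" using f(3) Mm[OF \<open>b \<in> arcs Q\<close>] x(2) by simp
    ultimately show "\<exists>f. admissible_stream f \<and> period f < path_length x \<and> x = window f 0 (path_length x)" 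
      using f(1) by blast
  next
    fix c assume c: "primitive_cycle Q Z c"
    obtain g where g: "admissible_stream g" "c = window g 0 (period g)" using primitive_cycle_window[OF c] .
    have "\<exists>f. admissible_stream f \<and> f 0 = g 0 \<and> period f < M (g 0)"
      by (rule M[OF stream_window[OF g(1), of 0 "Suc (M (g 0))"]])
         (simp_all add: window_def path_length_def upt_conv_Cons del: upt_Suc)
    then obtain f where f: "admissible_stream f" "f 0 = g 0" "period f < M (g 0)" by blast
    have "f = g" using stream_eq[OF f(1) g(1), of 0 0] f(2) by auto
    then show "path_length c \<le> m" using f(3) Mm[OF stream_arcs[OF g(1), of 0]] g(2) by simp
  qed
qed

section \<open>The primitive-nerve partition\<close>

lemma traversed_window:
  assumes "admissible_stream f"
  shows "traversed_vertices Q (window f 0 (period f)) = range (\<lambda>j. tail Q (f j))"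
proof (intro equalityI subsetI)
  note p = period_pos[OF assms] and h = head_window[OF assms, of 0 "period f"]
  fix v assume "v \<in> traversed_vertices Q (window f 0 (period f))"
  then show "v \<in> range (\<lambda>j. tail Q (f j))"
    using p h unfolding traversed_vertices_def by (auto simp: awalk_verts_conv path_head_def window_def split: if_splits)
next
  note p = period_pos[OF assms]
  fix v assume "v \<in> range (\<lambda>j. tail Q (f j))"
  then obtain j where "v = tail Q (f (j mod period f))" using period_mod[OF assms] by auto
  moreover have "j mod period f < period f" using p by simp
  ultimately show "v \<in> traversed_vertices Q (window f 0 (period f))"
    using p unfolding traversed_vertices_def by (auto simp: awalk_verts_conv window_def)
qed

text \<open>The relation whose transitive closure has the parts \<open>V[i]\<close> as its classes.\<close>

definition nerve_relation :: "('v \<times> 'v) set" where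
  "nerve_relation = (\<Union>c \<in> {c. primitive_cycle Q Z c}. traversed_vertices Q c \<times> traversed_vertices Q c)"

lemma equiv_nerve: "equiv (primitive_vertices Q Z) (nerve_relation\<^sup>+)"
proof (rule equivI)
  show "nerve_relation\<^sup>+ \<subseteq> primitive_vertices Q Z \<times> primitive_vertices Q Z"
    by (rule trancl_subset_Sigma) (auto simp: nerve_relation_def primitive_vertices_def)
  show "refl_on (primitive_vertices Q Z) (nerve_relation\<^sup>+)"
    by (rule refl_onI) (auto simp: nerve_relation_def primitive_vertices_def intro!: r_into_trancl)
  show "sym (nerve_relation\<^sup>+)"
    by (rule sym_trancl) (auto simp: nerve_relation_def sym_def)
qed simp

lemma nerve_partition_disjoint:
  assumes "X \<in> primitive_nerve_partition Q Z" "Y \<in> primitive_nerve_partition Q Z" "v \<in> X" "v \<in> Y"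
  shows "X = Y"
  using quotient_disj[OF equiv_nerve, of X Y] assms
  unfolding primitive_nerve_partition_def nerve_relation_def by blast

lemma stream_in_nerve_part:
  assumes "admissible_stream f"
  obtains X where "X \<in> primitive_nerve_partition Q Z" "\<And>j. tail Q (f j) \<in> X"
proof (rule that)
  let ?X = "nerve_relation\<^sup>+ `` {tail Q (f 0)}"
  have r: "(tail Q (f 0), tail Q (f j)) \<in> nerve_relation" for j
    using window_period_primitive[OF assms, of 0] traversed_window[OF assms]
    unfolding nerve_relation_def by blast
  then show "tail Q (f j) \<in> ?X" for j by auto
  show "?X \<in> primitive_nerve_partition Q Z"
    unfolding primitive_nerve_partition_def nerve_relation_def[symmetric]
  proof (rule quotientI)
    show "tail Q (f 0) \<in> primitive_vertices Q Z"
      using window_period_primitive[OF assms, of 0] traversed_window[OF assms]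
      unfolding primitive_vertices_def by blast
  qed
qed

end

section \<open>Sums of ideals and regular sequences\<close>

text \<open>
  The path algebra is not commutative, so the sum of a family of ideals has to be available over
  arbitrary rings.
\<close>

lemma (in ring) ideals_set_abelian_monoid: "abelian_monoid (ideals_set R)"
proof (rule abelian_monoidI)
  fix I J K assume I: "I \<in> carrier (ideals_set R)" and J: "J \<in> carrier (ideals_set R)"
    and K: "K \<in> carrier (ideals_set R)"
  have id: "ideal I R" "ideal J R" "ideal K R" using I J K by (auto simp: ideals_set_def)
  then have sub: "I \<subseteq> carrier R" "J \<subseteq> carrier R" "K \<subseteq> carrier R"
    by (auto simp: additive_subgroup.a_subset ideal.axioms(1))
  show "I \<oplus>\<^bsub>ideals_set R\<^esub> J \<in> carrier (ideals_set R)"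
    using add_ideals id by (simp add: ideals_set_def)
  show "(I \<oplus>\<^bsub>ideals_set R\<^esub> J) \<oplus>\<^bsub>ideals_set R\<^esub> K = I \<oplus>\<^bsub>ideals_set R\<^esub> (J \<oplus>\<^bsub>ideals_set R\<^esub> K)"
    using add.set_mult_assoc[OF sub] by (simp add: ideals_set_def set_add_def)
  show "I \<oplus>\<^bsub>ideals_set R\<^esub> J = J \<oplus>\<^bsub>ideals_set R\<^esub> I"
    using set_add_comm[OF sub(1,2)] by (simp add: ideals_set_def)
  show "\<zero>\<^bsub>ideals_set R\<^esub> \<oplus>\<^bsub>ideals_set R\<^esub> I = I"
    using sub(1) by (force simp: ideals_set_def set_add_def' subset_iff)
qed (simp add: ideals_set_def zeroideal)

lemma (in ring) set_add_least:
  assumes "ideal K R" "I \<subseteq> K" "J \<subseteq> K"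
  shows "I <+>\<^bsub>R\<^esub> J \<subseteq> K"
  using assms additive_subgroup.a_closed[OF ideal.axioms(1)[OF assms(1)]]
  by (auto simp: set_add_def' subset_iff)

lemma (in ring) set_add_superset:
  assumes z: "\<zero> \<in> I" "\<zero> \<in> J" and c: "I \<subseteq> carrier R" "J \<subseteq> carrier R"
  shows "I \<subseteq> I <+>\<^bsub>R\<^esub> J" "J \<subseteq> I <+>\<^bsub>R\<^esub> J"
proof -
  show "I \<subseteq> I <+>\<^bsub>R\<^esub> J"
  proof
    fix x assume x: "x \<in> I"
    then have "x = x \<oplus> \<zero>" using c by auto
    with x z show "x \<in> I <+>\<^bsub>R\<^esub> J" unfolding set_add_def' by blast
  qed
  show "J \<subseteq> I <+>\<^bsub>R\<^esub> J"
  proof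
    fix x assume x: "x \<in> J"
    then have "x = \<zero> \<oplus> x" using c by auto
    with x z show "x \<in> I <+>\<^bsub>R\<^esub> J" unfolding set_add_def' by blast
  qed
qed

lemma (in ring) set_add_upper:
  assumes "ideal I R" "ideal J R"
  shows "I \<subseteq> I <+>\<^bsub>R\<^esub> J" "J \<subseteq> I <+>\<^bsub>R\<^esub> J"
  using assms
  by (simp_all add: set_add_superset additive_subgroup.zero_closed additive_subgroup.a_subset ideal.axioms(1))

lemma (in ring) ideal_sum:
  assumes "finite A" "\<And>i. i \<in> A \<Longrightarrow> ideal (F i) R"
  shows ideal_sum_ideal: "ideal (\<Oplus>\<^bsub>ideals_set R\<^esub> i \<in> A. F i) R"
    and ideal_sum_upper: "\<And>i. i \<in> A \<Longrightarrow> F i \<subseteq> (\<Oplus>\<^bsub>ideals_set R\<^esub> i \<in> A. F i)"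
    and ideal_sum_least: "\<And>K. ideal K R \<Longrightarrow> (\<And>i. i \<in> A \<Longrightarrow> F i \<subseteq> K) \<Longrightarrow> (\<Oplus>\<^bsub>ideals_set R\<^esub> i \<in> A. F i) \<subseteq> K"
proof -
  interpret S: abelian_monoid "ideals_set R" by (rule ideals_set_abelian_monoid)
  have car: "carrier (ideals_set R) = {I. ideal I R}" and ad: "X \<oplus>\<^bsub>ideals_set R\<^esub> Y = X <+>\<^bsub>R\<^esub> Y"
    and ze: "\<zero>\<^bsub>ideals_set R\<^esub> = {\<zero>}" for X Y
    by (simp_all add: ideals_set_def)
  have "ideal (\<Oplus>\<^bsub>ideals_set R\<^esub> i \<in> A. F i) R \<and> (\<forall>i\<in>A. F i \<subseteq> (\<Oplus>\<^bsub>ideals_set R\<^esub> i \<in> A. F i)) \<and>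
    (\<forall>K. ideal K R \<longrightarrow> (\<forall>i\<in>A. F i \<subseteq> K) \<longrightarrow> (\<Oplus>\<^bsub>ideals_set R\<^esub> i \<in> A. F i) \<subseteq> K)"
    using assms
  proof (induction A rule: finite_induct)
    case empty
    show ?case by (simp add: ze zeroideal additive_subgroup.zero_closed ideal.axioms(1))
  next
    case (insert i A)
    have eq: "(\<Oplus>\<^bsub>ideals_set R\<^esub> i \<in> insert i A. F i) = F i <+>\<^bsub>R\<^esub> (\<Oplus>\<^bsub>ideals_set R\<^esub> i \<in> A. F i)"
      using insert.hyps insert.prems by (subst S.finsum_insert) (auto simp: car ad)
    have i: "ideal (F i) R" "ideal (\<Oplus>\<^bsub>ideals_set R\<^esub> i \<in> A. F i) R"
      using insert by auto
    have IH: "\<forall>i\<in>A. F i \<subseteq> (\<Oplus>\<^bsub>ideals_set R\<^esub> i \<in> A. F i)"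
       "\<forall>K. ideal K R \<longrightarrow> (\<forall>i\<in>A. F i \<subseteq> K) \<longrightarrow> (\<Oplus>\<^bsub>ideals_set R\<^esub> i \<in> A. F i) \<subseteq> K"
      using insert by auto
    show ?case unfolding eq
    proof (intro conjI ballI allI impI)
      show "F j \<subseteq> F i <+>\<^bsub>R\<^esub> (\<Oplus>\<^bsub>ideals_set R\<^esub> i \<in> A. F i)" if "j \<in> insert i A" for j
        using that IH(1) set_add_upper[OF i] by blast
      show "F i <+>\<^bsub>R\<^esub> (\<Oplus>\<^bsub>ideals_set R\<^esub> i \<in> A. F i) \<subseteq> K" if "ideal K R" "\<forall>j\<in>insert i A. F j \<subseteq> K" for K
        using that IH(2) by (intro set_add_least) auto
    qed (rule add_ideals[OF i])
  qed
  then show "ideal (\<Oplus>\<^bsub>ideals_set R\<^esub> i \<in> A. F i) R"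
    "\<And>i. i \<in> A \<Longrightarrow> F i \<subseteq> (\<Oplus>\<^bsub>ideals_set R\<^esub> i \<in> A. F i)"
    "\<And>K. ideal K R \<Longrightarrow> (\<And>i. i \<in> A \<Longrightarrow> F i \<subseteq> K) \<Longrightarrow> (\<Oplus>\<^bsub>ideals_set R\<^esub> i \<in> A. F i) \<subseteq> K"
    by blast+
qed

text \<open>That \<open>a\<close> is a non-zero-divisor on \<open>R/J\<close>.\<close>

definition (in cring) regular_mod :: "'a \<Rightarrow> 'a set \<Rightarrow> bool" where
  "regular_mod a J \<longleftrightarrow> (\<forall>x \<in> carrier R. a \<otimes> x \<in> J \<longrightarrow> x \<in> J)"

lemma (in cring) Idl_insert_iff:
  assumes "S \<subseteq> carrier R" "a \<in> carrier R"
  shows "x \<in> Idl (insert a S) \<longleftrightarrow> (\<exists>j \<in> Idl S. \<exists>y \<in> carrier R. x = j \<oplus> a \<otimes> y)"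
proof -
  have idS: "ideal (Idl S) R" and idP: "ideal (PIdl a) R"
    using assms genideal_ideal cgenideal_ideal by auto
  have "Idl (insert a S) = Idl S <+>\<^bsub>R\<^esub> PIdl a"
  proof (rule equalityI)
    show "Idl (insert a S) \<subseteq> Idl S <+>\<^bsub>R\<^esub> PIdl a"
      using set_add_upper[OF idS idP] genideal_self[OF assms(1)] cgenideal_self[OF assms(2)]
      by (intro genideal_minimal add_ideals idS idP) auto
    have idI: "ideal (Idl (insert a S)) R" using assms genideal_ideal by simp
    have "insert a S \<subseteq> Idl (insert a S)" using assms by (intro genideal_self) simp
    then show "Idl S <+>\<^bsub>R\<^esub> PIdl a \<subseteq> Idl (insert a S)"
      using idI by (intro set_add_least cgenideal_minimal genideal_minimal) auto
  qed
  then show ?thesis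
    using assms(2) m_comm unfolding set_add_def' cgenideal_def by fastforce
qed

text \<open>
  Let \<open>J\<close> be the ideal generated by \<open>S\<close>. If \<open>ax = j + by\<close> with \<open>j \<in> J\<close>, then \<open>y = j' + az\<close> with
  \<open>j' \<in> J\<close> because \<open>b\<close> is regular modulo \<open>J + (a)\<close>. So \<open>a(x - bz) \<in> J\<close>, hence \<open>x - bz \<in> J\<close> because
  \<open>a\<close> is regular modulo \<open>J\<close>, and \<open>x \<in> J + (b)\<close>.
\<close>

lemma (in cring) regular_mod_swap:
  assumes S: "S \<subseteq> carrier R" and a: "a \<in> carrier R" and b: "b \<in> carrier R"
    and ra: "regular_mod a (Idl S)" and rb: "regular_mod b (Idl (insert a S))"
  shows "regular_mod a (Idl (insert b S))"
  unfolding regular_mod_def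
proof (intro ballI impI)
  interpret J: ideal "Idl S" R using S genideal_ideal by blast
  fix x assume x: "x \<in> carrier R" "a \<otimes> x \<in> Idl (insert b S)"
  then obtain j y where j: "j \<in> Idl S" "y \<in> carrier R" "a \<otimes> x = j \<oplus> b \<otimes> y"
    using Idl_insert_iff[OF S b] by blast
  have jc: "j \<in> carrier R" using j(1) J.Icarr by blast
  have "b \<otimes> y = (\<ominus> j) \<oplus> a \<otimes> x" unfolding j(3) using jc j b by (simp add: r_neg1)
  then have "b \<otimes> y \<in> Idl (insert a S)"
    using Idl_insert_iff[OF S a] j(1) x(1) by blast
  then have "y \<in> Idl (insert a S)" using rb j(2) unfolding regular_mod_def by blast
  then obtain j' z where j': "j' \<in> Idl S" "z \<in> carrier R" "y = j' \<oplus> a \<otimes> z"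
    using Idl_insert_iff[OF S a] by blast
  have j'c: "j' \<in> carrier R" using j'(1) J.Icarr by blast
  have "a \<otimes> (x \<ominus> b \<otimes> z) = a \<otimes> x \<ominus> b \<otimes> (a \<otimes> z)"
    using a b x j'(2) by (simp add: a_minus_def r_distr r_minus m_lcomm)
  also have "\<dots> = j \<oplus> b \<otimes> j'"
    unfolding j(3) j'(3) using a b jc j'c j'(2)
    by (simp add: a_minus_def r_distr a_assoc r_neg)
  finally have "a \<otimes> (x \<ominus> b \<otimes> z) \<in> Idl S"
    using j(1) j'(1) J.I_l_closed[OF j'(1) b] J.a_closed by simp
  then have "x \<ominus> b \<otimes> z \<in> Idl S" using ra x(1) b j'(2) unfolding regular_mod_def by simp
  moreover have "x = (x \<ominus> b \<otimes> z) \<oplus> b \<otimes> z"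
    using x(1) b j'(2) by (simp add: a_minus_def a_assoc l_neg)
  ultimately show "x \<in> Idl (insert b S)" using Idl_insert_iff[OF S b] j'(2) by blast
qed

text \<open>Exchange \<open>s\<^sub>i\<close> successively with \<open>s\<^sub>i\<^sub>+\<^sub>1, \<dots>, s\<^sub>n\<close>.\<close>

lemma (in cring) regular_sequence_move_last:
  assumes "regular_sequence R n s" "i \<in> {1..n}"
  shows "regular_mod (s i) (Idl (s ` ({1..n} - {i})))"
proof -
  have s: "\<And>j. j \<in> {1..n} \<Longrightarrow> s j \<in> carrier R"
    and r: "\<And>j. j \<in> {1..n} \<Longrightarrow> regular_mod (s j) (Idl (s ` {1..<j}))"
    using assms(1) unfolding regular_sequence_def regular_mod_def by auto
  have "i \<le> k \<Longrightarrow> k \<le> n \<Longrightarrow> regular_mod (s i) (Idl (s ` ({1..k} - {i})))" for k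
  proof (induction k rule: dec_induct)
    case base
    have "{1..i} - {i} = {1..<i}" by auto
    then show ?case using r[OF assms(2)] by simp
  next
    case (step k)
    have e1: "s ` ({1..Suc k} - {i}) = insert (s (Suc k)) (s ` ({1..k} - {i}))"
      using step assms(2) by (auto simp: atLeastAtMostSuc_conv)
    have "{1..<Suc k} = insert i ({1..k} - {i})" using step assms(2) by auto
    then have e2: "s ` {1..<Suc k} = insert (s i) (s ` ({1..k} - {i}))" by (metis image_insert)
    show ?case unfolding e1
    proof (rule regular_mod_swap)
      show "regular_mod (s (Suc k)) (Idl (insert (s i) (s ` ({1..k} - {i}))))"
        using r[of "Suc k"] step e2 by simp
    qed (use step s assms in auto)
  qed
  then show ?thesis using assms(2) by simp
qed

text \<open>Cancelling \<open>s\<^sub>i\<close> repeatedly would bring \<open>1\<close> into the ideal generated by the sequence.\<close>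

lemma (in cring) regular_sequence_power:
  assumes "regular_sequence R n s" "i \<in> {1..n}"
  shows "s i [^] (k::nat) \<notin> Idl (s ` ({1..n} - {i}))"
proof
  let ?J = "Idl (s ` ({1..n} - {i}))"
  have s: "s ` {1..n} \<subseteq> carrier R" and ne: "Idl (s ` {1..n}) \<noteq> carrier R"
    using assms(1) unfolding regular_sequence_def by auto
  have si: "s i \<in> carrier R" using s assms(2) by auto
  assume "s i [^] k \<in> ?J"
  then have "\<one> \<in> ?J"
  proof (induction k)
    case (Suc k)
    have "s i \<otimes> s i [^] k \<in> ?J" using Suc.prems si by (simp add: m_comm)
    then have "s i [^] k \<in> ?J"
      using regular_sequence_move_last[OF assms] si unfolding regular_mod_def by blast
    then show ?case by (rule Suc.IH)
  qed simp
  moreover have "?J \<subseteq> Idl (s ` {1..n})"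
    using genideal_self[OF s] genideal_ideal[OF s] by (intro genideal_minimal) auto
  ultimately show False
    using ideal.one_imp_carrier[OF genideal_ideal[OF s]] ne by blast
qed

section \<open>Calculating in the path algebra\<close>

locale path_alg = R: cring R + fin_digraph Q
  for R :: "('r, 'm) ring_scheme" (structure) and Q :: "('v, 'e) pre_digraph"
begin

abbreviation RQ :: "('r, ('v, 'e) qpath \<Rightarrow> 'r) module" where
  "RQ \<equiv> path_algebra R Q"

sublocale RQ: ring RQ
  by (rule ring_path_algebra) unfold_locales

lemma mem_RQ: "f \<in> carrier RQ \<longleftrightarrow>
    (\<forall>x. f x \<in> carrier R) \<and> (\<forall>x. x \<notin> paths Q \<longrightarrow> f x = \<zero>) \<and> finite {x. f x \<noteq> \<zero>}"
  by (simp add: path_algebra_def)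

lemma coeff_closed: "f \<in> carrier RQ \<Longrightarrow> f x \<in> carrier R"
  by (simp only: mem_RQ)

lemma supp_finite: "f \<in> carrier RQ \<Longrightarrow> finite {x. f x \<noteq> \<zero>}"
  by (simp only: mem_RQ)

lemma supp_paths: "f \<in> carrier RQ \<Longrightarrow> f x \<noteq> \<zero> \<Longrightarrow> x \<in> paths Q"
  unfolding mem_RQ by blast

lemma RQ_mult: "(f \<otimes>\<^bsub>RQ\<^esub> g) x = (\<Oplus> pq \<in> path_factorizations Q x. f (fst pq) \<otimes> g (snd pq))"
  and RQ_add: "(f \<oplus>\<^bsub>RQ\<^esub> g) x = f x \<oplus> g x"
  and RQ_zero: "\<zero>\<^bsub>RQ\<^esub> x = \<zero>"
  and RQ_smult: "(r \<odot>\<^bsub>RQ\<^esub> f) x = r \<otimes> f x"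
  by (simp_all add: path_algebra_def)

lemma RQ_neg:
  assumes "f \<in> carrier RQ"
  shows "(\<ominus>\<^bsub>RQ\<^esub> f) x = \<ominus> f x"
proof -
  have "(\<ominus>\<^bsub>RQ\<^esub> f \<oplus>\<^bsub>RQ\<^esub> f) x = \<zero>" using assms by (simp add: RQ.l_neg RQ_zero)
  then have "(\<ominus>\<^bsub>RQ\<^esub> f) x \<oplus> f x = \<zero>" by (simp add: RQ_add)
  then show ?thesis
    using assms coeff_closed RQ.a_inv_closed R.minus_equality by metis
qed

lemma path_elem_closed [simp]: "p \<in> paths Q \<Longrightarrow> path_elem R p \<in> carrier RQ"
  by (auto simp: mem_RQ path_elem_def)

lemma smult_closed [simp]:
  assumes "r \<in> carrier R" "f \<in> carrier RQ"
  shows "r \<odot>\<^bsub>RQ\<^esub> f \<in> carrier RQ"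
proof -
  have "{x. r \<otimes> f x \<noteq> \<zero>} \<subseteq> {x. f x \<noteq> \<zero>}" using assms by auto
  then show ?thesis using assms unfolding mem_RQ RQ_smult by (auto intro: finite_subset)
qed

lemma smult_mult_left:
  assumes "r \<in> carrier R" "f \<in> carrier RQ" "g \<in> carrier RQ"
  shows "(r \<odot>\<^bsub>RQ\<^esub> f) \<otimes>\<^bsub>RQ\<^esub> g = r \<odot>\<^bsub>RQ\<^esub> (f \<otimes>\<^bsub>RQ\<^esub> g)"
proof
  fix x
  have "((r \<odot>\<^bsub>RQ\<^esub> f) \<otimes>\<^bsub>RQ\<^esub> g) x = (\<Oplus> pq \<in> path_factorizations Q x. r \<otimes> (f (fst pq) \<otimes> g (snd pq)))"
    unfolding RQ_mult RQ_smult using assms coeff_closed by (intro R.finsum_cong') (auto simp: R.m_assoc)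
  also have "\<dots> = r \<otimes> (f \<otimes>\<^bsub>RQ\<^esub> g) x"
    unfolding RQ_mult using assms coeff_closed
    by (intro R.finsum_rdistr[symmetric] finite_path_factorizations) auto
  finally show "((r \<odot>\<^bsub>RQ\<^esub> f) \<otimes>\<^bsub>RQ\<^esub> g) x = (r \<odot>\<^bsub>RQ\<^esub> (f \<otimes>\<^bsub>RQ\<^esub> g)) x" by (simp add: RQ_smult)
qed

lemma smult_mult_right:
  assumes "r \<in> carrier R" "f \<in> carrier RQ" "g \<in> carrier RQ"
  shows "f \<otimes>\<^bsub>RQ\<^esub> (r \<odot>\<^bsub>RQ\<^esub> g) = r \<odot>\<^bsub>RQ\<^esub> (f \<otimes>\<^bsub>RQ\<^esub> g)"
proof
  fix x
  have "(f \<otimes>\<^bsub>RQ\<^esub> (r \<odot>\<^bsub>RQ\<^esub> g)) x = (\<Oplus> pq \<in> path_factorizations Q x. r \<otimes> (f (fst pq) \<otimes> g (snd pq)))"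
    unfolding RQ_mult RQ_smult using assms coeff_closed by (intro R.finsum_cong') (auto simp: R.m_lcomm)
  also have "\<dots> = r \<otimes> (f \<otimes>\<^bsub>RQ\<^esub> g) x"
    unfolding RQ_mult using assms coeff_closed
    by (intro R.finsum_rdistr[symmetric] finite_path_factorizations) auto
  finally show "(f \<otimes>\<^bsub>RQ\<^esub> (r \<odot>\<^bsub>RQ\<^esub> g)) x = (r \<odot>\<^bsub>RQ\<^esub> (f \<otimes>\<^bsub>RQ\<^esub> g)) x" by (simp add: RQ_smult)
qed

lemma smult_add:
  assumes "r \<in> carrier R" "f \<in> carrier RQ" "g \<in> carrier RQ"
  shows "r \<odot>\<^bsub>RQ\<^esub> (f \<oplus>\<^bsub>RQ\<^esub> g) = r \<odot>\<^bsub>RQ\<^esub> f \<oplus>\<^bsub>RQ\<^esub> r \<odot>\<^bsub>RQ\<^esub> g"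
  using assms coeff_closed by (intro ext) (simp add: RQ_smult RQ_add R.r_distr)

lemma add_smult:
  assumes "r \<in> carrier R" "r' \<in> carrier R" "f \<in> carrier RQ"
  shows "(r \<oplus> r') \<odot>\<^bsub>RQ\<^esub> f = r \<odot>\<^bsub>RQ\<^esub> f \<oplus>\<^bsub>RQ\<^esub> r' \<odot>\<^bsub>RQ\<^esub> f"
  using assms coeff_closed by (intro ext) (simp add: RQ_smult RQ_add R.l_distr)

lemma smult_assoc:
  assumes "r \<in> carrier R" "r' \<in> carrier R" "f \<in> carrier RQ"
  shows "(r \<otimes> r') \<odot>\<^bsub>RQ\<^esub> f = r \<odot>\<^bsub>RQ\<^esub> (r' \<odot>\<^bsub>RQ\<^esub> f)"
  using assms coeff_closed by (intro ext) (simp add: RQ_smult R.m_assoc)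

lemma smult_zero: "r \<in> carrier R \<Longrightarrow> r \<odot>\<^bsub>RQ\<^esub> \<zero>\<^bsub>RQ\<^esub> = \<zero>\<^bsub>RQ\<^esub>"
  by (intro ext) (simp add: RQ_smult RQ_zero)

lemma zero_smult: "f \<in> carrier RQ \<Longrightarrow> \<zero> \<odot>\<^bsub>RQ\<^esub> f = \<zero>\<^bsub>RQ\<^esub>"
  using coeff_closed by (intro ext) (simp add: RQ_smult RQ_zero)

lemma ideal_smult_closed:
  assumes "ideal I RQ" "r \<in> carrier R" "f \<in> I"
  shows "r \<odot>\<^bsub>RQ\<^esub> f \<in> I"
proof -
  have f: "f \<in> carrier RQ" using ideal.Icarr[OF assms(1,3)] .
  have "r \<odot>\<^bsub>RQ\<^esub> f = (r \<odot>\<^bsub>RQ\<^esub> \<one>\<^bsub>RQ\<^esub>) \<otimes>\<^bsub>RQ\<^esub> f"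
    using assms f by (simp add: smult_mult_left)
  then show ?thesis using ideal.I_l_closed[OF assms(1,3)] assms(2) by simp
qed

lemma path_elem_mult:
  assumes p: "p \<in> paths Q" and q: "q \<in> paths Q"
  shows "path_elem R p \<otimes>\<^bsub>RQ\<^esub> path_elem R q =
    (if path_tail p = path_head Q q then path_elem R (path_comp p q) else \<zero>\<^bsub>RQ\<^esub>)"
proof
  fix x
  let ?F = "path_factorizations Q x"
  have "(path_elem R p \<otimes>\<^bsub>RQ\<^esub> path_elem R q) x = (\<Oplus> pq \<in> ?F. if (p, q) = pq then \<one> else \<zero>)"
    unfolding RQ_mult by (rule R.finsum_cong') (auto simp: path_elem_def)
  also have "\<dots> = (if (p, q) \<in> ?F then \<one> else \<zero>)"
  proof (cases "(p, q) \<in> ?F")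
    case True
    then show ?thesis
      using R.add.finprod_singleton[OF True finite_path_factorizations, of "\<lambda>_. \<one>"] by simp
  next
    case False
    then have "(\<Oplus> pq \<in> ?F. if (p, q) = pq then \<one> else \<zero>) = \<zero>"
      by (intro R.add.finprod_one_eqI[simplified]) auto
    then show ?thesis using False by simp
  qed
  also have "\<dots> = (if path_tail p = path_head Q q then path_elem R (path_comp p q) else \<zero>\<^bsub>RQ\<^esub>) x"
    using p q by (auto simp: path_factorizations_def path_elem_def RQ_zero)
  finally show "(path_elem R p \<otimes>\<^bsub>RQ\<^esub> path_elem R q) x =
    (if path_tail p = path_head Q q then path_elem R (path_comp p q) else \<zero>\<^bsub>RQ\<^esub>) x" .
qed

text \<open>
  Every element is built from its own terms \<open>f(x)x\<close>; keeping these coefficients in the step allows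
  hypotheses on the coefficients of \<open>f\<close> to be used there.
\<close>

lemma RQ_induct [consumes 1, case_names zero add]:
  assumes "f \<in> carrier RQ"
    and "P \<zero>\<^bsub>RQ\<^esub>"
    and "\<And>x g. x \<in> paths Q \<Longrightarrow> f x \<noteq> \<zero> \<Longrightarrow> g \<in> carrier RQ \<Longrightarrow> P g \<Longrightarrow>
      P (f x \<odot>\<^bsub>RQ\<^esub> path_elem R x \<oplus>\<^bsub>RQ\<^esub> g)"
  shows "P f"
proof -
  have *: "P (\<lambda>x. if x \<in> A then f x else \<zero>)" if "finite A" "A \<subseteq> {x. f x \<noteq> \<zero>}" for A
    using that
  proof (induction A rule: finite_induct)
    case empty
    have "(\<lambda>x. if x \<in> {} then f x else \<zero>) = \<zero>\<^bsub>RQ\<^esub>" by (rule ext) (simp add: RQ_zero)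
    then show ?case using assms(2) by simp
  next
    case (insert x A)
    let ?g = "\<lambda>x. if x \<in> A then f x else \<zero>"
    have fx: "f x \<noteq> \<zero>" using insert by auto
    have g: "?g \<in> carrier RQ"
      using assms(1) insert.hyps(1) unfolding mem_RQ by (auto elim: finite_subset[rotated])
    have "(\<lambda>y. if y \<in> insert x A then f y else \<zero>) = f x \<odot>\<^bsub>RQ\<^esub> path_elem R x \<oplus>\<^bsub>RQ\<^esub> ?g"
      using insert.hyps(2) coeff_closed[OF assms(1)]
      by (auto simp: RQ_add RQ_smult path_elem_def fun_eq_iff)
    then show ?case
      using assms(3)[OF supp_paths[OF assms(1) fx] fx g] insert by simp
  qed
  have "(\<lambda>x. if x \<in> {x. f x \<noteq> \<zero>} then f x else \<zero>) = f" by auto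
  then show ?thesis using *[OF supp_finite[OF assms(1)] order_refl] by simp
qed

section \<open>Linear functionals on the path algebra\<close>

text \<open>The linear extension to \<open>RQ\<close> of a function on paths.\<close>

definition lin :: "(('v, 'e) qpath \<Rightarrow> 'r) \<Rightarrow> (('v, 'e) qpath \<Rightarrow> 'r) \<Rightarrow> 'r" where
  "lin \<phi> f = (\<Oplus> x \<in> {x. f x \<noteq> \<zero>}. f x \<otimes> \<phi> x)"

context
  fixes \<phi> :: "('v, 'e) qpath \<Rightarrow> 'r"
  assumes \<phi>: "\<And>x. \<phi> x \<in> carrier R"
begin

lemma lin_superset:
  assumes "f \<in> carrier RQ" "finite B" "{x. f x \<noteq> \<zero>} \<subseteq> B"
  shows "lin \<phi> f = (\<Oplus> x \<in> B. f x \<otimes> \<phi> x)"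
  unfolding lin_def using assms coeff_closed[OF assms(1)] \<phi>
  by (intro R.add.finprod_mono_neutral_cong_left) auto

lemma lin_closed: "f \<in> carrier RQ \<Longrightarrow> lin \<phi> f \<in> carrier R"
  unfolding lin_def using coeff_closed \<phi> by (intro R.finsum_closed) auto

lemma lin_add:
  assumes "f \<in> carrier RQ" "g \<in> carrier RQ"
  shows "lin \<phi> (f \<oplus>\<^bsub>RQ\<^esub> g) = lin \<phi> f \<oplus> lin \<phi> g"
proof -
  let ?B = "{x. f x \<noteq> \<zero>} \<union> {x. g x \<noteq> \<zero>}"
  have B: "finite ?B" using assms supp_finite by blast
  have s: "{x. (f \<oplus>\<^bsub>RQ\<^esub> g) x \<noteq> \<zero>} \<subseteq> ?B" by (auto simp: RQ_add)
  have "lin \<phi> (f \<oplus>\<^bsub>RQ\<^esub> g) = (\<Oplus> x \<in> ?B. f x \<otimes> \<phi> x \<oplus> g x \<otimes> \<phi> x)"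
    unfolding lin_superset[OF RQ.a_closed[OF assms] B s] RQ_add
    using assms coeff_closed \<phi> by (intro R.finsum_cong') (auto simp: R.l_distr)
  also have "\<dots> = (\<Oplus> x \<in> ?B. f x \<otimes> \<phi> x) \<oplus> (\<Oplus> x \<in> ?B. g x \<otimes> \<phi> x)"
    using assms coeff_closed \<phi> by (intro R.finsum_addf) auto
  also have "\<dots> = lin \<phi> f \<oplus> lin \<phi> g"
    using lin_superset[OF assms(1) B] lin_superset[OF assms(2) B] by auto
  finally show ?thesis .
qed

lemma lin_smult:
  assumes "r \<in> carrier R" "f \<in> carrier RQ"
  shows "lin \<phi> (r \<odot>\<^bsub>RQ\<^esub> f) = r \<otimes> lin \<phi> f"
proof -
  let ?B = "{x. f x \<noteq> \<zero>}"
  have s: "{x. (r \<odot>\<^bsub>RQ\<^esub> f) x \<noteq> \<zero>} \<subseteq> ?B" using assms(1) by (auto simp: RQ_smult)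
  have "lin \<phi> (r \<odot>\<^bsub>RQ\<^esub> f) = (\<Oplus> x \<in> ?B. r \<otimes> (f x \<otimes> \<phi> x))"
    unfolding lin_superset[OF smult_closed[OF assms] supp_finite[OF assms(2)] s] RQ_smult
    using assms coeff_closed \<phi> by (intro R.finsum_cong') (auto simp: R.m_assoc)
  also have "\<dots> = r \<otimes> lin \<phi> f"
    unfolding lin_def using assms coeff_closed \<phi> supp_finite
    by (intro R.finsum_rdistr[symmetric]) auto
  finally show ?thesis .
qed

lemma lin_zero: "lin \<phi> \<zero>\<^bsub>RQ\<^esub> = \<zero>"
  by (simp add: lin_def RQ_zero)

lemma lin_neg:
  assumes "f \<in> carrier RQ"
  shows "lin \<phi> (\<ominus>\<^bsub>RQ\<^esub> f) = \<ominus> lin \<phi> f"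
proof -
  have "lin \<phi> (\<ominus>\<^bsub>RQ\<^esub> f) \<oplus> lin \<phi> f = \<zero>"
    using lin_add[of "\<ominus>\<^bsub>RQ\<^esub> f" f] assms lin_zero by (simp add: RQ.l_neg)
  then show ?thesis using assms lin_closed R.minus_equality by (metis RQ.a_inv_closed)
qed

lemma lin_minus:
  assumes "f \<in> carrier RQ" "g \<in> carrier RQ"
  shows "lin \<phi> (f \<ominus>\<^bsub>RQ\<^esub> g) = lin \<phi> f \<ominus> lin \<phi> g"
  using assms by (simp add: a_minus_def lin_add lin_neg)

lemma lin_path_elem: "\<one> \<noteq> \<zero> \<Longrightarrow> lin \<phi> (path_elem R p) = \<phi> p"
  using \<phi> by (simp add: lin_def path_elem_def)

lemma lin_finsum:
  assumes "finite C" "\<And>c. c \<in> C \<Longrightarrow> g c \<in> carrier RQ"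
  shows "lin \<phi> (\<Oplus>\<^bsub>RQ\<^esub> c \<in> C. g c) = (\<Oplus> c \<in> C. lin \<phi> (g c))"
  using assms
proof (induction C rule: finite_induct)
  case (insert c C)
  then show ?case
    using lin_closed by (simp add: RQ.finsum_insert R.finsum_insert lin_add RQ.finsum_closed Pi_iff)
qed (simp add: lin_zero)

text \<open>
  The largest two-sided ideal on which the functional takes values in \<open>J\<close>. By linearity it suffices
  to take paths for the factors \<open>a\<close> and \<open>b\<close>, which is \<open>lin_idealI\<close> below.
\<close>

definition lin_ideal :: "'r set \<Rightarrow> (('v, 'e) qpath \<Rightarrow> 'r) set" where
  "lin_ideal J = {f \<in> carrier RQ. \<forall>a \<in> carrier RQ. \<forall>b \<in> carrier RQ. lin \<phi> (a \<otimes>\<^bsub>RQ\<^esub> f \<otimes>\<^bsub>RQ\<^esub> b) \<in> J}"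

lemma lin_ideal_ideal:
  assumes "ideal J R"
  shows "ideal (lin_ideal J) RQ"
proof -
  interpret J: ideal J R by fact
  show ?thesis
  proof (rule idealI)
    show "ring RQ" by (rule RQ.ring_axioms)
    show "subgroup (lin_ideal J) (add_monoid RQ)"
    proof (rule RQ.add.subgroupI)
      show "lin_ideal J \<subseteq> carrier RQ" by (auto simp: lin_ideal_def)
      have "\<zero>\<^bsub>RQ\<^esub> \<in> lin_ideal J" by (auto simp: lin_ideal_def lin_zero)
      then show "lin_ideal J \<noteq> {}" by blast
      show "\<ominus>\<^bsub>RQ\<^esub> f \<in> lin_ideal J" if "f \<in> lin_ideal J" for f
        using that by (auto simp: lin_ideal_def RQ.l_minus RQ.r_minus lin_neg)
      show "f \<oplus>\<^bsub>RQ\<^esub> g \<in> lin_ideal J" if "f \<in> lin_ideal J" "g \<in> lin_ideal J" for f g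
        using that by (auto simp: lin_ideal_def RQ.l_distr RQ.r_distr lin_add)
    qed
    show "x \<otimes>\<^bsub>RQ\<^esub> f \<in> lin_ideal J" "f \<otimes>\<^bsub>RQ\<^esub> x \<in> lin_ideal J" if "f \<in> lin_ideal J" "x \<in> carrier RQ" for f x
    proof -
      have f: "f \<in> carrier RQ" "\<And>a b. a \<in> carrier RQ \<Longrightarrow> b \<in> carrier RQ \<Longrightarrow> lin \<phi> (a \<otimes>\<^bsub>RQ\<^esub> f \<otimes>\<^bsub>RQ\<^esub> b) \<in> J"
        using that by (auto simp: lin_ideal_def)
      have "lin \<phi> (a \<otimes>\<^bsub>RQ\<^esub> (x \<otimes>\<^bsub>RQ\<^esub> f) \<otimes>\<^bsub>RQ\<^esub> b) \<in> J" "lin \<phi> (a \<otimes>\<^bsub>RQ\<^esub> (f \<otimes>\<^bsub>RQ\<^esub> x) \<otimes>\<^bsub>RQ\<^esub> b) \<in> J"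
        if "a \<in> carrier RQ" "b \<in> carrier RQ" for a b
        using f(2)[of "a \<otimes>\<^bsub>RQ\<^esub> x" b] f(2)[of a "x \<otimes>\<^bsub>RQ\<^esub> b"] that f(1) \<open>x \<in> carrier RQ\<close>
        by (simp_all add: RQ.m_assoc)
      then show "x \<otimes>\<^bsub>RQ\<^esub> f \<in> lin_ideal J" "f \<otimes>\<^bsub>RQ\<^esub> x \<in> lin_ideal J"
        using f(1) that(2) by (auto simp: lin_ideal_def)
    qed
  qed
qed

lemma lin_ideal_value:
  assumes "f \<in> lin_ideal J"
  shows "lin \<phi> f \<in> J"
proof -
  have "f \<in> carrier RQ" using assms by (simp add: lin_ideal_def)
  moreover have "lin \<phi> (\<one>\<^bsub>RQ\<^esub> \<otimes>\<^bsub>RQ\<^esub> f \<otimes>\<^bsub>RQ\<^esub> \<one>\<^bsub>RQ\<^esub>) \<in> J"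
    using assms RQ.one_closed unfolding lin_ideal_def by blast
  ultimately show ?thesis by simp
qed

lemma lin_idealI:
  assumes J: "ideal J R" and f: "f \<in> carrier RQ"
    and uw: "\<And>u w. u \<in> paths Q \<Longrightarrow> w \<in> paths Q \<Longrightarrow>
      lin \<phi> (path_elem R u \<otimes>\<^bsub>RQ\<^esub> f \<otimes>\<^bsub>RQ\<^esub> path_elem R w) \<in> J"
  shows "f \<in> lin_ideal J"
proof -
  interpret J: ideal J R by fact
  have 1: "lin \<phi> (path_elem R u \<otimes>\<^bsub>RQ\<^esub> f \<otimes>\<^bsub>RQ\<^esub> b) \<in> J" if u: "u \<in> paths Q" and b: "b \<in> carrier RQ" for u b
    using b
  proof (induction b rule: RQ_induct)
    case zero
    then show ?case using u f by (simp add: lin_zero)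
  next
    case (add x g)
    then show ?case
      using u f b uw[OF u, of x]
      by (simp add: RQ.r_distr smult_mult_right lin_add lin_smult coeff_closed J.I_l_closed)
  qed
  have "lin \<phi> (a \<otimes>\<^bsub>RQ\<^esub> f \<otimes>\<^bsub>RQ\<^esub> b) \<in> J" if a: "a \<in> carrier RQ" and b: "b \<in> carrier RQ" for a b
    using a
  proof (induction a rule: RQ_induct)
    case zero
    then show ?case using b f by (simp add: lin_zero)
  next
    case (add x g)
    then show ?case
      using b f a 1[OF _ b, of x]
      by (simp add: RQ.l_distr smult_mult_left lin_add lin_smult coeff_closed J.I_l_closed)
  qed
  then show ?thesis using f by (simp add: lin_ideal_def)
qed

end

end

section \<open>The nerve ideal\<close>

locale nerve_algebra = path_alg R Q + special_quiver Q Z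
  for R :: "('r, 'm) ring_scheme" (structure) and Q :: "('v, 'e) pre_digraph"
    and Z :: "('v, 'e) qpath set" +
  fixes n :: nat and V :: "nat \<Rightarrow> 'v set" and s :: "nat \<Rightarrow> 'r"
  assumes nerve_parts: "bij_betw V {1..n} (primitive_nerve_partition Q Z)"
    and regular_seq: "regular_sequence R n s"
begin

abbreviation \<mm> :: "'r set" where
  "\<mm> \<equiv> Idl (s ` {1..n})"

abbreviation \<I> :: "(('v, 'e) qpath \<Rightarrow> 'r) set" where
  "\<I> \<equiv> nerve_ideal R Q Z n V s"

abbreviation vert :: "'v \<Rightarrow> ('v, 'e) qpath \<Rightarrow> 'r" where
  "vert \<equiv> vertex_elem R"

abbreviation cycles_at :: "'v \<Rightarrow> ('v, 'e) qpath set" where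
  "cycles_at v \<equiv> {c. primitive_cycle Q Z c \<and> path_tail c = v}"

abbreviation \<sigma> :: "'v \<Rightarrow> ('v, 'e) qpath \<Rightarrow> 'r" where
  "\<sigma> \<equiv> primitive_cycle_sum R Q Z"

lemma s_closed: "i \<in> {1..n} \<Longrightarrow> s i \<in> carrier R"
  using regular_seq unfolding regular_sequence_def by blast

lemma s_subset: "A \<subseteq> {1..n} \<Longrightarrow> s ` A \<subseteq> carrier R"
  using s_closed by blast

lemma max_ideal: "ideal \<mm> R"
  by (intro R.genideal_ideal s_subset) simp

lemma s_in_max: "i \<in> {1..n} \<Longrightarrow> s i \<in> \<mm>"
  using R.genideal_self[OF s_subset[OF order_refl]] by blast

lemma one_not_in_max: "\<one> \<notin> \<mm>"
  using regular_seq ideal.one_imp_carrier[OF max_ideal] unfolding regular_sequence_def by blast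

lemma nontrivial: "\<one> \<noteq> \<zero>"
  using one_not_in_max max_ideal additive_subgroup.zero_closed ideal.axioms(1) by metis

lemma stream_part:
  assumes "admissible_stream f"
  obtains i where "i \<in> {1..n}" "\<And>j. tail Q (f j) \<in> V i"
proof -
  obtain X where X: "X \<in> primitive_nerve_partition Q Z" "\<And>j. tail Q (f j) \<in> X"
    by (rule stream_in_nerve_part[OF assms]) blast
  then obtain i where "i \<in> {1..n}" "X = V i"
    using nerve_parts unfolding bij_betw_def by blast
  then show ?thesis using that X(2) by blast
qed

lemma part_unique:
  assumes "i \<in> {1..n}" "j \<in> {1..n}" "v \<in> V i" "v \<in> V j"
  shows "i = j"
proof -
  have "V i = V j"
    using nerve_partition_disjoint[of "V i" "V j" v] nerve_parts assms unfolding bij_betw_def by blast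
  then show ?thesis using nerve_parts assms(1,2) unfolding bij_betw_def inj_on_def by blast
qed

lemma part_verts:
  assumes "i \<in> {1..n}"
  shows "V i \<subseteq> verts Q"
proof -
  have "V i \<in> primitive_nerve_partition Q Z" using nerve_parts assms unfolding bij_betw_def by blast
  then have "V i \<subseteq> primitive_vertices Q Z"
    using Union_quotient[OF equiv_nerve] unfolding primitive_nerve_partition_def nerve_relation_def by blast
  moreover have "primitive_vertices Q Z \<subseteq> verts Q"
  proof
    fix v assume "v \<in> primitive_vertices Q Z"
    then obtain c where c: "primitive_cycle Q Z c" "v \<in> traversed_vertices Q c"
      unfolding primitive_vertices_def by blast
    obtain f where f: "admissible_stream f" "c = window f 0 (period f)"
      using primitive_cycle_window[OF c(1)] .
    then show "v \<in> verts Q"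
      using c(2) traversed_window[OF f(1)] stream_arcs[OF f(1)] by auto
  qed
  ultimately show ?thesis by blast
qed

lemma trivial_in_paths: "v \<in> verts Q \<Longrightarrow> trivial_path v \<in> paths Q"
  by (simp add: trivial_path_def mem_paths_iff)

lemma head_trivial [simp]: "path_head Q (trivial_path v) = v" "path_tail (trivial_path v) = v"
  by (simp_all add: trivial_path_def path_head_eq path_tail_def)

lemma comp_trivial [simp]: "path_tail u = v \<Longrightarrow> path_comp u (trivial_path v) = u"
  "path_comp (trivial_path v) w = w"
  by (auto simp: trivial_path_def path_comp_def path_tail_def)

lemma tail_comp [simp]: "path_tail (path_comp p q) = path_tail q"
  by (simp add: path_tail_def)

lemma length_comp [simp]: "path_length (path_comp p q) = path_length q + path_length p"
  by (simp add: path_length_def)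

lemma vert_closed [simp]: "v \<in> verts Q \<Longrightarrow> vert v \<in> carrier RQ"
  by (simp add: vertex_elem_def trivial_in_paths)

lemma cycle_closed: "c \<in> cycles_at v \<Longrightarrow> path_elem R c \<in> carrier RQ"
  using primitive_cycle_path by simp

lemma sigma_closed [simp]: "\<sigma> v \<in> carrier RQ"
  unfolding primitive_cycle_sum_def using cycle_closed by (intro RQ.finsum_closed) auto

lemma Z_closed: "path_elem R ` Z \<subseteq> carrier RQ"
  using Z_paths by auto

lemma nerve_ideal_summands:
  shows "ideal (genideal RQ (path_elem R ` Z)) RQ"
    and "i \<in> {1..n} \<Longrightarrow> ideal (genideal RQ {(s i \<odot>\<^bsub>RQ\<^esub> vert v) \<ominus>\<^bsub>RQ\<^esub> \<sigma> v | v. v \<in> V i}) RQ"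
    and "i \<in> {1..n} \<Longrightarrow> ideal (genideal RQ {s i \<odot>\<^bsub>RQ\<^esub> vert v | v. v \<in> verts Q - V i}) RQ"
  using Z_closed part_verts[of i] s_closed[of i] by (auto intro!: RQ.genideal_ideal RQ.minus_closed)

lemma nerve_ideal_least:
  assumes K: "ideal K RQ"
    and "\<And>z. z \<in> Z \<Longrightarrow> path_elem R z \<in> K"
    and "\<And>i v. i \<in> {1..n} \<Longrightarrow> v \<in> V i \<Longrightarrow> (s i \<odot>\<^bsub>RQ\<^esub> vert v) \<ominus>\<^bsub>RQ\<^esub> \<sigma> v \<in> K"
    and "\<And>i v. i \<in> {1..n} \<Longrightarrow> v \<in> verts Q - V i \<Longrightarrow> s i \<odot>\<^bsub>RQ\<^esub> vert v \<in> K"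
  shows "\<I> \<subseteq> K"
  unfolding nerve_ideal_def Let_def using assms(2-4)
  by (intro RQ.set_add_least RQ.ideal_sum_least RQ.genideal_minimal K RQ.add_ideals nerve_ideal_summands) auto

lemma nerve_ideal_ideal: "ideal \<I> RQ"
  unfolding nerve_ideal_def Let_def
  by (intro RQ.add_ideals RQ.ideal_sum_ideal nerve_ideal_summands) auto

lemma nerve_ideal_gens:
  shows gen_Z: "\<And>z. z \<in> Z \<Longrightarrow> path_elem R z \<in> \<I>"
    and gen_part: "\<And>i v. i \<in> {1..n} \<Longrightarrow> v \<in> V i \<Longrightarrow> (s i \<odot>\<^bsub>RQ\<^esub> vert v) \<ominus>\<^bsub>RQ\<^esub> \<sigma> v \<in> \<I>"
    and gen_off_part: "\<And>i v. i \<in> {1..n} \<Longrightarrow> v \<in> verts Q - V i \<Longrightarrow> s i \<odot>\<^bsub>RQ\<^esub> vert v \<in> \<I>"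
proof -
  let ?Z = "genideal RQ (path_elem R ` Z)"
  let ?F = "\<lambda>i. genideal RQ {(s i \<odot>\<^bsub>RQ\<^esub> vert v) \<ominus>\<^bsub>RQ\<^esub> \<sigma> v | v. v \<in> V i} <+>\<^bsub>RQ\<^esub>
    genideal RQ {s i \<odot>\<^bsub>RQ\<^esub> vert v | v. v \<in> verts Q - V i}"
  have F: "ideal (?F i) RQ" if "i \<in> {1..n}" for i
    using that by (intro RQ.add_ideals nerve_ideal_summands)
  have I: "\<I> = ?Z <+>\<^bsub>RQ\<^esub> (\<Oplus>\<^bsub>ideals_set RQ\<^esub> i \<in> {1..n}. ?F i)"
    by (simp add: nerve_ideal_def Let_def)
  have S: "ideal (\<Oplus>\<^bsub>ideals_set RQ\<^esub> i \<in> {1..n}. ?F i) RQ" using F by (intro RQ.ideal_sum_ideal) auto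
  have "?Z \<subseteq> \<I>" unfolding I by (rule RQ.set_add_upper[OF nerve_ideal_summands(1) S])
  then show "path_elem R z \<in> \<I>" if "z \<in> Z" for z
    using RQ.genideal_self[OF Z_closed] that by blast
  fix i assume i: "i \<in> {1..n}"
  have "?F i \<subseteq> (\<Oplus>\<^bsub>ideals_set RQ\<^esub> i \<in> {1..n}. ?F i)"
    using RQ.ideal_sum_upper[of "{1..n}" ?F i] F i by auto
  also have "\<dots> \<subseteq> \<I>" unfolding I by (rule RQ.set_add_upper[OF nerve_ideal_summands(1) S])
  finally have Fi: "?F i \<subseteq> \<I>" .
  note up = RQ.set_add_upper[OF nerve_ideal_summands(2)[OF i] nerve_ideal_summands(3)[OF i]]
  show "(s i \<odot>\<^bsub>RQ\<^esub> vert v) \<ominus>\<^bsub>RQ\<^esub> \<sigma> v \<in> \<I>" if "v \<in> V i" for v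
  proof -
    have "{(s i \<odot>\<^bsub>RQ\<^esub> vert v) \<ominus>\<^bsub>RQ\<^esub> \<sigma> v | v. v \<in> V i} \<subseteq> carrier RQ"
      using part_verts[OF i] s_closed[OF i] by auto
    from RQ.genideal_self[OF this] up(1) Fi that show ?thesis by blast
  qed
  show "s i \<odot>\<^bsub>RQ\<^esub> vert v \<in> \<I>" if "v \<in> verts Q - V i" for v
  proof -
    have "{s i \<odot>\<^bsub>RQ\<^esub> vert v | v. v \<in> verts Q - V i} \<subseteq> carrier RQ"
      using s_closed[OF i] by auto
    from RQ.genideal_self[OF this] up(2) Fi that show ?thesis by blast
  qed
qed

lemma sandwich_vert:
  assumes "u \<in> paths Q" "w \<in> paths Q" "v \<in> verts Q"
  shows "path_elem R u \<otimes>\<^bsub>RQ\<^esub> vert v \<otimes>\<^bsub>RQ\<^esub> path_elem R w =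
    (if path_tail u = v \<and> path_head Q w = v then path_elem R (path_comp u w) else \<zero>\<^bsub>RQ\<^esub>)"
  using assms trivial_in_paths by (auto simp: vertex_elem_def path_elem_mult)

lemma sandwich_path:
  assumes "u \<in> paths Q" "w \<in> paths Q" "z \<in> paths Q"
  shows "path_elem R u \<otimes>\<^bsub>RQ\<^esub> path_elem R z \<otimes>\<^bsub>RQ\<^esub> path_elem R w =
    (if path_tail u = path_head Q z \<and> path_head Q w = path_tail z
     then path_elem R (path_comp u (path_comp z w)) else \<zero>\<^bsub>RQ\<^esub>)"
  using assms path_head_comp(2) by (auto simp: path_elem_mult path_comp_assoc)

lemma sandwich_sigma:
  assumes "u \<in> paths Q" "w \<in> paths Q"
  shows "path_elem R u \<otimes>\<^bsub>RQ\<^esub> \<sigma> v \<otimes>\<^bsub>RQ\<^esub> path_elem R w =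
    (if path_tail u = v \<and> path_head Q w = v
     then (\<Oplus>\<^bsub>RQ\<^esub> c \<in> cycles_at v. path_elem R (path_comp u (path_comp c w))) else \<zero>\<^bsub>RQ\<^esub>)"
proof -
  have "path_elem R u \<otimes>\<^bsub>RQ\<^esub> \<sigma> v \<otimes>\<^bsub>RQ\<^esub> path_elem R w =
    (\<Oplus>\<^bsub>RQ\<^esub> c \<in> cycles_at v. path_elem R u \<otimes>\<^bsub>RQ\<^esub> path_elem R c) \<otimes>\<^bsub>RQ\<^esub> path_elem R w"
    unfolding primitive_cycle_sum_def using assms cycle_closed finite_primitive_cycles
    by (subst RQ.finsum_rdistr) auto
  also have "\<dots> = (\<Oplus>\<^bsub>RQ\<^esub> c \<in> cycles_at v. path_elem R u \<otimes>\<^bsub>RQ\<^esub> path_elem R c \<otimes>\<^bsub>RQ\<^esub> path_elem R w)"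
    using assms cycle_closed finite_primitive_cycles by (intro RQ.finsum_ldistr) auto
  also have "\<dots> = (\<Oplus>\<^bsub>RQ\<^esub> c \<in> cycles_at v. if path_tail u = v \<and> path_head Q w = v
     then path_elem R (path_comp u (path_comp c w)) else \<zero>\<^bsub>RQ\<^esub>)"
  proof (rule RQ.finsum_cong'[OF refl])
    show "(\<lambda>c. if path_tail u = v \<and> path_head Q w = v then path_elem R (path_comp u (path_comp c w)) else \<zero>\<^bsub>RQ\<^esub>)
      \<in> cycles_at v \<rightarrow> carrier RQ"
      using assms primitive_cycle_path primitive_cycle_head path_head_comp by auto
    show "path_elem R u \<otimes>\<^bsub>RQ\<^esub> path_elem R c \<otimes>\<^bsub>RQ\<^esub> path_elem R w = (if path_tail u = v \<and> path_head Q w = v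
     then path_elem R (path_comp u (path_comp c w)) else \<zero>\<^bsub>RQ\<^esub>)" if "c \<in> cycles_at v" for c
      using that assms primitive_cycle_path primitive_cycle_head sandwich_path[of u w c] by auto
  qed
  also have "\<dots> = (if path_tail u = v \<and> path_head Q w = v
     then (\<Oplus>\<^bsub>RQ\<^esub> c \<in> cycles_at v. path_elem R (path_comp u (path_comp c w))) else \<zero>\<^bsub>RQ\<^esub>)"
    by (cases "path_tail u = v \<and> path_head Q w = v") (simp_all only: if_True if_False simp_thms RQ.finsum_zero)
  finally show ?thesis .
qed

lemma insert_cycle_path:
  assumes "u \<in> paths Q" "w \<in> paths Q" "path_tail u = path_head Q w" "c \<in> cycles_at (path_tail u)"
  shows "path_comp u (path_comp c w) \<in> paths Q"
  using assms primitive_cycle_path primitive_cycle_head path_head_comp by auto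

text \<open>
  The three hypotheses on \<open>\<phi>\<close> are the values of its linear extension on the elements \<open>ugw\<close>, where \<open>u\<close>
  and \<open>w\<close> are paths and \<open>g\<close> is one of the three kinds of generators; so all generators lie in the ideal
  \<open>lin_ideal \<phi> J\<close>.
\<close>

lemma nerve_ideal_functional:
  assumes \<phi>: "\<And>x. \<phi> x \<in> carrier R" and J: "ideal J R"
    and Z: "\<And>u z w. u \<in> paths Q \<Longrightarrow> z \<in> Z \<Longrightarrow> w \<in> paths Q \<Longrightarrow> path_tail u = path_head Q z \<Longrightarrow>
      path_tail z = path_head Q w \<Longrightarrow> \<phi> (path_comp u (path_comp z w)) \<in> J"
    and part: "\<And>i u w. i \<in> {1..n} \<Longrightarrow> path_tail u \<in> V i \<Longrightarrow> u \<in> paths Q \<Longrightarrow> w \<in> paths Q \<Longrightarrow> path_tail u = path_head Q w \<Longrightarrow>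
      s i \<otimes> \<phi> (path_comp u w) \<ominus> (\<Oplus> c \<in> cycles_at (path_tail u). \<phi> (path_comp u (path_comp c w))) \<in> J"
    and off_part: "\<And>i u w. i \<in> {1..n} \<Longrightarrow> path_tail u \<notin> V i \<Longrightarrow> u \<in> paths Q \<Longrightarrow> w \<in> paths Q \<Longrightarrow> path_tail u = path_head Q w \<Longrightarrow>
      s i \<otimes> \<phi> (path_comp u w) \<in> J"
    and f: "f \<in> \<I>"
  shows "lin \<phi> f \<in> J"
proof -
  interpret J: ideal J R by fact
  have K: "ideal (lin_ideal \<phi> J) RQ" using lin_ideal_ideal \<phi> J by blast
  note linp = lin_path_elem[OF \<phi> nontrivial]
  note linI = lin_idealI[OF \<phi> J]
  have lin0: "lin \<phi> \<zero>\<^bsub>RQ\<^esub> \<in> J" using lin_zero[of \<phi>] \<phi> J.zero_closed by simp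
  have "\<I> \<subseteq> lin_ideal \<phi> J"
  proof (rule nerve_ideal_least[OF K])
    fix z assume z: "z \<in> Z"
    show "path_elem R z \<in> lin_ideal \<phi> J"
    proof (rule linI)
      fix u w assume uw: "u \<in> paths Q" "w \<in> paths Q"
      have zp: "z \<in> paths Q" using z Z_paths by blast
      show "lin \<phi> (path_elem R u \<otimes>\<^bsub>RQ\<^esub> path_elem R z \<otimes>\<^bsub>RQ\<^esub> path_elem R w) \<in> J"
        unfolding sandwich_path[OF uw zp] using Z[OF uw(1) z uw(2)] lin0 by (simp add: linp)
    qed (use z Z_paths in auto)
  next
    fix i v assume i: "i \<in> {1..n}" and v: "v \<in> V i"
    have vv: "v \<in> verts Q" using part_verts i v by blast
    show "(s i \<odot>\<^bsub>RQ\<^esub> vert v) \<ominus>\<^bsub>RQ\<^esub> \<sigma> v \<in> lin_ideal \<phi> J"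
    proof (rule linI)
      fix u w assume uw: "u \<in> paths Q" "w \<in> paths Q"
      let ?u = "path_elem R u" and ?w = "path_elem R w"
      have eq: "?u \<otimes>\<^bsub>RQ\<^esub> ((s i \<odot>\<^bsub>RQ\<^esub> vert v) \<ominus>\<^bsub>RQ\<^esub> \<sigma> v) \<otimes>\<^bsub>RQ\<^esub> ?w =
        s i \<odot>\<^bsub>RQ\<^esub> (?u \<otimes>\<^bsub>RQ\<^esub> vert v \<otimes>\<^bsub>RQ\<^esub> ?w) \<ominus>\<^bsub>RQ\<^esub> (?u \<otimes>\<^bsub>RQ\<^esub> \<sigma> v \<otimes>\<^bsub>RQ\<^esub> ?w)"
        using uw vv s_closed[OF i]
        by (simp add: a_minus_def RQ.l_distr RQ.r_distr RQ.l_minus RQ.r_minus smult_mult_left smult_mult_right)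
      show "lin \<phi> (?u \<otimes>\<^bsub>RQ\<^esub> ((s i \<odot>\<^bsub>RQ\<^esub> vert v) \<ominus>\<^bsub>RQ\<^esub> \<sigma> v) \<otimes>\<^bsub>RQ\<^esub> ?w) \<in> J"
      proof (cases "path_tail u = v \<and> path_head Q w = v")
        case True
        have c: "path_elem R (path_comp u (path_comp c w)) \<in> carrier RQ" if "c \<in> cycles_at v" for c
          using insert_cycle_path[OF uw] True that by auto
        have uwp: "path_comp u w \<in> paths Q" using path_head_comp(2)[OF uw] True by simp
        have "lin \<phi> (?u \<otimes>\<^bsub>RQ\<^esub> ((s i \<odot>\<^bsub>RQ\<^esub> vert v) \<ominus>\<^bsub>RQ\<^esub> \<sigma> v) \<otimes>\<^bsub>RQ\<^esub> ?w) =
          lin \<phi> (s i \<odot>\<^bsub>RQ\<^esub> path_elem R (path_comp u w)) \<ominus>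
          lin \<phi> (\<Oplus>\<^bsub>RQ\<^esub> c \<in> cycles_at v. path_elem R (path_comp u (path_comp c w)))"
          unfolding eq sandwich_vert[OF uw vv] sandwich_sigma[OF uw] if_P[OF True]
          using uwp c s_closed[OF i] by (intro lin_minus \<phi> smult_closed RQ.finsum_closed) auto
        also have "lin \<phi> (\<Oplus>\<^bsub>RQ\<^esub> c \<in> cycles_at v. path_elem R (path_comp u (path_comp c w))) =
          (\<Oplus> c \<in> cycles_at v. \<phi> (path_comp u (path_comp c w)))"
          using lin_finsum[of \<phi> "cycles_at v" "\<lambda>c. path_elem R (path_comp u (path_comp c w))"] c finite_primitive_cycles \<phi>
          by (simp add: linp)
        also have "lin \<phi> (s i \<odot>\<^bsub>RQ\<^esub> path_elem R (path_comp u w)) = s i \<otimes> \<phi> (path_comp u w)"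
          using uwp s_closed[OF i] \<phi> by (simp add: lin_smult linp)
        finally show ?thesis using part[OF i _ uw] True v by auto
      next
        case False
        then have "?u \<otimes>\<^bsub>RQ\<^esub> ((s i \<odot>\<^bsub>RQ\<^esub> vert v) \<ominus>\<^bsub>RQ\<^esub> \<sigma> v) \<otimes>\<^bsub>RQ\<^esub> ?w = \<zero>\<^bsub>RQ\<^esub>"
          unfolding eq sandwich_vert[OF uw vv] sandwich_sigma[OF uw] if_not_P[OF False]
          using s_closed[OF i] by (simp add: smult_zero RQ.minus_eq)
        then show ?thesis using lin0 by simp
      qed
    qed (use vv s_closed[OF i] in auto)
  next
    fix i v assume i: "i \<in> {1..n}" and v: "v \<in> verts Q - V i"
    show "s i \<odot>\<^bsub>RQ\<^esub> vert v \<in> lin_ideal \<phi> J"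
    proof (rule linI)
      fix u w assume uw: "u \<in> paths Q" "w \<in> paths Q"
      have eq: "path_elem R u \<otimes>\<^bsub>RQ\<^esub> (s i \<odot>\<^bsub>RQ\<^esub> vert v) \<otimes>\<^bsub>RQ\<^esub> path_elem R w =
        s i \<odot>\<^bsub>RQ\<^esub> (path_elem R u \<otimes>\<^bsub>RQ\<^esub> vert v \<otimes>\<^bsub>RQ\<^esub> path_elem R w)"
        using uw v s_closed[OF i] by (simp add: smult_mult_left smult_mult_right)
      have "lin \<phi> (s i \<odot>\<^bsub>RQ\<^esub> (path_elem R u \<otimes>\<^bsub>RQ\<^esub> vert v \<otimes>\<^bsub>RQ\<^esub> path_elem R w)) \<in> J"
        using sandwich_vert[OF uw, of v] v off_part[OF i _ uw] path_head_comp(2)[OF uw] J.I_l_closed[OF lin0] s_closed[OF i] \<phi>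
        by (auto simp: lin_smult linp smult_zero)
      then show "lin \<phi> (path_elem R u \<otimes>\<^bsub>RQ\<^esub> (s i \<odot>\<^bsub>RQ\<^esub> vert v) \<otimes>\<^bsub>RQ\<^esub> path_elem R w) \<in> J"
        unfolding eq .
    qed (use v s_closed[OF i] in auto)
  qed
  then show ?thesis using f lin_ideal_value[of \<phi> f J] \<phi> by blast
qed

section \<open>Admissible paths lie outside the nerve ideal\<close>

lemma lin_coefficient:
  assumes "f \<in> carrier RQ"
  shows "lin (path_elem R p) f = f p"
proof -
  have \<phi>: "path_elem R p x \<in> carrier R" for x by (simp add: path_elem_def)
  let ?B = "insert p {x. f x \<noteq> \<zero>}"
  have B: "finite ?B" using supp_finite[OF assms] by simp
  have "lin (path_elem R p) f = (\<Oplus> x \<in> ?B. f x \<otimes> path_elem R p x)"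
    using B by (intro lin_superset \<phi> assms) auto
  also have "\<dots> = (\<Oplus> x \<in> ?B. if p = x then f x else \<zero>)"
    using coeff_closed[OF assms] by (intro R.finsum_cong') (auto simp: path_elem_def)
  also have "\<dots> = f p"
    using R.add.finprod_singleton[of p ?B f] B coeff_closed[OF assms] by auto
  finally show ?thesis .
qed

text \<open>
  Modulo \<open>\<mm>\<close> the generators become paths in \<open>Z\<close>, the elements \<open>-\<sigma>\<^sub>v\<close>, and \<open>0\<close>. Multiples of
  these by paths involve only paths that contain an element of \<open>Z\<close> or a primitive cycle, so \<open>p\<close> does
  not occur.
\<close>

lemma nerve_ideal_coefficient:
  assumes p: "admissible_path Q Z p" and free: "\<And>c. primitive_cycle Q Z c \<Longrightarrow> \<not> sublist (snd c) (snd p)"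
    and f: "f \<in> \<I>"
  shows "f p \<in> \<mm>"
proof -
  interpret M: ideal \<mm> R by (rule max_ideal)
  let ?\<phi> = "path_elem R p"
  have val: "?\<phi> x \<in> carrier R" for x by (simp add: path_elem_def)
  have zero: "?\<phi> x = \<zero>" if "x \<noteq> p" for x using that by (simp add: path_elem_def)
  have "lin ?\<phi> f \<in> \<mm>"
  proof (rule nerve_ideal_functional[OF val max_ideal _ _ _ f])
    fix u z w assume "z \<in> Z"
    moreover have "sublist (snd z) (snd (path_comp u (path_comp z w)))" by (auto simp: sublist_def)
    ultimately have "path_comp u (path_comp z w) \<noteq> p" using p unfolding admissible_iff by blast
    then show "?\<phi> (path_comp u (path_comp z w)) \<in> \<mm>" using zero M.zero_closed by simp
  next
    fix i u w assume i: "i \<in> {1..n}"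
    have "?\<phi> (path_comp u (path_comp c w)) = \<zero>" if "c \<in> cycles_at (path_tail u)" for c
    proof (rule zero)
      have "sublist (snd c) (snd (path_comp u (path_comp c w)))" by (auto simp: sublist_def)
      then show "path_comp u (path_comp c w) \<noteq> p" using free that by blast
    qed
    then have "(\<Oplus> c \<in> cycles_at (path_tail u). ?\<phi> (path_comp u (path_comp c w))) = \<zero>"
      by (intro R.add.finprod_one_eqI[simplified]) auto
    then show "s i \<otimes> ?\<phi> (path_comp u w) \<ominus> (\<Oplus> c \<in> cycles_at (path_tail u). ?\<phi> (path_comp u (path_comp c w))) \<in> \<mm>"
      using M.I_r_closed[OF s_in_max[OF i] val] s_closed[OF i] val by (simp add: a_minus_def)
  next
    fix i u w assume i: "i \<in> {1..n}"
    show "s i \<otimes> ?\<phi> (path_comp u w) \<in> \<mm>" using M.I_r_closed[OF s_in_max[OF i] val] .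
  qed
  then show ?thesis using lin_coefficient ideal.Icarr[OF nerve_ideal_ideal f] by simp
qed

text \<open>
  One full turn counts as the factor \<open>t\<close>. Only one residue \<open>r\<close> of the length is kept, because paths
  with different residues end at different arrows of the cycle, and their contributions must not be
  mixed.
\<close>

definition stream_weight :: "(nat \<Rightarrow> 'e) \<Rightarrow> nat \<Rightarrow> 'r \<Rightarrow> ('v, 'e) qpath \<Rightarrow> 'r" where
  "stream_weight f r t y =
     (if y = window f 0 (path_length y) \<and> path_length y mod period f = r
      then t [^] (path_length y div period f) else \<zero>)"

text \<open>
  Paths on the stream are admissible, so \<open>Z\<close> is killed. In the relations with \<open>s\<^sub>j\<close>, \<open>j \<noteq> i\<close>,
  the term with \<open>s\<^sub>j\<close> vanishes modulo the ideal, and the cycles that occur do not meet the stream. The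
  relation \<open>s\<^sub>ie\<^sub>v\<close> with \<open>v \<notin> V[i]\<close> concerns a vertex that the stream does not traverse. In
  \<open>s\<^sub>iuw - u\<sigma>\<^sub>vw\<close> with \<open>uw\<close> on the stream exactly one summand of \<open>u\<sigma>\<^sub>vw\<close> is on the stream, one turn longer
  than \<open>uw\<close>, and the two values cancel.
\<close>

lemma nerve_ideal_stream_weight:
  assumes f: "admissible_stream f" and i: "i \<in> {1..n}" and fi: "\<And>j. tail Q (f j) \<in> V i"
    and g: "g \<in> \<I>"
  shows "lin (stream_weight f r (s i)) g \<in> Idl (s ` ({1..n} - {i}))"
proof -
  let ?J = "Idl (s ` ({1..n} - {i}))"
  let ?\<phi> = "stream_weight f r (s i)"
  have Ji: "ideal ?J R" by (intro R.genideal_ideal s_subset) auto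
  interpret J: ideal ?J R by (rule Ji)
  have sJ: "s j \<in> ?J" if "j \<in> {1..n}" "j \<noteq> i" for j
    using R.genideal_self[OF s_subset, of "{1..n} - {i}"] that by blast
  note si = s_closed[OF i] and per = period_pos[OF f]
  have val: "?\<phi> x \<in> carrier R" for x using si by (simp add: stream_weight_def)
  define on where "on y \<longleftrightarrow> y = window f 0 (path_length y) \<and> path_length y mod period f = r" for y
  have \<phi>: "?\<phi> y = (if on y then s i [^] (path_length y div period f) else \<zero>)" for y
    by (simp add: stream_weight_def on_def)
  have on_vertex: "path_head Q w = tail Q (f (path_length w))"
    if "on (path_comp u w)" "u \<in> paths Q" "w \<in> paths Q" "path_tail u = path_head Q w" for u w
  proof -
    have "w = window f 0 (path_length w)"
      using window_decomp(1)[OF f that(2,3,4)] that(1) unfolding on_def by blast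
    then show ?thesis using head_window[OF f, of 0 "path_length w"] by simp
  qed
  have on_insert: "on (path_comp u (path_comp c w)) \<longleftrightarrow> c = window f (path_length w) (period f) \<and> on (path_comp u w)"
    if "u \<in> paths Q" "w \<in> paths Q" "path_tail u = path_head Q w" "c \<in> cycles_at (path_head Q w)" for u c w
  proof -
    let ?N = "path_length (path_comp u (path_comp c w))"
    have c: "primitive_cycle Q Z c" "path_tail c = path_head Q w" using that(4) by auto
    note ins = insert_primitive_cycle[OF f that(1-3) c]
    show ?thesis
    proof
      assume o: "on (path_comp u (path_comp c w))"
      then have h: "period f \<le> ?N" "c = window f (path_length w) (period f)"
        "path_comp u w = window f 0 (?N - period f)"
        using ins[of ?N] unfolding on_def by blast+
      have len: "path_length (path_comp u w) = ?N - period f" using arg_cong[OF h(3), of path_length] by simp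
      have "?N mod period f = r" using o unfolding on_def by blast
      then have "path_length (path_comp u w) mod period f = r" using len h(1) by (simp add: le_mod_geq)
      then show "c = window f (path_length w) (period f) \<and> on (path_comp u w)"
        using h(2,3) len unfolding on_def by simp
    next
      assume o: "c = window f (path_length w) (period f) \<and> on (path_comp u w)"
      then have len: "?N = path_length (path_comp u w) + period f" by simp
      have "path_comp u (path_comp c w) = window f 0 ?N"
        using ins[of ?N] o len unfolding on_def by simp
      moreover have "?N mod period f = r" using o len unfolding on_def by (metis mod_add_self2)
      ultimately show "on (path_comp u (path_comp c w))" unfolding on_def by blast
    qed
  qed
  show ?thesis
  proof (rule nerve_ideal_functional[OF val Ji _ _ _ g])
    fix u z w assume "z \<in> Z"
    moreover have "sublist (snd z) (snd (path_comp u (path_comp z w)))" by (auto simp: sublist_def)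
    ultimately have "\<not> on (path_comp u (path_comp z w))"
      using stream_window[OF f] unfolding admissible_iff on_def by metis
    then show "?\<phi> (path_comp u (path_comp z w)) \<in> ?J" using J.zero_closed by (simp add: \<phi>)
  next
    fix j u w assume j: "j \<in> {1..n}" "path_tail u \<in> V j" and uw: "u \<in> paths Q" "w \<in> paths Q" "path_tail u = path_head Q w"
    \<comment> \<open>The full turn that starts where \<open>w\<close> ends.\<close>
    let ?c = "window f (path_length w) (period f)"
    let ?S = "\<Oplus> c \<in> cycles_at (path_tail u). ?\<phi> (path_comp u (path_comp c w))"
    show "s j \<otimes> ?\<phi> (path_comp u w) \<ominus> ?S \<in> ?J"
    proof (cases "on (path_comp u w)")
      case False
      then have "?\<phi> (path_comp u (path_comp c w)) = \<zero>" if "c \<in> cycles_at (path_tail u)" for c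
        using on_insert[OF uw] that uw(3) by (simp add: \<phi>)
      then have "?S = \<zero>" by (intro R.add.finprod_one_eqI[simplified]) auto
      then show ?thesis using False s_closed[OF j(1)] J.zero_closed by (simp add: \<phi> a_minus_def)
    next
      case True
      have t: "path_tail u = tail Q (f (path_length w))" using on_vertex[OF True uw] uw(3) by simp
      then have [simp]: "j = i" using part_unique[OF j(1) i j(2)] fi by simp
      have c: "?c \<in> cycles_at (path_tail u)" using window_period_primitive[OF f] t by simp
      let ?k = "path_length (path_comp u w) div period f"
      have "?\<phi> (path_comp u (path_comp c w)) = (if ?c = c then s i [^] Suc ?k else \<zero>)"
        if "c \<in> cycles_at (path_tail u)" for c
      proof -
        have "(path_length (path_comp u w) + period f) div period f = Suc ?k"
          using per by (simp only: div_add_self2 Suc_eq_plus1)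
        moreover have "path_length (path_comp u (path_comp ?c w)) = path_length (path_comp u w) + period f"
          by simp
        ultimately have "path_length (path_comp u (path_comp ?c w)) div period f = Suc ?k"
          by (simp only:)
        then show ?thesis using on_insert[OF uw] that uw(3) True by (auto simp: \<phi>)
      qed
      then have "?S = (\<Oplus> c \<in> cycles_at (path_tail u). if ?c = c then s i [^] Suc ?k else \<zero>)"
        using si by (intro R.finsum_cong') auto
      also have "\<dots> = s i [^] Suc ?k"
        using R.add.finprod_singleton[OF c finite_primitive_cycles, of "\<lambda>_. s i [^] Suc ?k"] si by auto
      also have "\<dots> = s j \<otimes> ?\<phi> (path_comp u w)" using True si by (simp add: \<phi> R.m_comm)
      finally show ?thesis using s_closed[OF i] val J.zero_closed by (simp add: a_minus_def R.r_neg)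
    qed
  next
    fix j u w assume j: "j \<in> {1..n}" "path_tail u \<notin> V j" and uw: "u \<in> paths Q" "w \<in> paths Q" "path_tail u = path_head Q w"
    show "s j \<otimes> ?\<phi> (path_comp u w) \<in> ?J"
    proof (cases "j = i")
      case True
      then have "\<not> on (path_comp u w)" using on_vertex[OF _ uw] uw(3) fi j(2) by auto
      then show ?thesis using s_closed[OF j(1)] J.zero_closed by (simp add: \<phi>)
    qed (use sJ j val J.I_r_closed in blast)
  qed
qed

theorem admissible_path_notin_nerve_ideal:
  assumes p: "admissible_path Q Z p"
  shows "path_elem R p \<notin> \<I>"
proof
  assume I: "path_elem R p \<in> \<I>"
  show False
  proof (cases "\<exists>c. primitive_cycle Q Z c \<and> sublist (snd c) (snd p)")
    case False
    then have "path_elem R p p \<in> \<mm>" using nerve_ideal_coefficient[OF p _ I] by blast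
    then show False using one_not_in_max by (simp add: path_elem_def)
  next
    case True
    then obtain c where c: "primitive_cycle Q Z c" "sublist (snd c) (snd p)" by blast
    obtain f where f: "admissible_stream f" "p = window f 0 (path_length p)"
      using primitive_subpath_stream[OF p c] .
    obtain i where i: "i \<in> {1..n}" "\<And>j. tail Q (f j) \<in> V i" by (rule stream_part[OF f(1)]) blast
    let ?\<phi> = "stream_weight f (path_length p mod period f) (s i)"
    have "?\<phi> x \<in> carrier R" for x using s_closed[OF i(1)] by (simp add: stream_weight_def)
    then have "lin ?\<phi> (path_elem R p) = ?\<phi> p" using nontrivial by (intro lin_path_elem)
    also have "\<dots> = s i [^] (path_length p div period f)" using f(2) by (simp add: stream_weight_def)
    finally show False
      using nerve_ideal_stream_weight[OF f(1) i I] R.regular_sequence_power[OF regular_seq i(1)] by metis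
  qed
qed


section \<open>Spans of paths\<close>

text \<open>
  Spans of paths are not ideals in general, but membership in them and in their sums with ideals can
  still be tested on single terms \<open>f(x)x\<close>. This property is what the test needs.
\<close>

definition sum_closed :: "(('v, 'e) qpath \<Rightarrow> 'r) set \<Rightarrow> bool" where
  "sum_closed M \<longleftrightarrow> \<zero>\<^bsub>RQ\<^esub> \<in> M \<and> (\<forall>f \<in> M. \<forall>g \<in> M. f \<oplus>\<^bsub>RQ\<^esub> g \<in> M)"

lemma sum_closed_induct:
  assumes "sum_closed M" "f \<in> carrier RQ"
    and "\<And>x. x \<in> paths Q \<Longrightarrow> f x \<noteq> \<zero> \<Longrightarrow> f x \<odot>\<^bsub>RQ\<^esub> path_elem R x \<in> M"
  shows "f \<in> M"
  using assms(2)
proof (induction f rule: RQ_induct)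
  case (add x g)
  then show ?case using assms(1,3) unfolding sum_closed_def by blast
qed (use assms(1) in \<open>auto simp: sum_closed_def\<close>)

lemma sum_closed_finsum:
  assumes "sum_closed M" "M \<subseteq> carrier RQ" "finite A" "\<And>i. i \<in> A \<Longrightarrow> F i \<in> M"
  shows "(\<Oplus>\<^bsub>RQ\<^esub> i \<in> A. F i) \<in> M"
  using assms(3,4)
proof (induction A rule: finite_induct)
  case empty
  then show ?case using assms(1) by (simp add: sum_closed_def)
next
  case (insert i A)
  then have "F \<in> A \<rightarrow> carrier RQ" "F i \<in> carrier RQ" using assms(2) by auto
  then have "(\<Oplus>\<^bsub>RQ\<^esub> i \<in> insert i A. F i) = F i \<oplus>\<^bsub>RQ\<^esub> (\<Oplus>\<^bsub>RQ\<^esub> i \<in> A. F i)"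
    using insert.hyps by (simp add: RQ.finsum_insert)
  then show ?case using insert assms(1) unfolding sum_closed_def by simp
qed

lemma sum_closed_ideal: "ideal K RQ \<Longrightarrow> sum_closed K"
  unfolding sum_closed_def
  using additive_subgroup.zero_closed additive_subgroup.a_closed ideal.axioms(1) by metis

lemma sum_closed_set_add:
  assumes "sum_closed M" "sum_closed N" "M \<subseteq> carrier RQ" "N \<subseteq> carrier RQ"
  shows "sum_closed (M <+>\<^bsub>RQ\<^esub> N)" "M \<subseteq> M <+>\<^bsub>RQ\<^esub> N" "N \<subseteq> M <+>\<^bsub>RQ\<^esub> N"
proof -
  have z: "\<zero>\<^bsub>RQ\<^esub> \<in> M" "\<zero>\<^bsub>RQ\<^esub> \<in> N" using assms unfolding sum_closed_def by auto
  show M: "M \<subseteq> M <+>\<^bsub>RQ\<^esub> N" and "N \<subseteq> M <+>\<^bsub>RQ\<^esub> N"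
    by (rule RQ.set_add_superset[OF z assms(3,4)])+
  have "f \<oplus>\<^bsub>RQ\<^esub> g \<in> M <+>\<^bsub>RQ\<^esub> N" if f: "f \<in> M <+>\<^bsub>RQ\<^esub> N" and g: "g \<in> M <+>\<^bsub>RQ\<^esub> N" for f g
  proof -
    obtain a b where ab: "a \<in> M" "b \<in> N" "f = a \<oplus>\<^bsub>RQ\<^esub> b" using f unfolding set_add_def' by blast
    obtain c d where cd: "c \<in> M" "d \<in> N" "g = c \<oplus>\<^bsub>RQ\<^esub> d" using g unfolding set_add_def' by blast
    have "f \<oplus>\<^bsub>RQ\<^esub> g = (a \<oplus>\<^bsub>RQ\<^esub> c) \<oplus>\<^bsub>RQ\<^esub> (b \<oplus>\<^bsub>RQ\<^esub> d)"
      using ab cd assms(3,4) by (simp add: RQ.a_ac subset_iff)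
    moreover have "a \<oplus>\<^bsub>RQ\<^esub> c \<in> M" "b \<oplus>\<^bsub>RQ\<^esub> d \<in> N" using ab cd assms(1,2) unfolding sum_closed_def by auto
    ultimately show ?thesis unfolding set_add_def' by blast
  qed
  then show "sum_closed (M <+>\<^bsub>RQ\<^esub> N)" using M z unfolding sum_closed_def by blast
qed

lemma mem_path_span: "f \<in> path_span R Q P \<longleftrightarrow> f \<in> carrier RQ \<and> (\<forall>x. f x \<noteq> \<zero> \<longrightarrow> x \<in> P)"
  by (simp add: path_span_def)

lemma path_span_subset: "path_span R Q P \<subseteq> carrier RQ"
  by (auto simp: mem_path_span)

lemma sum_closed_path_span: "sum_closed (path_span R Q P)"
proof -
  have supp: "x \<in> P" if "f \<in> path_span R Q P" "g \<in> path_span R Q P" "(f \<oplus>\<^bsub>RQ\<^esub> g) x \<noteq> \<zero>" for f g x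
  proof (rule ccontr)
    assume "x \<notin> P"
    then have "f x = \<zero>" "g x = \<zero>" using that(1,2) unfolding mem_path_span by blast+
    then show False using that(3) by (simp add: RQ_add)
  qed
  show ?thesis unfolding sum_closed_def
  proof (intro conjI ballI)
    show "\<zero>\<^bsub>RQ\<^esub> \<in> path_span R Q P" by (simp add: mem_path_span RQ_zero)
    fix f g assume fg: "f \<in> path_span R Q P" "g \<in> path_span R Q P"
    then have "f \<oplus>\<^bsub>RQ\<^esub> g \<in> carrier RQ" using path_span_subset by blast
    then show "f \<oplus>\<^bsub>RQ\<^esub> g \<in> path_span R Q P" using supp[OF fg] unfolding mem_path_span by blast
  qed
qed

lemma path_span_smult:
  assumes "r \<in> carrier R" "f \<in> path_span R Q P"
  shows "r \<odot>\<^bsub>RQ\<^esub> f \<in> path_span R Q P"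
proof -
  have "x \<in> P" if "r \<otimes> f x \<noteq> \<zero>" for x
  proof (rule ccontr)
    assume "x \<notin> P"
    then have "f x = \<zero>" using assms(2) unfolding mem_path_span by blast
    then show False using that assms(1) by simp
  qed
  then show ?thesis using assms by (simp add: mem_path_span RQ_smult)
qed

lemma path_elem_in_span: "x \<in> paths Q \<Longrightarrow> x \<in> P \<Longrightarrow> path_elem R x \<in> path_span R Q P"
  by (simp add: mem_path_span) (auto simp: path_elem_def)

lemma mult_support:
  assumes "f \<in> carrier RQ" "g \<in> carrier RQ" "(f \<otimes>\<^bsub>RQ\<^esub> g) x \<noteq> \<zero>"
  obtains p q where "x = path_comp p q" "p \<in> paths Q" "q \<in> paths Q" "path_tail p = path_head Q q" "f p \<noteq> \<zero>" "g q \<noteq> \<zero>"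
proof -
  have "\<exists>pq \<in> path_factorizations Q x. f (fst pq) \<otimes> g (snd pq) \<noteq> \<zero>"
  proof (rule ccontr)
    assume "\<not> ?thesis"
    then have "(f \<otimes>\<^bsub>RQ\<^esub> g) x = \<zero>" unfolding RQ_mult by (intro R.add.finprod_one_eqI[simplified]) auto
    then show False using assms(3) by blast
  qed
  then obtain p q where pq: "(p, q) \<in> path_factorizations Q x" "f p \<otimes> g q \<noteq> \<zero>" by force
  have nz: "f p \<noteq> \<zero>" "g q \<noteq> \<zero>"
    using pq(2) assms(1,2) by (metis coeff_closed R.l_null, metis coeff_closed R.r_null)
  have "x = path_comp p q" "p \<in> paths Q" "q \<in> paths Q" "path_tail p = path_head Q q"
    using pq(1) by (auto simp: path_factorizations_def)
  then show ?thesis using that nz by blast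
qed

definition restrict_supp :: "(('v, 'e) qpath \<Rightarrow> bool) \<Rightarrow> (('v, 'e) qpath \<Rightarrow> 'r) \<Rightarrow> ('v, 'e) qpath \<Rightarrow> 'r" where
  "restrict_supp P f = (\<lambda>x. if P x then f x else \<zero>)"

lemma restrict_supp_closed [simp]: "f \<in> carrier RQ \<Longrightarrow> restrict_supp P f \<in> carrier RQ"
  unfolding mem_RQ restrict_supp_def by (auto elim: finite_subset[rotated])

lemma restrict_supp_decomp: "f \<in> carrier RQ \<Longrightarrow> f = restrict_supp P f \<oplus>\<^bsub>RQ\<^esub> restrict_supp (\<lambda>x. \<not> P x) f"
  using coeff_closed by (intro ext) (simp add: RQ_add restrict_supp_def)

lemma restrict_supp_span:
  assumes "f \<in> carrier RQ" "\<And>x. P x \<Longrightarrow> f x \<noteq> \<zero> \<Longrightarrow> x \<in> S"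
  shows "restrict_supp P f \<in> path_span R Q S"
  unfolding mem_path_span
proof (intro conjI allI impI)
  show "restrict_supp P f \<in> carrier RQ" using assms(1) by simp
  fix x assume "restrict_supp P f x \<noteq> \<zero>"
  then show "x \<in> S" using assms(2)[of x] by (auto simp: restrict_supp_def split: if_splits)
qed

abbreviation \<mm>Q :: "(('v, 'e) qpath \<Rightarrow> 'r) set" where
  "\<mm>Q \<equiv> coeff_ideal R \<mm> Q"

lemma mem_coeff_ideal: "f \<in> \<mm>Q \<longleftrightarrow> f \<in> carrier RQ \<and> (\<forall>x. f x \<in> \<mm>)"
  by (simp add: coeff_ideal_def)

lemma sum_closed_coeff_ideal: "sum_closed \<mm>Q"
proof -
  interpret M: ideal \<mm> R by (rule max_ideal)
  show ?thesis unfolding sum_closed_def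
  proof (intro conjI ballI)
    have "\<zero>\<^bsub>RQ\<^esub> x \<in> \<mm>" for x unfolding RQ_zero by (rule M.zero_closed)
    then show "\<zero>\<^bsub>RQ\<^esub> \<in> \<mm>Q" unfolding mem_coeff_ideal using RQ.zero_closed by blast
    fix f g assume "f \<in> \<mm>Q" "g \<in> \<mm>Q"
    then have fg: "f \<in> carrier RQ" "g \<in> carrier RQ" "\<And>x. f x \<in> \<mm>" "\<And>x. g x \<in> \<mm>"
      unfolding mem_coeff_ideal by blast+
    have "(f \<oplus>\<^bsub>RQ\<^esub> g) x \<in> \<mm>" for x unfolding RQ_add by (rule M.a_closed[OF fg(3,4)])
    then show "f \<oplus>\<^bsub>RQ\<^esub> g \<in> \<mm>Q" unfolding mem_coeff_ideal using RQ.a_closed[OF fg(1,2)] by blast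
  qed
qed

lemma max_smult_path:
  assumes "r \<in> \<mm>" "x \<in> paths Q"
  shows "r \<odot>\<^bsub>RQ\<^esub> path_elem R x \<in> \<mm>Q"
proof -
  interpret M: ideal \<mm> R by (rule max_ideal)
  have "r \<in> carrier R" using assms(1) M.Icarr by blast
  then have "r \<odot>\<^bsub>RQ\<^esub> path_elem R x \<in> carrier RQ" using assms(2) by simp
  moreover have "(r \<odot>\<^bsub>RQ\<^esub> path_elem R x) y \<in> \<mm>" for y
    unfolding RQ_smult using M.I_r_closed[OF assms(1)] by (simp add: path_elem_def)
  ultimately show ?thesis unfolding mem_coeff_ideal by blast
qed

section \<open>The nerve ideal is admissible, special and arrow-direct\<close>

text \<open>
  A long admissible path \<open>x\<close> lies on a stream \<open>f\<close> and is longer than its period, so \<open>x = uc\<close> with \<open>c\<close> the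
  first turn and \<open>u\<close> non-trivial. Another primitive cycle \<open>c'\<close> at the same vertex ends with an arrow
  that cannot be followed by the first arrow of \<open>u\<close>, since its only admissible successor is the
  first arrow of \<open>c'\<close>. So \<open>u\<sigma>\<^sub>v\<close> and \<open>x\<close> are congruent modulo \<open>I\<close>, and so are \<open>u\<sigma>\<^sub>v\<close> and \<open>s\<^sub>iu\<close>.
\<close>

lemma long_path_reduction:
  obtains m where "m > 0"
    and "\<And>c. primitive_cycle Q Z c \<Longrightarrow> path_length c \<le> m"
    and "\<And>x. x \<in> paths Q \<Longrightarrow> m \<le> path_length x \<Longrightarrow> path_elem R x \<in> \<I> \<or>
      (\<exists>i \<in> {1..n}. \<exists>u \<in> paths Q. 0 < path_length u \<and> path_length u < path_length x \<and>
        path_elem R x \<ominus>\<^bsub>RQ\<^esub> (s i \<odot>\<^bsub>RQ\<^esub> path_elem R u) \<in> \<I>)"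
proof -
  interpret I: ideal \<I> RQ by (rule nerve_ideal_ideal)
  obtain m where m: "m > 0"
    "\<And>c. primitive_cycle Q Z c \<Longrightarrow> path_length c \<le> m"
    "\<And>x. admissible_path Q Z x \<Longrightarrow> m \<le> path_length x \<Longrightarrow>
      \<exists>f. admissible_stream f \<and> period f < path_length x \<and> x = window f 0 (path_length x)"
    by (rule long_paths) blast
  have inadm: "path_elem R x \<in> \<I>" if x: "x \<in> paths Q" "\<not> admissible_path Q Z x" for x
  proof -
    obtain p z q where pzq: "p \<in> paths Q" "z \<in> Z" "q \<in> paths Q" "path_tail p = path_head Q z"
      "path_tail z = path_head Q q" "x = path_comp p (path_comp z q)"
      using x unfolding admissible_path_def inadmissible_path_def by blast
    have z: "z \<in> paths Q" using pzq(2) Z_paths by blast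
    have "path_elem R x = path_elem R p \<otimes>\<^bsub>RQ\<^esub> path_elem R z \<otimes>\<^bsub>RQ\<^esub> path_elem R q"
      using sandwich_path[OF pzq(1,3) z] pzq(4-6) by simp
    then show ?thesis
      using I.I_l_closed[OF gen_Z[OF pzq(2)]] I.I_r_closed pzq(1,3) by simp
  qed
  have red: "\<exists>i \<in> {1..n}. \<exists>u \<in> paths Q. 0 < path_length u \<and> path_length u < path_length x \<and>
        path_elem R x \<ominus>\<^bsub>RQ\<^esub> (s i \<odot>\<^bsub>RQ\<^esub> path_elem R u) \<in> \<I>"
    if x: "admissible_path Q Z x" "m \<le> path_length x" for x
  proof -
    obtain f where f: "admissible_stream f" "period f < path_length x" "x = window f 0 (path_length x)"
      using m(3)[OF x] by blast
    let ?t = "period f" and ?v = "tail Q (f 0)"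
    let ?c = "window f 0 ?t" and ?l = "path_length x - period f"
    let ?u = "window f ?t ?l"
    note per = period_pos[OF f(1)] period_return[OF f(1)]
    have xc: "x = path_comp ?u ?c" using f(2,3) window_comp[of f 0 ?t ?l] by simp
    have u: "?u \<in> paths Q" "path_tail ?u = ?v" "0 < path_length ?u" "path_length ?u < path_length x"
      using stream_window[OF f(1)] per f(2) unfolding admissible_iff by simp_all
    have c: "?c \<in> cycles_at ?v" using window_period_primitive[OF f(1)] by simp
    obtain i where i: "i \<in> {1..n}" "\<And>j. tail Q (f j) \<in> V i" by (rule stream_part[OF f(1)]) blast
    have v: "?v \<in> verts Q" using part_verts[OF i(1)] i(2) by blast
    let ?rest = "\<Oplus>\<^bsub>RQ\<^esub> c \<in> cycles_at ?v - {?c}. path_elem R (path_comp ?u c)"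
    have uc: "path_comp ?u c \<in> paths Q" if "c \<in> cycles_at ?v" for c
      using that u primitive_cycle_path primitive_cycle_head path_head_comp(2)[of ?u c] by auto
    have kill: "path_elem R (path_comp ?u c) \<in> \<I>" if c': "c \<in> cycles_at ?v - {?c}" for c
    proof (rule inadm)
      show "path_comp ?u c \<in> paths Q" using uc c' by blast
      show "\<not> admissible_path Q Z (path_comp ?u c)"
      proof
        assume adm: "admissible_path Q Z (path_comp ?u c)"
        have prim: "primitive_cycle Q Z c" using c' by blast
        obtain g where g: "admissible_stream g" "c = window g 0 (period g)"
          using primitive_cycle_window[OF prim] .
        have "snd c = butlast (snd c) @ [last (snd c)]" using primitive_cycle_nonempty[OF prim] by simp
        moreover have "snd ?u = f ?t # tl (snd ?u)" using u(3) f(2) by (simp add: window_def upt_conv_Cons)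
        ultimately have "snd (path_comp ?u c) = butlast (snd c) @ last (snd c) # f ?t # tl (snd ?u)"
          by (metis append.assoc append_Cons append_Nil path_comp_simps(2))
        from admissible_follows[OF adm this] have 1: "follows (last (snd c)) (f 0)" using per(2) by simp
        have "last (snd c) = g (period g - 1)"
          using g(2) period_pos[OF g(1)] by (simp add: window_def last_map)
        then have "follows (last (snd c)) (g 0)"
          using stream_follows[OF g(1), of "period g - 1"] period_pos[OF g(1)] period_return[OF g(1)] by simp
        then have "g 0 = f 0" using 1 follows_unique by blast
        then have "hd (snd c) = hd (snd ?c)"
          using g(2) period_pos[OF g(1)] per(1) by (simp add: window_def hd_map)
        then have "c = ?c" using primitive_cycle_unique[OF prim] c by blast
        then show False using c' by blast
      qed
    qed
    have rest: "?rest \<in> \<I>"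
      using kill finite_primitive_cycles I.Icarr
      by (intro sum_closed_finsum sum_closed_ideal nerve_ideal_ideal) auto
    have "path_elem R ?u \<otimes>\<^bsub>RQ\<^esub> \<sigma> ?v = (\<Oplus>\<^bsub>RQ\<^esub> c \<in> cycles_at ?v. path_elem R ?u \<otimes>\<^bsub>RQ\<^esub> path_elem R c)"
      unfolding primitive_cycle_sum_def using u cycle_closed finite_primitive_cycles
      by (intro RQ.finsum_rdistr) auto
    also have "\<dots> = (\<Oplus>\<^bsub>RQ\<^esub> c \<in> cycles_at ?v. path_elem R (path_comp ?u c))"
    proof (rule RQ.finsum_cong'[OF refl])
      fix c assume "c \<in> cycles_at ?v"
      then show "path_elem R ?u \<otimes>\<^bsub>RQ\<^esub> path_elem R c = path_elem R (path_comp ?u c)"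
        using path_elem_mult[OF u(1), of c] u(2) primitive_cycle_path primitive_cycle_head by auto
    qed (use uc in auto)
    also have "cycles_at ?v = insert ?c (cycles_at ?v - {?c})" using c by blast
    also have "(\<Oplus>\<^bsub>RQ\<^esub> c \<in> insert ?c (cycles_at ?v - {?c}). path_elem R (path_comp ?u c)) =
      path_elem R (path_comp ?u ?c) \<oplus>\<^bsub>RQ\<^esub> ?rest"
      using uc c finite_primitive_cycles by (intro RQ.finsum_insert) auto
    finally have us: "path_elem R ?u \<otimes>\<^bsub>RQ\<^esub> \<sigma> ?v = path_elem R x \<oplus>\<^bsub>RQ\<^esub> ?rest" using xc by simp
    have xp: "x \<in> paths Q" using x(1) by (simp add: admissible_iff)
    have restc: "?rest \<in> carrier RQ" using rest I.Icarr by blast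
    have "path_elem R ?u \<otimes>\<^bsub>RQ\<^esub> ((s i \<odot>\<^bsub>RQ\<^esub> vert ?v) \<ominus>\<^bsub>RQ\<^esub> \<sigma> ?v) =
      s i \<odot>\<^bsub>RQ\<^esub> (path_elem R ?u \<otimes>\<^bsub>RQ\<^esub> vert ?v) \<ominus>\<^bsub>RQ\<^esub> (path_elem R ?u \<otimes>\<^bsub>RQ\<^esub> \<sigma> ?v)"
      using u v s_closed[OF i(1)] by (simp add: a_minus_def RQ.r_distr RQ.r_minus smult_mult_right)
    also have "path_elem R ?u \<otimes>\<^bsub>RQ\<^esub> vert ?v = path_elem R ?u"
      using u v trivial_in_paths by (simp add: vertex_elem_def path_elem_mult)
    finally have eq: "path_elem R ?u \<otimes>\<^bsub>RQ\<^esub> ((s i \<odot>\<^bsub>RQ\<^esub> vert ?v) \<ominus>\<^bsub>RQ\<^esub> \<sigma> ?v) =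
      s i \<odot>\<^bsub>RQ\<^esub> path_elem R ?u \<ominus>\<^bsub>RQ\<^esub> (path_elem R x \<oplus>\<^bsub>RQ\<^esub> ?rest)" unfolding us .
    have "path_elem R ?u \<otimes>\<^bsub>RQ\<^esub> ((s i \<odot>\<^bsub>RQ\<^esub> vert ?v) \<ominus>\<^bsub>RQ\<^esub> \<sigma> ?v) \<in> \<I>"
      using I.I_l_closed[OF gen_part[OF i(1) i(2)]] u by simp
    \<comment> \<open>Solve \<open>u(s\<^sub>ie\<^sub>v - \<sigma>\<^sub>v) = s\<^sub>iu - (x + rest)\<close> for \<open>x - s\<^sub>iu\<close>.\<close>
    then have "\<ominus>\<^bsub>RQ\<^esub> (s i \<odot>\<^bsub>RQ\<^esub> path_elem R ?u \<ominus>\<^bsub>RQ\<^esub> (path_elem R x \<oplus>\<^bsub>RQ\<^esub> ?rest)) \<oplus>\<^bsub>RQ\<^esub> \<ominus>\<^bsub>RQ\<^esub> ?rest \<in> \<I>"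
      unfolding eq using rest by (intro I.a_closed I.a_inv_closed)
    also have "\<ominus>\<^bsub>RQ\<^esub> (s i \<odot>\<^bsub>RQ\<^esub> path_elem R ?u \<ominus>\<^bsub>RQ\<^esub> (path_elem R x \<oplus>\<^bsub>RQ\<^esub> ?rest)) \<oplus>\<^bsub>RQ\<^esub> \<ominus>\<^bsub>RQ\<^esub> ?rest =
      path_elem R x \<ominus>\<^bsub>RQ\<^esub> s i \<odot>\<^bsub>RQ\<^esub> path_elem R ?u"
      using restc xp u(1) s_closed[OF i(1)]
      by (simp add: a_minus_def RQ.minus_add RQ.a_ac RQ.r_neg RQ.r_neg1 RQ.r_neg2)
    finally show ?thesis using i(1) u by blast
  qed
  show ?thesis
    using that[OF m(1,2)] red inadm by blast
qed

lemma arrow_ideal_power: "arrow_ideal R Q [^]\<^bsub>ideals_set RQ\<^esub> (k::nat) \<subseteq> path_span R Q {p. k \<le> path_length p}"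
proof (induction k)
  case 0
  show ?case by (auto simp: nat_pow_def ideals_set_def mem_path_span)
next
  case (Suc k)
  let ?P = "arrow_ideal R Q [^]\<^bsub>ideals_set RQ\<^esub> k"
  have eq: "arrow_ideal R Q [^]\<^bsub>ideals_set RQ\<^esub> Suc k = ?P \<cdot>\<^bsub>RQ\<^esub> arrow_ideal R Q"
    by (simp add: nat_pow_def ideals_set_def)
  show ?case
  proof
    fix f assume "f \<in> arrow_ideal R Q [^]\<^bsub>ideals_set RQ\<^esub> Suc k"
    then show "f \<in> path_span R Q {p. Suc k \<le> path_length p}" unfolding eq
    proof (induction f rule: ideal_prod.induct)
      case (prod g h)
      then have g: "g \<in> path_span R Q {p. k \<le> path_length p}" and h: "h \<in> path_span R Q {p. path_length p \<ge> 1}"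
        using Suc.IH unfolding arrow_ideal_def by auto
      then have gh: "g \<in> carrier RQ" "h \<in> carrier RQ" by (auto simp: mem_path_span)
      show ?case unfolding mem_path_span
      proof (intro conjI allI impI)
        fix x assume "(g \<otimes>\<^bsub>RQ\<^esub> h) x \<noteq> \<zero>"
        then obtain p q where pq: "x = path_comp p q" "g p \<noteq> \<zero>" "h q \<noteq> \<zero>"
          using mult_support[OF gh] by metis
        then have "k \<le> path_length p" "1 \<le> path_length q" using g h unfolding mem_path_span by blast+
        then show "x \<in> {p. Suc k \<le> path_length p}" using pq(1) by simp
      qed (use gh in simp)
    next
      case (sum f g)
      then show ?case using sum_closed_path_span unfolding sum_closed_def by blast
    qed
  qed
qed

lemma path_span_subset_arrow_square:
  "path_span R Q {p. 2 \<le> path_length p} \<subseteq> arrow_ideal R Q [^]\<^bsub>ideals_set RQ\<^esub> (2::nat)"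
proof
  let ?A = "arrow_ideal R Q"
  let ?X = "(carrier RQ \<cdot>\<^bsub>RQ\<^esub> ?A) \<cdot>\<^bsub>RQ\<^esub> ?A"
  have eq: "?A [^]\<^bsub>ideals_set RQ\<^esub> (2::nat) = ?X"
    by (simp add: nat_pow_def ideals_set_def numeral_2_eq_2)
  have zA: "\<zero>\<^bsub>RQ\<^esub> \<in> ?A" using sum_closed_path_span unfolding sum_closed_def arrow_ideal_def by blast
  have "\<one>\<^bsub>RQ\<^esub> \<otimes>\<^bsub>RQ\<^esub> \<zero>\<^bsub>RQ\<^esub> \<otimes>\<^bsub>RQ\<^esub> \<zero>\<^bsub>RQ\<^esub> \<in> ?X" using zA by (intro ideal_prod.prod) auto
  then have sc: "sum_closed ?X" unfolding sum_closed_def using ideal_prod.sum by auto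
  fix f assume f: "f \<in> path_span R Q {p. 2 \<le> path_length p}"
  have "f \<in> ?X"
  proof (rule sum_closed_induct[OF sc])
    show fc: "f \<in> carrier RQ" using f by (simp add: mem_path_span)
    fix x assume x: "x \<in> paths Q" "f x \<noteq> \<zero>"
    then have l: "2 \<le> path_length x" using f unfolding mem_path_span by blast
    obtain v a as where xa: "x = (v, a # as)" "as \<noteq> []"
    proof -
      have "length (snd x) \<ge> 2" using l by (simp add: path_length_def)
      then show ?thesis using that[of "fst x" "hd (snd x)" "tl (snd x)"] by (cases x; cases "snd x"; cases "tl (snd x)") auto
    qed
    let ?q = "(v, [a])" and ?p = "(path_head Q (v, [a]), as)"
    have pq: "?q \<in> paths Q" "?p \<in> paths Q"
      using prefix_subpath[of v "[a]" as] x(1) xa by auto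
    have "path_elem R x = path_elem R ?p \<otimes>\<^bsub>RQ\<^esub> path_elem R ?q"
      using path_elem_mult[OF pq(2,1)] xa by (simp add: path_tail_def path_comp_def)
    then have "f x \<odot>\<^bsub>RQ\<^esub> path_elem R x = (\<one>\<^bsub>RQ\<^esub> \<otimes>\<^bsub>RQ\<^esub> (f x \<odot>\<^bsub>RQ\<^esub> path_elem R ?p)) \<otimes>\<^bsub>RQ\<^esub> path_elem R ?q"
      using pq coeff_closed[OF fc, of x] by (simp add: smult_mult_left)
    also have "\<dots> \<in> ?X"
    proof (intro ideal_prod.prod)
      show "f x \<odot>\<^bsub>RQ\<^esub> path_elem R ?p \<in> ?A" "path_elem R ?q \<in> ?A"
        unfolding arrow_ideal_def using pq xa(2) coeff_closed[OF fc, of x]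
        by (auto intro!: path_span_smult path_elem_in_span simp: path_length_def Suc_le_eq)
    qed simp
    finally show "f x \<odot>\<^bsub>RQ\<^esub> path_elem R x \<in> ?X" .
  qed
  then show "f \<in> ?A [^]\<^bsub>ideals_set RQ\<^esub> (2::nat)" unfolding eq .
qed

text \<open>
  The coefficient functional applies unless the arrow \<open>x\<close> is itself a primitive cycle, that is, a loop
  whose powers are all admissible. For such a loop the stream functional maps \<open>g\<close> to
  \<open>g(x)s\<^sub>i + g(x\<^sup>2)s\<^sub>i\<^sup>2 + \<dots>\<close>, since the constant term of \<open>g\<close> vanishes. Cancelling \<open>s\<^sub>i\<close> leaves \<open>g(x)\<close> plus
  an element of \<open>\<mm>\<close>.
\<close>

lemma arrow_coefficient:
  assumes g: "g \<in> \<I>" and gA: "g \<in> arrow_ideal R Q" and x: "x \<in> paths Q" "path_length x = 1"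
  shows "g x \<in> \<mm>"
proof -
  have "\<not> sublist (snd z) (snd x)" if "z \<in> Z" for z
    using Z_length[OF that] x(2) sublist_length_le[of "snd z" "snd x"] by (auto simp: path_length_def)
  then have adm: "admissible_path Q Z x" using x(1) unfolding admissible_iff by blast
  show ?thesis
  proof (cases "\<exists>c. primitive_cycle Q Z c \<and> sublist (snd c) (snd x)")
    case False
    show ?thesis using nerve_ideal_coefficient adm False g by blast
  next
    case True
    then obtain c where c: "primitive_cycle Q Z c" "sublist (snd c) (snd x)" by blast
    obtain f where f: "admissible_stream f" "x = window f 0 1"
      using primitive_subpath_stream[OF adm c] x(2) by metis
    have "snd x = [f 0]" using f(2) by (simp add: window_def)
    then have sc: "snd c = [f 0]" using c(2) primitive_cycle_nonempty[OF c(1)] by (auto simp: sublist_Cons_right prefix_Cons)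
    then have "c = window f 0 1"
      using stream_agree[OF f(1) primitive_cycle_admissible[OF c(1)], of 0] by (simp add: path_length_def)
    then have per: "period f = 1" using primitive_cycle_in_stream[OF f(1) c(1)] by simp
    obtain i where i: "i \<in> {1..n}" "\<And>j. tail Q (f j) \<in> V i" by (rule stream_part[OF f(1)]) blast
    note si = s_closed[OF i(1)]
    have gc: "g \<in> carrier RQ" using gA path_span_subset unfolding arrow_ideal_def by blast
    let ?J = "Idl (s ` ({1..n} - {i}))"
    \<comment> \<open>On non-trivial paths this is the stream functional divided by \<open>s\<^sub>i\<close>.\<close>
    define \<phi> where "\<phi> y = (if y = window f 0 (path_length y) then s i [^] (path_length y - 1) else \<zero>)" for y
    have val: "\<phi> y \<in> carrier R" for y using si by (simp add: \<phi>_def)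
    have val': "stream_weight f 0 (s i) y \<in> carrier R" for y using si by (simp add: stream_weight_def)
    let ?S = "{y. g y \<noteq> \<zero>}"
    have fin: "finite ?S" using supp_finite[OF gc] .
    have "s i \<otimes> lin \<phi> g = (\<Oplus> y \<in> ?S. s i \<otimes> (g y \<otimes> \<phi> y))"
      unfolding lin_def using fin si val coeff_closed[OF gc] by (intro R.finsum_rdistr) auto
    also have "\<dots> = lin (stream_weight f 0 (s i)) g"
      unfolding lin_def
    proof (rule R.finsum_cong'[OF refl])
      fix y assume y: "y \<in> ?S"
      then have "path_length y \<ge> 1" using gA unfolding arrow_ideal_def mem_path_span by blast
      then obtain k where k: "path_length y = Suc k" by (cases "path_length y") auto
      show "s i \<otimes> (g y \<otimes> \<phi> y) = g y \<otimes> stream_weight f 0 (s i) y"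
        using k si coeff_closed[OF gc] by (simp add: \<phi>_def stream_weight_def per R.m_ac)
    qed (use val' coeff_closed[OF gc] in auto)
    also have "\<dots> \<in> ?J" using nerve_ideal_stream_weight[OF f(1) i g] .
    finally have "lin \<phi> g \<in> ?J"
      using R.regular_sequence_move_last[OF regular_seq i(1)] lin_closed[of \<phi> g] val gc
      unfolding R.regular_mod_def by blast
    moreover have "?J \<subseteq> \<mm>"
      using R.genideal_self[OF s_subset[OF order_refl]] by (intro R.genideal_minimal max_ideal) auto
    ultimately have lm: "lin \<phi> g \<in> \<mm>" by blast
    interpret M: ideal \<mm> R by (rule max_ideal)
    let ?B = "insert x (?S - {x})"
    have "lin \<phi> g = (\<Oplus> y \<in> ?B. g y \<otimes> \<phi> y)" using fin by (intro lin_superset val gc) auto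
    also have "\<dots> = g x \<otimes> \<phi> x \<oplus> (\<Oplus> y \<in> ?S - {x}. g y \<otimes> \<phi> y)"
      using fin val coeff_closed[OF gc] by (intro R.finsum_insert) auto
    also have "g x \<otimes> \<phi> x = g x" using f(2) coeff_closed[OF gc] by (simp add: \<phi>_def)
    finally have eq: "lin \<phi> g = g x \<oplus> (\<Oplus> y \<in> ?S - {x}. g y \<otimes> \<phi> y)" .
    have rest: "(\<Oplus> y \<in> ?S - {x}. g y \<otimes> \<phi> y) \<in> \<mm>"
    proof -
      have "g y \<otimes> \<phi> y \<in> \<mm>" if y: "y \<in> ?S - {x}" for y
      proof (cases "y = window f 0 (path_length y)")
        case True
        then have "path_length y \<noteq> 1" using y f(2) by auto
        moreover have "path_length y \<ge> 1" using y gA unfolding arrow_ideal_def mem_path_span by blast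
        ultimately obtain k where "path_length y = Suc (Suc k)" by (cases "path_length y"; cases "path_length y - 1") auto
        then have "\<phi> y = s i [^] k \<otimes> s i" using True by (simp add: \<phi>_def)
        then have "\<phi> y \<in> \<mm>" using M.I_l_closed[OF s_in_max[OF i(1)]] si by simp
        then show ?thesis using M.I_l_closed coeff_closed[OF gc] by blast
      next
        case False
        then have "g y \<otimes> \<phi> y = \<zero>" using coeff_closed[OF gc] by (simp add: \<phi>_def)
        then show ?thesis using M.zero_closed by simp
      qed
      moreover have "finite A \<Longrightarrow> (\<And>y. y \<in> A \<Longrightarrow> g y \<otimes> \<phi> y \<in> \<mm>) \<Longrightarrow> (\<Oplus> y \<in> A. g y \<otimes> \<phi> y) \<in> \<mm>" for A
      proof (induction A rule: finite_induct)
        case empty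
        then show ?case using M.zero_closed by simp
      next
        case (insert y A)
        then have "(\<Oplus> y \<in> insert y A. g y \<otimes> \<phi> y) = g y \<otimes> \<phi> y \<oplus> (\<Oplus> y \<in> A. g y \<otimes> \<phi> y)"
          using val coeff_closed[OF gc] by (intro R.finsum_insert) auto
        then show ?case using insert M.a_closed by simp
      qed
      ultimately show ?thesis using fin by blast
    qed
    have "(a \<oplus> b) \<oplus> \<ominus> b = a" if "a \<in> carrier R" "b \<in> carrier R" for a b
      using that by (simp add: R.a_assoc R.r_neg)
    from this[OF coeff_closed[OF gc] M.Icarr[OF rest], of x] show ?thesis
      using M.a_closed[OF lm M.a_inv_closed[OF rest]] unfolding eq by argo
  qed
qed

text \<open>
  The first two inclusions split \<open>f\<close> according to the lengths of paths and use that the coefficients at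
  trivial paths, respectively arrows, lie in \<open>\<mm>\<close>. The other two replace long paths by multiples
  of shorter ones. In the last one the terms \<open>re\<^sub>v\<close> remain; the \<open>r\<close> for which \<open>re\<^sub>v\<close> belongs to the
  right-hand side form an ideal of \<open>R\<close>, and it contains all \<open>s\<^sub>i\<close> by the relations for \<open>s\<^sub>ie\<^sub>v\<close>.
\<close>

theorem nerve_ideal_admissible: "admissible_ideal R \<mm> Q \<I>"
proof -
  interpret I: ideal \<I> RQ by (rule nerve_ideal_ideal)
  interpret M: ideal \<mm> R by (rule max_ideal)
  let ?A = "arrow_ideal R Q"
  obtain m where m: "m > 0"
    "\<And>c. primitive_cycle Q Z c \<Longrightarrow> path_length c \<le> m"
    "\<And>x. x \<in> paths Q \<Longrightarrow> m \<le> path_length x \<Longrightarrow> path_elem R x \<in> \<I> \<or>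
      (\<exists>i \<in> {1..n}. \<exists>u \<in> paths Q. 0 < path_length u \<and> path_length u < path_length x \<and>
        path_elem R x \<ominus>\<^bsub>RQ\<^esub> (s i \<odot>\<^bsub>RQ\<^esub> path_elem R u) \<in> \<I>)"
    by (rule long_path_reduction) blast
  let ?S = "path_span R Q {p. 1 \<le> path_length p \<and> path_length p \<le> m}"
  have Ic: "\<I> \<subseteq> carrier RQ" using I.Icarr by blast
  have mc: "\<mm>Q \<subseteq> carrier RQ" unfolding coeff_ideal_def by blast
  have add_back: "path_elem R x = (path_elem R x \<ominus>\<^bsub>RQ\<^esub> g) \<oplus>\<^bsub>RQ\<^esub> g" if "x \<in> paths Q" "g \<in> carrier RQ" for x g
    using that by (simp add: a_minus_def RQ.a_assoc RQ.l_neg)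
  have "\<I> \<subseteq> ?A <+>\<^bsub>RQ\<^esub> \<mm>Q"
  proof
    fix f assume f: "f \<in> \<I>"
    then have fc: "f \<in> carrier RQ" using Ic by blast
    let ?g = "restrict_supp (\<lambda>x. 1 \<le> path_length x) f" and ?h = "restrict_supp (\<lambda>x. \<not> 1 \<le> path_length x) f"
    have "?g \<in> ?A" unfolding arrow_ideal_def by (rule restrict_supp_span[OF fc]) simp
    moreover have "?h x \<in> \<mm>" for x
    proof (cases "\<not> 1 \<le> path_length x \<and> x \<in> paths Q")
      case True
      then have "path_length x = 0" by linarith
      then have sx: "snd x = []" by (simp add: path_length_def)
      have "fst x \<in> verts Q" using True mem_paths_iff[of "fst x" "snd x"] by simp
      then have "admissible_path Q Z x" using trivial_admissible[of "fst x"] sx by (cases x) simp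
      moreover have "\<not> sublist (snd c) (snd x)" if "primitive_cycle Q Z c" for c
        using primitive_cycle_nonempty[OF that] sx by simp
      ultimately show ?thesis
        using True nerve_ideal_coefficient[of x, OF _ _ f] by (auto simp: restrict_supp_def)
    next
      case False
      then have "?h x = \<zero>" using supp_paths[OF fc, of x] by (auto simp: restrict_supp_def)
      then show ?thesis using M.zero_closed by simp
    qed
    then have "?h \<in> \<mm>Q" unfolding mem_coeff_ideal using restrict_supp_closed[OF fc] by blast
    ultimately show "f \<in> ?A <+>\<^bsub>RQ\<^esub> \<mm>Q"
      using restrict_supp_decomp[OF fc] unfolding set_add_def' by blast
  qed
  moreover have "\<I> \<inter> ?A \<subseteq> (?A [^]\<^bsub>ideals_set RQ\<^esub> (2::nat)) <+>\<^bsub>RQ\<^esub> (\<mm>Q \<inter> ?A)"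
  proof
    fix f assume "f \<in> \<I> \<inter> ?A"
    then have f: "f \<in> \<I>" "f \<in> ?A" by auto
    then have fc: "f \<in> carrier RQ" using Ic by blast
    let ?g = "restrict_supp (\<lambda>x. 2 \<le> path_length x) f" and ?h = "restrict_supp (\<lambda>x. \<not> 2 \<le> path_length x) f"
    have "?g \<in> path_span R Q {p. 2 \<le> path_length p}"
      by (rule restrict_supp_span[OF fc]) simp
    then have g: "?g \<in> ?A [^]\<^bsub>ideals_set RQ\<^esub> (2::nat)" using path_span_subset_arrow_square by blast
    have "?h x \<in> \<mm>" for x
    proof (cases "?h x = \<zero>")
      case False
      then have x: "f x \<noteq> \<zero>" "\<not> 2 \<le> path_length x" "?h x = f x" by (auto simp: restrict_supp_def split: if_splits)
      moreover have "1 \<le> path_length x" using x(1) f(2) unfolding arrow_ideal_def mem_path_span by blast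
      ultimately have "path_length x = 1" by linarith
      then show ?thesis using arrow_coefficient[OF f supp_paths[OF fc x(1)]] x(3) by simp
    qed (use M.zero_closed in simp)
    then have "?h \<in> \<mm>Q" unfolding mem_coeff_ideal using restrict_supp_closed[OF fc] by blast
    moreover have "?h \<in> ?A"
      unfolding arrow_ideal_def
    proof (rule restrict_supp_span[OF fc])
      fix x assume "f x \<noteq> \<zero>"
      then show "x \<in> {p. 1 \<le> path_length p}" using f(2) unfolding arrow_ideal_def mem_path_span by blast
    qed
    ultimately show "f \<in> (?A [^]\<^bsub>ideals_set RQ\<^esub> (2::nat)) <+>\<^bsub>RQ\<^esub> (\<mm>Q \<inter> ?A)"
      using g restrict_supp_decomp[OF fc] unfolding set_add_def' by blast
  qed
  moreover have "?A [^]\<^bsub>ideals_set RQ\<^esub> m \<subseteq> \<I> <+>\<^bsub>RQ\<^esub> \<mm>Q"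
  proof
    note sum = sum_closed_set_add[OF sum_closed_ideal[OF nerve_ideal_ideal] sum_closed_coeff_ideal Ic mc]
    fix f assume "f \<in> ?A [^]\<^bsub>ideals_set RQ\<^esub> m"
    then have f: "f \<in> path_span R Q {p. m \<le> path_length p}" using arrow_ideal_power by blast
    then have fc: "f \<in> carrier RQ" by (simp add: mem_path_span)
    show "f \<in> \<I> <+>\<^bsub>RQ\<^esub> \<mm>Q"
    proof (rule sum_closed_induct[OF sum(1) fc])
      fix x assume x: "x \<in> paths Q" "f x \<noteq> \<zero>"
      note r = coeff_closed[OF fc, of x]
      have "m \<le> path_length x" using f x(2) unfolding mem_path_span by blast
      then consider "path_elem R x \<in> \<I>" | i u where "i \<in> {1..n}" "u \<in> paths Q"
        "path_elem R x \<ominus>\<^bsub>RQ\<^esub> (s i \<odot>\<^bsub>RQ\<^esub> path_elem R u) \<in> \<I>"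
        using m(3)[OF x(1)] by blast
      then show "f x \<odot>\<^bsub>RQ\<^esub> path_elem R x \<in> \<I> <+>\<^bsub>RQ\<^esub> \<mm>Q"
      proof cases
        case 1
        then show ?thesis using ideal_smult_closed[OF nerve_ideal_ideal r] sum(2) by blast
      next
        case (2 i u)
        let ?g = "s i \<odot>\<^bsub>RQ\<^esub> path_elem R u"
        have gc: "?g \<in> carrier RQ" using 2 s_closed by simp
        have "f x \<odot>\<^bsub>RQ\<^esub> path_elem R x = f x \<odot>\<^bsub>RQ\<^esub> ((path_elem R x \<ominus>\<^bsub>RQ\<^esub> ?g) \<oplus>\<^bsub>RQ\<^esub> ?g)"
          by (rule arg_cong[OF add_back[OF x(1) gc]])
        also have "\<dots> = f x \<odot>\<^bsub>RQ\<^esub> (path_elem R x \<ominus>\<^bsub>RQ\<^esub> ?g) \<oplus>\<^bsub>RQ\<^esub> f x \<odot>\<^bsub>RQ\<^esub> ?g"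
          using x(1) gc by (intro smult_add r) auto
        also have "f x \<odot>\<^bsub>RQ\<^esub> ?g = (f x \<otimes> s i) \<odot>\<^bsub>RQ\<^esub> path_elem R u"
          using r 2 s_closed by (simp add: smult_assoc)
        finally have eq: "f x \<odot>\<^bsub>RQ\<^esub> path_elem R x =
          f x \<odot>\<^bsub>RQ\<^esub> (path_elem R x \<ominus>\<^bsub>RQ\<^esub> ?g) \<oplus>\<^bsub>RQ\<^esub> (f x \<otimes> s i) \<odot>\<^bsub>RQ\<^esub> path_elem R u" .
        have "(f x \<otimes> s i) \<odot>\<^bsub>RQ\<^esub> path_elem R u \<in> \<mm>Q"
          using max_smult_path M.I_l_closed[OF s_in_max[OF 2(1)] r] 2(2) by blast
        then show ?thesis
          using ideal_smult_closed[OF nerve_ideal_ideal r 2(3)] eq unfolding set_add_def' by blast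
      qed
    qed
  qed
  moreover have "\<mm>Q \<subseteq> \<I> <+>\<^bsub>RQ\<^esub> ?S"
  proof
    note sum = sum_closed_set_add[OF sum_closed_ideal[OF nerve_ideal_ideal] sum_closed_path_span Ic
      path_span_subset[of "{p. 1 \<le> path_length p \<and> path_length p \<le> m}"]]
    let ?T = "\<I> <+>\<^bsub>RQ\<^esub> ?S"
    have add: "f \<oplus>\<^bsub>RQ\<^esub> g \<in> ?T" if "f \<in> ?T" "g \<in> ?T" for f g
      using that sum(1) unfolding sum_closed_def by blast
    have smult: "r \<odot>\<^bsub>RQ\<^esub> f \<in> ?T" if r: "r \<in> carrier R" and fT: "f \<in> ?T" for r f
    proof -
      obtain a b where ab: "a \<in> \<I>" "b \<in> ?S" "f = a \<oplus>\<^bsub>RQ\<^esub> b" using fT unfolding set_add_def' by blast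
      have "r \<odot>\<^bsub>RQ\<^esub> f = r \<odot>\<^bsub>RQ\<^esub> a \<oplus>\<^bsub>RQ\<^esub> r \<odot>\<^bsub>RQ\<^esub> b"
        using ab r Ic path_span_subset by (auto intro!: smult_add)
      then show ?thesis
        using ideal_smult_closed[OF nerve_ideal_ideal r ab(1)] path_span_smult[OF r ab(2)]
        unfolding set_add_def' by blast
    qed
    have nontriv: "x \<in> paths Q \<Longrightarrow> 1 \<le> path_length x \<Longrightarrow> path_elem R x \<in> ?T" for x
    proof (induction x rule: measure_induct_rule[where f = path_length])
      case (less x)
      show ?case
      proof (cases "path_length x \<le> m")
        case True
        then have "path_elem R x \<in> ?S" using less.prems by (intro path_elem_in_span) auto
        then show ?thesis using sum(3) by blast
      next
        case False
        then consider "path_elem R x \<in> \<I>" | i u where "i \<in> {1..n}" "u \<in> paths Q" "0 < path_length u"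
          "path_length u < path_length x" "path_elem R x \<ominus>\<^bsub>RQ\<^esub> (s i \<odot>\<^bsub>RQ\<^esub> path_elem R u) \<in> \<I>"
          using m(3)[OF less.prems(1)] by fastforce
        then show ?thesis
        proof cases
          case 1
          then show ?thesis using sum(2) by blast
        next
          case (2 i u)
          have "path_elem R u \<in> ?T" using less.IH[OF 2(4,2)] 2(3) by simp
          then have "s i \<odot>\<^bsub>RQ\<^esub> path_elem R u \<in> ?T" using smult s_closed[OF 2(1)] by blast
          moreover have "path_elem R x \<ominus>\<^bsub>RQ\<^esub> (s i \<odot>\<^bsub>RQ\<^esub> path_elem R u) \<in> ?T" using 2(5) sum(2) by blast
          ultimately have "(path_elem R x \<ominus>\<^bsub>RQ\<^esub> (s i \<odot>\<^bsub>RQ\<^esub> path_elem R u)) \<oplus>\<^bsub>RQ\<^esub> s i \<odot>\<^bsub>RQ\<^esub> path_elem R u \<in> ?T"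
            using add by blast
          then show ?thesis
            using add_back[OF less.prems(1) smult_closed[OF s_closed[OF 2(1)] path_elem_closed[OF 2(2)]]]
            by argo
        qed
      qed
    qed
    have triv: "r \<odot>\<^bsub>RQ\<^esub> vert v \<in> ?T" if v: "v \<in> verts Q" and "r \<in> \<mm>" for v r
    proof -
      let ?K = "{r \<in> carrier R. r \<odot>\<^bsub>RQ\<^esub> vert v \<in> ?T}"
      have gens: "s i \<odot>\<^bsub>RQ\<^esub> vert v \<in> ?T" if i: "i \<in> {1..n}" for i
      proof (cases "v \<in> V i")
        case True
        have "\<sigma> v \<in> ?S"
          unfolding primitive_cycle_sum_def
        proof (rule sum_closed_finsum[OF sum_closed_path_span path_span_subset finite_primitive_cycles])
          fix c assume c: "c \<in> cycles_at v"
          then have "1 \<le> path_length c" using primitive_cycle_nonempty[of c] by (simp add: path_length_def Suc_le_eq)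
          then show "path_elem R c \<in> ?S" using c m(2) primitive_cycle_path by (intro path_elem_in_span) auto
        qed
        moreover have "s i \<odot>\<^bsub>RQ\<^esub> vert v = ((s i \<odot>\<^bsub>RQ\<^esub> vert v) \<ominus>\<^bsub>RQ\<^esub> \<sigma> v) \<oplus>\<^bsub>RQ\<^esub> \<sigma> v"
          using v s_closed[OF i] by (simp add: a_minus_def RQ.a_assoc RQ.l_neg)
        ultimately show ?thesis using gen_part[OF i True] unfolding set_add_def' by blast
      next
        case False
        then show ?thesis using gen_off_part[OF i, of v] v sum(2) by blast
      qed
      have z: "\<zero>\<^bsub>RQ\<^esub> \<in> ?T"
        using sum(1) unfolding sum_closed_def by blast
      have mulK: "r \<otimes> a \<in> ?K" if "r \<in> carrier R" "a \<in> ?K" for r a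
        using that smult[OF that(1), of "a \<odot>\<^bsub>RQ\<^esub> vert v"] v by (simp add: smult_assoc)
      have "ideal ?K R"
      proof (rule idealI)
        show "ring R" by (rule R.ring_axioms)
        show "subgroup ?K (add_monoid R)"
        proof (rule R.add.subgroupI)
          show "?K \<noteq> {}" using z v zero_smult[of "vert v"] by auto
          show "\<ominus> a \<in> ?K" if "a \<in> ?K" for a
            using mulK[of "\<ominus> \<one>" a] that by (auto simp: R.l_minus)
          show "a \<oplus> b \<in> ?K" if "a \<in> ?K" "b \<in> ?K" for a b
            using that add v by (auto simp: add_smult)
        qed auto
        show "r \<otimes> a \<in> ?K" "a \<otimes> r \<in> ?K" if "a \<in> ?K" "r \<in> carrier R" for a r
          using mulK[OF that(2,1)] that by (auto simp: R.m_comm)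
      qed
      moreover have "s ` {1..n} \<subseteq> ?K" using gens s_closed by blast
      ultimately have "\<mm> \<subseteq> ?K" by (rule R.genideal_minimal)
      then show ?thesis using that(2) by blast
    qed
    fix f assume f: "f \<in> \<mm>Q"
    show "f \<in> ?T"
    proof (rule sum_closed_induct[OF sum(1)])
      show fc: "f \<in> carrier RQ" using f unfolding mem_coeff_ideal by blast
      fix x assume x: "x \<in> paths Q" "f x \<noteq> \<zero>"
      show "f x \<odot>\<^bsub>RQ\<^esub> path_elem R x \<in> ?T"
      proof (cases "1 \<le> path_length x")
        case True
        then show ?thesis using smult nontriv x(1) coeff_closed[OF fc] by blast
      next
        case False
        then have "path_length x = 0" by linarith
        then have "x = trivial_path (fst x)" by (cases x) (simp add: trivial_path_def path_length_def)
        moreover have "fst x \<in> verts Q" using x(1) mem_paths_iff[of "fst x" "snd x"] by simp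
        moreover have "f x \<in> \<mm>" using f unfolding mem_coeff_ideal by blast
        ultimately show ?thesis using triv[of "fst x" "f x"] by (simp add: vertex_elem_def)
      qed
    qed
  qed
  ultimately show ?thesis unfolding admissible_ideal_def Let_def by (intro exI[of _ m] conjI m(1))
qed

lemma arrow_path_in_paths: "a \<in> arcs Q \<Longrightarrow> arrow_path Q a \<in> paths Q"
  by (simp add: arrow_path_def mem_paths_iff)

lemma head_arrow_path: "path_head Q (arrow_path Q a) = head Q a"
  and tail_arrow_path: "path_tail (arrow_path Q a) = tail Q a"
  by (simp_all add: arrow_path_def path_head_eq path_tail_def)

theorem nerve_ideal_special: "special_ideal R Q \<I>"
proof -
  have Z: "path_comp (arrow_path Q a) (arrow_path Q b) \<notin> Z"
    if "a \<in> arcs Q" "b \<in> arcs Q" "tail Q a = head Q b" "arrow_elem R Q a \<otimes>\<^bsub>RQ\<^esub> arrow_elem R Q b \<notin> \<I>" for a b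
    using that gen_Z[of "path_comp (arrow_path Q a) (arrow_path Q b)"] arrow_path_in_paths path_elem_mult[of "arrow_path Q a" "arrow_path Q b"]
    by (auto simp: arrow_elem_def head_arrow_path tail_arrow_path)
  show ?thesis unfolding special_ideal_def
  proof (intro ballI conjI)
    fix b assume b: "b \<in> arcs Q"
    have U: "\<exists>\<^sub>\<le>\<^sub>1 a. a \<in> arcs Q \<and> tail Q a = head Q b \<and> path_comp (arrow_path Q a) (arrow_path Q b) \<notin> Z"
      "\<exists>\<^sub>\<le>\<^sub>1 c. c \<in> arcs Q \<and> head Q c = tail Q b \<and> path_comp (arrow_path Q b) (arrow_path Q c) \<notin> Z"
      using special b unfolding special_pair_def by meson+
    show "\<exists>\<^sub>\<le>\<^sub>1 a. a \<in> arcs Q \<and> tail Q a = head Q b \<and> arrow_elem R Q a \<otimes>\<^bsub>RQ\<^esub> arrow_elem R Q b \<notin> \<I>"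
      by (rule Uniq_I, rule Uniq_D[OF U(1)]) (use Z b in auto)
    show "\<exists>\<^sub>\<le>\<^sub>1 c. c \<in> arcs Q \<and> head Q c = tail Q b \<and> arrow_elem R Q b \<otimes>\<^bsub>RQ\<^esub> arrow_elem R Q c \<notin> \<I>"
      by (rule Uniq_I, rule Uniq_D[OF U(2)]) (use Z b in auto)
  qed
qed

text \<open>
  The paths in \<open>RQa\<close> start with \<open>a\<close> and those in \<open>\<Sum>\<^sub>x RQx\<close> start with other arrows, so the two left
  ideals meet in \<open>0\<close>. The right ideals are told apart by the last arrow.
\<close>

theorem nerve_ideal_arrow_direct: "arrow_direct_ideal R Q \<I>"
proof -
  let ?L = "\<lambda>X. path_span R Q {p. snd p \<noteq> [] \<and> hd (snd p) \<in> X}"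
  let ?R = "\<lambda>X. path_span R Q {p. snd p \<noteq> [] \<and> last (snd p) \<in> X}"
  have left: "left_ideal_gen RQ (arrow_elem R Q ` X) \<subseteq> ?L X" if X: "X \<subseteq> arcs Q" for X
  proof
    fix f assume "f \<in> left_ideal_gen RQ (arrow_elem R Q ` X)"
    then obtain h where h: "f = (\<Oplus>\<^bsub>RQ\<^esub> x \<in> arrow_elem R Q ` X. h x \<otimes>\<^bsub>RQ\<^esub> x)"
      "\<forall>x \<in> arrow_elem R Q ` X. h x \<in> carrier RQ"
      unfolding left_ideal_gen_def mem_Collect_eq by (elim exE conjE) (rule that; assumption)
    show "f \<in> ?L X" unfolding h(1)
    proof (rule sum_closed_finsum[OF sum_closed_path_span path_span_subset])
      show "finite (arrow_elem R Q ` X)" using finite_subset[OF X finite_arcs] by simp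
      fix y assume y: "y \<in> arrow_elem R Q ` X"
      then obtain a where a: "a \<in> X" "y = path_elem R (arrow_path Q a)" by (auto simp: arrow_elem_def)
      have yc: "y \<in> carrier RQ" using a X arrow_path_in_paths by auto
      have hy: "h y \<in> carrier RQ" using h(2) y by blast
      show "h y \<otimes>\<^bsub>RQ\<^esub> y \<in> ?L X" unfolding mem_path_span
      proof (intro conjI allI impI)
        fix x assume "(h y \<otimes>\<^bsub>RQ\<^esub> y) x \<noteq> \<zero>"
        then obtain p q where pq: "x = path_comp p q" "y q \<noteq> \<zero>" using mult_support[OF hy yc] by metis
        then have "q = arrow_path Q a" using a(2) by (auto simp: path_elem_def split: if_splits)
        then show "x \<in> {p. snd p \<noteq> [] \<and> hd (snd p) \<in> X}" using pq(1) a(1) by (simp add: arrow_path_def)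
      qed (use hy yc in simp)
    qed
  qed
  have right: "right_ideal_gen RQ (arrow_elem R Q ` X) \<subseteq> ?R X" if X: "X \<subseteq> arcs Q" for X
  proof
    fix f assume "f \<in> right_ideal_gen RQ (arrow_elem R Q ` X)"
    then obtain h where h: "f = (\<Oplus>\<^bsub>RQ\<^esub> x \<in> arrow_elem R Q ` X. x \<otimes>\<^bsub>RQ\<^esub> h x)"
      "\<forall>x \<in> arrow_elem R Q ` X. h x \<in> carrier RQ"
      unfolding right_ideal_gen_def mem_Collect_eq by (elim exE conjE) (rule that; assumption)
    show "f \<in> ?R X" unfolding h(1)
    proof (rule sum_closed_finsum[OF sum_closed_path_span path_span_subset])
      show "finite (arrow_elem R Q ` X)" using finite_subset[OF X finite_arcs] by simp
      fix y assume y: "y \<in> arrow_elem R Q ` X"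
      then obtain a where a: "a \<in> X" "y = path_elem R (arrow_path Q a)" by (auto simp: arrow_elem_def)
      have yc: "y \<in> carrier RQ" using a X arrow_path_in_paths by auto
      have hy: "h y \<in> carrier RQ" using h(2) y by blast
      show "y \<otimes>\<^bsub>RQ\<^esub> h y \<in> ?R X" unfolding mem_path_span
      proof (intro conjI allI impI)
        fix x assume "(y \<otimes>\<^bsub>RQ\<^esub> h y) x \<noteq> \<zero>"
        then obtain p q where pq: "x = path_comp p q" "y p \<noteq> \<zero>" using mult_support[OF yc hy] by metis
        then have "p = arrow_path Q a" using a(2) by (auto simp: path_elem_def split: if_splits)
        then show "x \<in> {p. snd p \<noteq> [] \<and> last (snd p) \<in> X}" using pq(1) a(1) by (simp add: arrow_path_def)
      qed (use hy yc in simp)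
    qed
  qed
  have zero: "\<zero>\<^bsub>RQ\<^esub> \<in> \<I>" using sum_closed_ideal[OF nerve_ideal_ideal] unfolding sum_closed_def by blast
  have disj: "f \<in> \<I>" if "f \<in> path_span R Q P" "f \<in> path_span R Q P'" "P \<inter> P' = {}" for f P P'
  proof -
    have "f x = \<zero>" for x
    proof (rule ccontr)
      assume "f x \<noteq> \<zero>"
      then have "x \<in> P \<inter> P'" using that(1,2) unfolding mem_path_span by blast
      then show False using that(3) by blast
    qed
    then have "f = \<zero>\<^bsub>RQ\<^esub>" by (intro ext) (simp add: RQ_zero)
    then show ?thesis using zero by simp
  qed
  show ?thesis unfolding arrow_direct_ideal_def
  proof (intro ballI conjI subsetI)
    fix a f assume a: "a \<in> arcs Q"
    let ?X = "{x \<in> arcs Q. x \<noteq> a \<and> tail Q x = tail Q a}"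
    assume f: "f \<in> left_ideal_gen RQ {arrow_elem R Q a} \<inter> left_ideal_gen RQ (arrow_elem R Q ` ?X)"
    have "f \<in> ?L {a}" "f \<in> ?L ?X" using f left[of "{a}"] left[of ?X] a by auto
    then show "f \<in> \<I>" by (rule disj) auto
  next
    fix a f assume a: "a \<in> arcs Q"
    let ?X = "{y \<in> arcs Q. y \<noteq> a \<and> head Q y = head Q a}"
    assume f: "f \<in> right_ideal_gen RQ {arrow_elem R Q a} \<inter> right_ideal_gen RQ (arrow_elem R Q ` ?X)"
    have "f \<in> ?R {a}" "f \<in> ?R ?X" using f right[of "{a}"] right[of ?X] a by auto
    then show "f \<in> \<I>" by (rule disj) auto
  qed
qed

end

theorem theorem1p2:
  fixes Q :: "('v, 'e) pre_digraph"
    and Z :: "('v, 'e) qpath set"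
    and R :: "('r, 'm) ring_scheme"
    and \<mm> :: "'r set"
    and n :: nat
    and V :: "nat \<Rightarrow> 'v set"
    and s :: "nat \<Rightarrow> 'r"
    and I :: "(('v, 'e) qpath \<Rightarrow> 'r) set"
  assumes "fin_digraph Q"
    and "Z \<subseteq> paths Q" and "\<And>z. z \<in> Z \<Longrightarrow> path_length z \<ge> 2"
    and "special_pair Q Z"
    and "bij_betw V {1..n} (primitive_nerve_partition Q Z)"
    and "regular_local_ring \<mm> R" and "krull_dim R = enat n"
    and "regular_sequence R n s" and "\<mm> = genideal R (s ` {1..n})"
    and "I = nerve_ideal R Q Z n V s"
  shows "(\<forall>p. admissible_path Q Z p \<longrightarrow> path_elem R p \<notin> I) \<and>
    (biserial Q \<longrightarrow> string_algebra R \<mm> (quotient_algebra (path_algebra R Q) I))"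
proof -
  have local: "local_ring \<mm> R" using assms(6) by (rule regular_local_ring.axioms(1))
  interpret N: nerve_algebra R Q Z n V s
    by (intro nerve_algebra.intro path_alg.intro special_quiver.intro special_quiver_axioms.intro
      nerve_algebra_axioms.intro assms local_ring.axioms(1)[OF local])
  have "string_algebra R \<mm> (quotient_algebra (path_algebra R Q) I)" if "biserial Q"
    unfolding string_algebra_def
    using local assms(1) that N.nerve_ideal_ideal N.nerve_ideal_admissible N.nerve_ideal_special
      N.nerve_ideal_arrow_direct assms(9,10) by blast
  then show ?thesis using N.admissible_path_notin_nerve_ideal assms(10) by blast
qed

end
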